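(* Let $R>1$ be fixed and let $K_R=\{z\in\mathbb C: R^{-1}\le|z|\le R\}$. Let $p_n$ be the Gaussian SU(2) polynomial of degree $n$ with zeros $z_1,\dots,z_n$ and critical point set $\mathcal C_n=\{\beta\in\mathbb C:p_n'(\beta)=0\}$. Let $I$ be uniformly distributed on $\{1,\dots,n\}$, independently of $p_n$, and let $z_I$ be the corresponding zero. Condition on the event $z_I\in K_R$. Let $\beta_I\in\mathcal C_n$ be the nearest critical point to $z_I$ in Fubini--Study distance. Then, in the affine coordinate, $$n(\beta_I-z_I)+\frac{1}{V_{\mathrm{FS}}(z_I)}\to 0$$ in probability as $n\to\infty$, conditionally on $z_I\in K_R$, where $V_{\mathrm{FS}}(z)=\frac{\bar z}{1+|z|^2}$. Consequently, with $D_n(z_I)=\min_{\beta\in\mathcal C_n}d_{\mathrm{FS}}(z_I,\beta)$, $$nD_n(z_I)-\frac{2}{|z_I|}\to0$$ in probability as $n\to\infty$, conditionally on $z_I\in K_R$.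
   Context: The Gaussian SU(2) polynomial of degree $n$ is $p_n(z)=\sum_{k=0}^n a_k\binom nk^{1/2}z^k$, $z\in\mathbb C$, where $a_0,\dots,a_n$ are i.i.d. standard complex Gaussian random variables ($\mathbb E[a_k]=0$, $\mathbb E[a_k\overline{a_j}]=\delta_{kj}$, $\mathbb E[a_ka_j]=0$). Almost surely $p_n$ has degree $n$ and its zeros $z_1,\dots,z_n\in\mathbb C$ are simple. $\mathbb C$ is identified with $\mathbb{CP}^1\setminus\{\infty\}$ (the affine coordinate), and $d_{\mathrm{FS}}$ is the geodesic distance on $\mathbb{CP}^1$ of the Fubini--Study metric $ds^2=\frac{4|dz|^2}{(1+|z|^2)^2}$ (this is the spherical geodesic distance on the unit sphere $S^2$). "$X_n\to0$ in probability, conditionally on $z_I\in K_R$" means that $\mathbb P(|X_n|>\eta\mid z_I\in K_R)\to0$ as $n\to\infty$ for every $\eta>0$. *)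

theory Defs
  imports "HOL-Probability.Probability" "HOL-Computational_Algebra.Computational_Algebra"
begin

section \<open>The Gaussian SU(2) polynomial\<close>

definition su2_poly :: "nat \<Rightarrow> (nat \<Rightarrow> complex) \<Rightarrow> complex poly" where
  "su2_poly n a = (\<Sum>k\<le>n. monom (a k * complex_of_real (sqrt (real (n choose k)))) k)"

text \<open>
  The circularly symmetric normal law on the complex plane, normalised by \<open>E[X] = 0\<close>,
  \<open>E[\<bar>X\<bar>\<^sup>2] = 1\<close> and \<open>E[X\<^sup>2] = 0\<close>: real and imaginary part are independent centred
  normal variables of variance \<open>1/2\<close>.
\<close>

definition std_complex_gaussian :: "'w measure \<Rightarrow> ('w \<Rightarrow> complex) \<Rightarrow> bool" where
  "std_complex_gaussian M X \<longleftrightarrow>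
     distributed M lborel X (\<lambda>z. ennreal (exp (- (cmod z)\<^sup>2) / pi))"

text \<open>
  The library's \<open>indep_var\<close> requires both variables to take values in the same type; this is the
  same notion for variables with values in different types.
\<close>

definition indep_var2 ::
  "'w measure \<Rightarrow> 'b measure \<Rightarrow> ('w \<Rightarrow> 'b) \<Rightarrow> 'c measure \<Rightarrow> ('w \<Rightarrow> 'c) \<Rightarrow> bool" where
  "indep_var2 M S X T Y \<longleftrightarrow> X \<in> measurable M S \<and> Y \<in> measurable M T \<and>
     prob_space.indep_set M {X -` A \<inter> space M | A. A \<in> sets S} {Y -` B \<inter> space M | B. B \<in> sets T}"

text \<open>
  A measurable way of writing the zeros of a degree \<open>n\<close> polynomial as \<open>z\<^sub>1, \<dots>, z\<^sub>n\<close>,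
  as a function of the coefficient vector. Zeros are listed with multiplicity, so that their
  simplicity (which holds almost surely) need not be presupposed.
\<close>

definition zero_labelling :: "nat \<Rightarrow> ((nat \<Rightarrow> complex) \<Rightarrow> nat \<Rightarrow> complex) \<Rightarrow> bool" where
  "zero_labelling n \<zeta> \<longleftrightarrow>
     (\<forall>i\<in>{1..n}. (\<lambda>a. \<zeta> a i) \<in> borel_measurable (PiM {..n} (\<lambda>_. borel))) \<and>
     (\<forall>a\<in>PiE {..n} (\<lambda>_. UNIV). a n \<noteq> 0 \<longrightarrow>
        proots (su2_poly n a) = image_mset (\<zeta> a) (mset_set {1..n}))"

definition critical_points :: "complex poly \<Rightarrow> complex set" where
  "critical_points p = {\<beta>. poly (pderiv p) \<beta> = 0}"

definition annulus :: "real \<Rightarrow> complex set" where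
  "annulus R = {z. inverse R \<le> cmod z \<and> cmod z \<le> R}"

definition V_FS :: "complex \<Rightarrow> complex" where
  "V_FS z = cnj z / complex_of_real (1 + (cmod z)\<^sup>2)"


section \<open>The Fubini--Study distance\<close>

definition fs_speed :: "(real \<Rightarrow> complex) \<Rightarrow> real \<Rightarrow> real" where
  "fs_speed g t = 2 * cmod (vector_derivative g (at t)) / (1 + (cmod (g t))\<^sup>2)"

text \<open>
  The geodesic distance between two points of the affine chart, as the infimum of the lengths of
  piecewise C1 curves. Curves through the point at infinity are left out, which does not change the
  infimum; the theorem \<open>fs_dist_eq_spherical\<close> below identifies the result with the angle
  between the corresponding points of the unit sphere. A \<^const>\<open>valid_path\<close> may have infinite
  length; \<^const>\<open>has_integral\<close> excludes such curves.
\<close>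

definition fs_dist :: "complex \<Rightarrow> complex \<Rightarrow> real" where
  "fs_dist z w = Inf {L. \<exists>g. valid_path g \<and> pathstart g = z \<and> pathfinish g = w \<and>
                             (fs_speed g has_integral L) {0..1}}"

definition inv_stereographic :: "complex \<Rightarrow> complex \<times> real" where
  "inv_stereographic z =
     ((2 / (1 + (cmod z)\<^sup>2)) *\<^sub>R z, ((cmod z)\<^sup>2 - 1) / (1 + (cmod z)\<^sup>2))"

lemma one_plus_pos: "1 + (cmod z)\<^sup>2 > 0"
  by (simp add: add_pos_nonneg)

lemma norm_inv_stereographic: "inv_stereographic z \<bullet> inv_stereographic z = 1"
proof -
  have p: "1 + (cmod z)\<^sup>2 \<noteq> 0" using one_plus_pos[of z] by linarith
  have "inv_stereographic z \<bullet> inv_stereographic z =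
     (4 * (cmod z)\<^sup>2 + ((cmod z)\<^sup>2 - 1)\<^sup>2) / (1 + (cmod z)\<^sup>2)\<^sup>2"
    unfolding inv_stereographic_def inner_Pair
    by (simp add: power2_norm_eq_inner[symmetric] power2_eq_square add_divide_distrib
        del: inner_real_def)
  also have "4 * (cmod z)\<^sup>2 + ((cmod z)\<^sup>2 - 1)\<^sup>2 = (1 + (cmod z)\<^sup>2)\<^sup>2" by algebra
  finally show ?thesis using p by simp
qed

lemma inv_stereographic_derivative:
  assumes g: "(g has_vector_derivative g') (at t)"
  obtains u where "((\<lambda>t. inv_stereographic (g t)) has_vector_derivative u) (at t)"
    "norm u = 2 * cmod g' / (1 + (cmod (g t))\<^sup>2)" "inv_stereographic (g t) \<bullet> u = 0"
proof -
  define v where "v = 1 / (1 + g t \<bullet> g t)"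
  define p where "p = g t \<bullet> g'"
  define v' where "v' = - 2 * p * v\<^sup>2"
  define u where "u = ((2 * v) *\<^sub>R g' + (2 * v') *\<^sub>R g t, - 2 * v')"
  have pos: "1 + x \<bullet> x \<noteq> 0" for x :: complex
    using inner_ge_zero[of x] by linarith
  have vpos: "v > 0" unfolding v_def using inner_ge_zero[of "g t"] by (simp add: add_pos_nonneg)
  have gg: "v * (g t \<bullet> g t) = 1 - v" unfolding v_def using pos[of "g t"] by (simp add: field_simps)
  have eq: "inv_stereographic z = ((2 * (1 / (1 + z \<bullet> z))) *\<^sub>R z, 1 - 2 * (1 / (1 + z \<bullet> z)))" for z
    using pos[of z] by (simp add: inv_stereographic_def power2_norm_eq_inner divide_simps)
  have dv: "((\<lambda>t. 1 / (1 + g t \<bullet> g t)) has_real_derivative v') (at t)"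
    using g pos[of "g t"] unfolding has_field_derivative_def has_vector_derivative_def v'_def v_def p_def
    by (auto intro!: derivative_eq_intros simp: fun_eq_iff inner_commute field_simps power2_eq_square)
  hence "((\<lambda>t. inv_stereographic (g t)) has_vector_derivative u) (at t)"
    unfolding eq u_def
  proof (intro has_vector_derivative_Pair)
    show "((\<lambda>t. (2 * (1 / (1 + g t \<bullet> g t))) *\<^sub>R g t) has_vector_derivative
            (2 * v) *\<^sub>R g' + (2 * v') *\<^sub>R g t) (at t)"
      using has_vector_derivative_scaleR[OF DERIV_cmult[OF dv, of 2] g] by (simp add: v_def)
    show "((\<lambda>t. 1 - 2 * (1 / (1 + g t \<bullet> g t))) has_vector_derivative - 2 * v') (at t)"
      unfolding has_real_derivative_iff_has_vector_derivative[symmetric]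
      using DERIV_diff[OF DERIV_const DERIV_cmult[OF dv, of 2], of 1] by simp
  qed
  moreover have "inv_stereographic (g t) \<bullet> u = 0"
  proof -
    have "inv_stereographic (g t) \<bullet> u = 4 * v\<^sup>2 * p + 4 * v' * (v * (g t \<bullet> g t)) - 2 * v' * (1 - 2 * v)"
      unfolding eq u_def v_def[symmetric]
      by (simp add: inner_add_right p_def power2_eq_square algebra_simps)
    also have "\<dots> = 0" unfolding gg v'_def by (simp add: algebra_simps power2_eq_square)
    finally show ?thesis .
  qed
  moreover have "norm u = 2 * cmod g' / (1 + (cmod (g t))\<^sup>2)"
  proof -
    have "u \<bullet> u = 4 * v\<^sup>2 * (g' \<bullet> g') + 8 * v * v' * p + 4 * v'\<^sup>2 * (g t \<bullet> g t) + 4 * v'\<^sup>2"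
      unfolding u_def
      by (simp add: inner_add_right inner_add_left p_def power2_eq_square algebra_simps inner_commute)
    also have "\<dots> = 4 * v\<^sup>2 * (g' \<bullet> g') + 8 * v * v' * p + 16 * p\<^sup>2 * v ^ 3 * (v * (g t \<bullet> g t) + v)"
      unfolding v'_def by (simp add: algebra_simps eval_nat_numeral)
    also have "\<dots> = (2 * v * cmod g')\<^sup>2"
      unfolding gg v'_def power_mult_distrib
      by (simp add: algebra_simps dot_square_norm eval_nat_numeral)
    finally have "norm u = \<bar>2 * v * cmod g'\<bar>" by (simp add: norm_eq_sqrt_inner)
    also have "\<dots> = 2 * v * cmod g'" using vpos by simp
    finally show ?thesis by (simp add: v_def power2_norm_eq_inner)
  qed
  ultimately show ?thesis using that by blast
qed

lemma fs_length_lower: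
  assumes vp: "valid_path g" and L: "(fs_speed g has_integral L) {0..1}"
  shows "arccos (inv_stereographic (g 0) \<bullet> inv_stereographic (g 1)) \<le> L"
proof -
  define u0 where "u0 = inv_stereographic (g 0)"
  define c where "c = (\<lambda>t. u0 \<bullet> inv_stereographic (g t))"
  have u0: "u0 \<bullet> u0 = 1" by (simp add: u0_def norm_inv_stereographic)
  have cbd: "\<bar>c t\<bar> \<le> 1" for t
    using Cauchy_Schwarz_ineq2[of u0 "inv_stereographic (g t)"]
    by (simp add: c_def u0_def norm_eq_sqrt_inner norm_inv_stereographic)
  from vp obtain S where S: "finite S" "\<And>t. t \<in> {0..1} - S \<Longrightarrow> g differentiable at t"
      and cont: "continuous_on {0..1} g"
    unfolding valid_path_def piecewise_C1_differentiable_on_def C1_differentiable_on_eq by blast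
  have contc: "continuous_on {0..1} c"
    unfolding c_def inv_stereographic_def using cont one_plus_pos
    by (intro continuous_intros) (auto simp: less_imp_neq[symmetric])
  have bound: "arccos (r * c 1) - arccos (r * c 0) \<le> L" if r: "0 < r" "r < 1" for r
  proof -
    have rc: "\<bar>r * c t\<bar> < 1" for t
    proof -
      have "\<bar>r * c t\<bar> \<le> r * 1" using r cbd[of t] by (simp add: abs_mult)
      thus ?thesis using r by linarith
    qed
    have "\<exists>d. ((\<lambda>t. arccos (r * c t)) has_vector_derivative d) (at t) \<and> d \<le> fs_speed g t"
      if t: "t \<in> {0..1} - S" for t
    proof -
      from S(2)[OF t] have "(g has_vector_derivative vector_derivative g (at t)) (at t)"
        by (simp add: vector_derivative_works)
      then obtain u where u: "((\<lambda>t. inv_stereographic (g t)) has_vector_derivative u) (at t)"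
        "norm u = fs_speed g t" "inv_stereographic (g t) \<bullet> u = 0"
        unfolding fs_speed_def by (rule inv_stereographic_derivative)
      have dc: "(c has_real_derivative (u0 \<bullet> u)) (at t)"
        unfolding c_def has_real_derivative_iff_has_vector_derivative
        by (rule bounded_linear.has_vector_derivative[OF bounded_linear_inner_right u(1)])
      have "u0 \<bullet> u = (u0 - c t *\<^sub>R inv_stereographic (g t)) \<bullet> u"
        by (simp add: inner_diff_left u(3))
      hence "\<bar>u0 \<bullet> u\<bar> \<le> norm (u0 - c t *\<^sub>R inv_stereographic (g t)) * norm u"
        using Cauchy_Schwarz_ineq2 by metis
      also have "norm (u0 - c t *\<^sub>R inv_stereographic (g t)) = sqrt (1 - (c t)\<^sup>2)"
        unfolding norm_eq_sqrt_inner
        by (simp add: inner_diff_left inner_diff_right u0 norm_inv_stereographic inner_commute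
            c_def[symmetric] power2_eq_square)
          (simp add: c_def inner_commute)
      finally have *: "\<bar>u0 \<bullet> u\<bar> \<le> sqrt (1 - (c t)\<^sup>2) * norm u" .
      define d where "d = inverse (- sqrt (1 - (r * c t)\<^sup>2)) * (r * (u0 \<bullet> u))"
      have sq: "(r * c t)\<^sup>2 < 1" using rc[of t] by (simp add: abs_square_less_1)
      have "((\<lambda>t. arccos (r * c t)) has_real_derivative d) (at t)"
        unfolding d_def using rc[of t]
        by (intro DERIV_chain2[where f = arccos] DERIV_arccos DERIV_cmult dc) auto
      moreover have "d \<le> fs_speed g t"
      proof -
        have pos: "0 < sqrt (1 - (r * c t)\<^sup>2)" using sq by simp
        have "d \<le> \<bar>d\<bar>" by simp
        also have "\<bar>d\<bar> = r * \<bar>u0 \<bullet> u\<bar> / sqrt (1 - (r * c t)\<^sup>2)"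
          unfolding d_def using r sq by (simp add: abs_mult divide_inverse)
        also have "\<dots> \<le> norm u"
        proof -
          have "r * \<bar>u0 \<bullet> u\<bar> \<le> r * (sqrt (1 - (c t)\<^sup>2) * norm u)"
            using * r by (intro mult_left_mono) auto
          also have "\<dots> = sqrt (r\<^sup>2 * (1 - (c t)\<^sup>2)) * norm u"
            using r by (simp add: real_sqrt_mult)
          also have "\<dots> \<le> sqrt (1 - (r * c t)\<^sup>2) * norm u"
          proof (intro mult_right_mono real_sqrt_le_mono)
            have "r\<^sup>2 \<le> 1" using r by (simp add: power_le_one)
            thus "r\<^sup>2 * (1 - (c t)\<^sup>2) \<le> 1 - (r * c t)\<^sup>2" by (simp add: algebra_simps power_mult_distrib)
          qed simp
          finally show ?thesis using pos by (simp add: field_simps)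
        qed
        finally show ?thesis using u(2) by simp
      qed
      ultimately show ?thesis by (auto simp: has_real_derivative_iff_has_vector_derivative)
    qed
    then obtain d where d: "\<And>t. t \<in> {0..1} - S \<Longrightarrow>
        ((\<lambda>t. arccos (r * c t)) has_vector_derivative d t) (at t) \<and> d t \<le> fs_speed g t"
      by metis
    have "(d has_integral (arccos (r * c 1) - arccos (r * c 0))) {0..1}"
    proof (rule fundamental_theorem_of_calculus_interior_strong[OF S(1)])
      show "continuous_on {0..1} (\<lambda>t. arccos (r * c t))"
        using rc contc by (intro continuous_intros) (auto simp: abs_less_iff less_imp_le)
    qed (use d in auto)
    hence "((\<lambda>t. if t \<in> S then fs_speed g t else d t) has_integral
              (arccos (r * c 1) - arccos (r * c 0))) {0..1}"
      by (rule has_integral_spike_finite[OF S(1), rotated]) auto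
    thus ?thesis using L by (rule has_integral_le) (use d in auto)
  qed
  have lim: "((\<lambda>r. arccos (r * x)) \<longlongrightarrow> arccos (1 * x)) (at_left 1)" if "\<bar>x\<bar> \<le> 1" for x :: real
  proof -
    have "\<forall>r\<in>{0..1}. -1 \<le> r * x \<and> r * x \<le> 1"
    proof
      fix r :: real assume "r \<in> {0..1}"
      hence "\<bar>r * x\<bar> \<le> 1" using that by (simp add: abs_mult mult_le_one)
      thus "-1 \<le> r * x \<and> r * x \<le> 1" by (auto simp: abs_le_iff)
    qed
    hence "continuous_on {0..1} (\<lambda>r. arccos (r * x))"
      by (intro continuous_on_arccos continuous_intros)
    hence "((\<lambda>r. arccos (r * x)) \<longlongrightarrow> arccos (1 * x)) (at 1 within {0..1})"
      unfolding continuous_on_def by (rule bspec) simp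
    thus ?thesis by (simp add: at_within_Icc_at_left)
  qed
  have "((\<lambda>r. arccos (r * c 1) - arccos (r * c 0)) \<longlongrightarrow> arccos (1 * c 1) - arccos (1 * c 0)) (at_left 1)"
    by (intro tendsto_diff lim cbd)
  moreover have "eventually (\<lambda>r. arccos (r * c 1) - arccos (r * c 0) \<le> L) (at_left 1)"
    using bound by (auto simp: eventually_at_left[of 0 1] intro!: exI[of _ "0::real"])
  ultimately have "arccos (1 * c 1) - arccos (1 * c 0) \<le> L"
    by (rule tendsto_upperbound) simp
  moreover have "c 0 = 1" using u0 by (simp add: c_def u0_def)
  ultimately show ?thesis by (simp add: c_def u0_def)
qed

lemma norm_rotation:
  assumes "c\<^sup>2 + (cmod b)\<^sup>2 = 1"
  shows "(cmod (z * of_real c + b))\<^sup>2 + (cmod (of_real c - cnj z * b))\<^sup>2 = 1 + (cmod z)\<^sup>2"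
proof -
  have "(cmod (z * of_real c + b))\<^sup>2 + (cmod (of_real c - cnj z * b))\<^sup>2 =
      (1 + (cmod z)\<^sup>2) * (c\<^sup>2 + (cmod b)\<^sup>2)"
    unfolding cmod_power2 by (simp add: algebra_simps power2_eq_square)
  thus ?thesis using assms by simp
qed

lemma fs_length_upper:
  fixes z u :: complex and \<phi> \<delta> :: real
  defines "D \<equiv> \<lambda>t::complex. cos (of_real \<phi> * t) - cnj z * (u * sin (of_real \<phi> * t) * exp (\<i> * of_real \<delta> * t * (1 - t)))"
  assumes u: "cmod u = 1" and nonneg: "0 \<le> \<phi>" "0 \<le> \<delta>"
    and nz: "\<And>t. t \<in> {0..1} \<Longrightarrow> D (of_real t) \<noteq> 0"
  obtains L g where "L \<le> 2 * (\<phi> + \<delta>)" "valid_path g" "pathstart g = z"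
    "pathfinish g = (z * of_real (cos \<phi>) + u * of_real (sin \<phi>)) /
                    (of_real (cos \<phi>) - cnj z * (u * of_real (sin \<phi>)))"
    "(fs_speed g has_integral L) {0..1}"
proof -
  define B where "B = (\<lambda>t::complex. u * sin (of_real \<phi> * t) * exp (\<i> * of_real \<delta> * t * (1 - t)))"
  define B' where "B' = (\<lambda>t::complex. u * exp (\<i> * of_real \<delta> * t * (1 - t)) *
     (of_real \<phi> * cos (of_real \<phi> * t) + \<i> * of_real \<delta> * (1 - 2 * t) * sin (of_real \<phi> * t)))"
  define A where "A = (\<lambda>t::complex. cos (of_real \<phi> * t))"
  define A' where "A' = (\<lambda>t::complex. - of_real \<phi> * sin (of_real \<phi> * t))"
  define g where "g = (\<lambda>t::real. (z * A (of_real t) + B (of_real t)) / D (of_real t))"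
  define W where "W = (\<lambda>t::complex. A t * B' t - A' t * B t)"
  define g' where "g' = (\<lambda>t::real. (1 + z * cnj z) * W (of_real t) / (D (of_real t))\<^sup>2)"
  have D: "D t = A t - cnj z * B t" for t by (simp add: D_def A_def B_def)
  have dA: "(A has_field_derivative A' t) (at t)" for t
    unfolding A_def A'_def by (auto intro!: derivative_eq_intros)
  have dB: "(B has_field_derivative B' t) (at t)" for t
    unfolding B_def B'_def by (auto intro!: derivative_eq_intros simp: algebra_simps)
  have dg: "(g has_vector_derivative g' t) (at t)" if "t \<in> {0..1}" for t
  proof -
    have "((\<lambda>t. (z * A t + B t) / D t) has_field_derivative
        ((z * A' (of_real t) + B' (of_real t)) * D (of_real t) - (z * A (of_real t) + B (of_real t)) *
           (A' (of_real t) - cnj z * B' (of_real t))) / (D (of_real t) * D (of_real t))) (at (of_real t))"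
      using nz[OF that] unfolding D
      by (intro DERIV_divide DERIV_add DERIV_diff DERIV_cmult dA dB) auto
    also have "((z * A' (of_real t) + B' (of_real t)) * D (of_real t) - (z * A (of_real t) + B (of_real t)) *
           (A' (of_real t) - cnj z * B' (of_real t))) / (D (of_real t) * D (of_real t)) = g' t"
      unfolding g'_def W_def D power2_eq_square
      by (rule arg_cong2[where f = "(/)"]) (simp_all add: algebra_simps)
    finally show ?thesis unfolding g_def by (rule has_vector_derivative_real_field)
  qed
  have cont: "continuous_on {0..1} (\<lambda>t. D (complex_of_real t))"
      "continuous_on {0..1} (\<lambda>t. W (complex_of_real t))"
    unfolding D_def W_def A_def A'_def B_def B'_def by (intro continuous_intros)+
  have "continuous_on {0..1} g'"
    unfolding g'_def using nz by (intro continuous_intros cont) auto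
  with dg have vp: "valid_path g"
    unfolding valid_path_def
    by (intro C1_differentiable_imp_piecewise) (unfold C1_differentiable_on_def, blast)
  have speed: "fs_speed g t = 2 * cmod (W (of_real t))" if t: "t \<in> {0..1}" for t
  proof -
    define d where "d = D (of_real t)"
    define b where "b = B (of_real t)"
    have d: "d \<noteq> 0" using nz[OF t] by (simp add: d_def)
    have Ar: "A (of_real t) = of_real (cos (\<phi> * t))" by (simp add: A_def cos_of_real[symmetric])
    have "cmod b = \<bar>sin (\<phi> * t)\<bar>"
    proof -
      have "b = u * of_real (sin (\<phi> * t)) * cis (\<delta> * t * (1 - t))"
        by (simp add: b_def B_def cis_conv_exp sin_of_real[symmetric] mult.assoc)
      thus ?thesis using u by (simp add: norm_mult)
    qed
    hence "(cos (\<phi> * t))\<^sup>2 + (cmod b)\<^sup>2 = 1" by simp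
    from norm_rotation[OF this, of z]
    have N: "(cmod (z * A (of_real t) + b))\<^sup>2 + (cmod d)\<^sup>2 = 1 + (cmod z)\<^sup>2"
      by (simp add: d_def D Ar b_def)
    have "1 + z * cnj z = of_real (1 + (cmod z)\<^sup>2)" by (simp add: complex_norm_square[symmetric])
    hence "cmod (g' t) = (1 + (cmod z)\<^sup>2) * cmod (W (of_real t)) / (cmod d)\<^sup>2"
      unfolding g'_def using one_plus_pos[of z]
      by (simp add: norm_mult norm_divide norm_power d_def del: of_real_add)
    moreover have "1 + (cmod (g t))\<^sup>2 = (1 + (cmod z)\<^sup>2) / (cmod d)\<^sup>2"
      unfolding N[symmetric] g_def d_def[symmetric] b_def[symmetric] using d
      by (simp add: norm_divide power_divide field_simps)
    moreover have "1 + (cmod z)\<^sup>2 \<noteq> 0" using one_plus_pos[of z] by linarith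
    ultimately show ?thesis
      unfolding fs_speed_def vector_derivative_at[OF dg[OF t]] using d by simp
  qed
  have Wle: "2 * cmod (W (of_real t)) \<le> 2 * (\<phi> + \<delta>)" if t: "t \<in> {0..1}" for t
  proof -
    define e where "e = cis (\<delta> * t * (1 - t))"
    define c where "c = cos (\<phi> * t)"
    define s where "s = sin (\<phi> * t)"
    have sc: "complex_of_real s * of_real s + of_real c * of_real c = 1"
      unfolding of_real_mult[symmetric] of_real_add[symmetric] s_def c_def
      by (simp flip: power2_eq_square)
    have "W (of_real t) = u * e * (of_real \<phi> * (of_real s * of_real s + of_real c * of_real c) +
             \<i> * of_real (\<delta> * (1 - 2 * t) * s * c))"
    proof -
      have "cos (of_real \<phi> * of_real t) = complex_of_real c"
        "sin (of_real \<phi> * of_real t) = complex_of_real s"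
        "exp (\<i> * of_real \<delta> * of_real t * (1 - of_real t)) = e"
        by (simp_all add: c_def s_def e_def cis_conv_exp sin_of_real[symmetric] cos_of_real[symmetric]
            mult.assoc)
      thus ?thesis unfolding W_def A_def A'_def B_def B'_def by (simp add: algebra_simps)
    qed
    hence "cmod (W (of_real t)) = cmod (of_real \<phi> + \<i> * of_real (\<delta> * (1 - 2 * t) * s * c))"
      unfolding sc using u by (simp add: norm_mult e_def)
    also have "\<dots> \<le> cmod (of_real \<phi>) + cmod (\<i> * of_real (\<delta> * (1 - 2 * t) * s * c))"
      by (rule norm_triangle_ineq)
    also have "\<dots> = \<phi> + \<delta> * (\<bar>1 - 2 * t\<bar> * (\<bar>s\<bar> * \<bar>c\<bar>))"
      using nonneg by (simp only: norm_mult norm_of_real norm_ii abs_mult)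
    also have "\<dots> \<le> \<phi> + \<delta> * (1 * (1 * 1))"
      using nonneg t by (intro add_left_mono mult_left_mono mult_mono) (auto simp: s_def c_def)
    finally show ?thesis by simp
  qed
  have "(\<lambda>t. 2 * cmod (W (of_real t))) integrable_on {0..1::real}"
    by (intro integrable_continuous_real continuous_intros cont)
  then obtain L where L: "((\<lambda>t. 2 * cmod (W (of_real t))) has_integral L) {0..1::real}" by blast
  have "L \<le> 2 * (\<phi> + \<delta>)"
    using has_integral_le[OF L has_integral_const_real[of "2 * (\<phi> + \<delta>)" 0 1]] Wle by simp
  moreover have "(fs_speed g has_integral L) {0..1}"
    using L by (rule has_integral_eq[rotated]) (simp add: speed)
  moreover have "pathstart g = z" by (simp add: pathstart_def g_def D A_def B_def)
  moreover have "pathfinish g = (z * of_real (cos \<phi>) + u * of_real (sin \<phi>)) /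
                    (of_real (cos \<phi>) - cnj z * (u * of_real (sin \<phi>)))"
    by (simp add: pathfinish_def g_def D A_def B_def cos_of_real sin_of_real)
  ultimately show ?thesis using that vp by blast
qed

theorem fs_dist_eq_spherical:
  "fs_dist z w = arccos (inv_stereographic z \<bullet> inv_stereographic w)"
proof -
  obtain \<phi> u where \<phi>: "0 \<le> \<phi>" "\<phi> \<le> pi / 2" and u: "cmod u = 1"
    and d: "of_real (cos \<phi>) - cnj z * (u * of_real (sin \<phi>)) \<noteq> 0"     and w: "w = (z * of_real (cos \<phi>) + u * of_real (sin \<phi>)) /
              (of_real (cos \<phi>) - cnj z * (u * of_real (sin \<phi>)))"
  proof (cases "1 + cnj z * w = 0")
    case False
    define q where "q = (w - z) / (1 + cnj z * w)"
    define u where "u = (if q = 0 then 1 else q / of_real (cmod q))"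
    define \<phi> where "\<phi> = arctan (cmod q)"
    have c: "cos \<phi> > 0" by (simp add: \<phi>_def cos_arctan add_pos_nonneg)
    have "sin \<phi> = cmod q * cos \<phi>" by (simp add: \<phi>_def cos_arctan sin_arctan)
    hence us: "u * of_real (sin \<phi>) = q * of_real (cos \<phi>)" by (simp add: u_def)
    have "1 + z * cnj z = of_real (1 + (cmod z)\<^sup>2)" by (simp add: complex_norm_square[symmetric])
    hence zz: "1 + z * cnj z \<noteq> 0" using one_plus_pos[of z] by (simp del: of_real_add)
    have q1: "1 - cnj z * q = (1 + z * cnj z) / (1 + cnj z * w)"
      unfolding q_def using False by (simp add: field_simps)
    have q2: "z + q = w * (1 + z * cnj z) / (1 + cnj z * w)"
      unfolding q_def using False by (simp add: field_simps)
    have e1: "of_real (cos \<phi>) - cnj z * (u * of_real (sin \<phi>)) = (1 - cnj z * q) * of_real (cos \<phi>)"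
      unfolding us by (simp add: algebra_simps)
    have e2: "z * of_real (cos \<phi>) + u * of_real (sin \<phi>) = (z + q) * of_real (cos \<phi>)"
      unfolding us by (simp add: algebra_simps)
    show ?thesis
    proof (rule that[of \<phi> u])
      show "0 \<le> \<phi>" "\<phi> \<le> pi / 2" using arctan_ubound[of "cmod q"] by (auto simp: \<phi>_def)
      show "cmod u = 1" by (simp add: u_def norm_divide)
      show "of_real (cos \<phi>) - cnj z * (u * of_real (sin \<phi>)) \<noteq> 0"
        unfolding e1 q1 using zz c False by simp
      show "w = (z * of_real (cos \<phi>) + u * of_real (sin \<phi>)) /
                (of_real (cos \<phi>) - cnj z * (u * of_real (sin \<phi>)))"
        unfolding e1 e2 q1 q2 using zz c False by simp
    qed
  next
    case True
    hence "z \<noteq> 0" by auto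
    moreover from this have "w = - 1 / cnj z" using True by (simp add: field_simps add_eq_0_iff)
    ultimately show ?thesis by (intro that[of "pi / 2" 1]) auto
  qed
  let ?d = "of_real (cos \<phi>) - cnj z * (u * of_real (sin \<phi>))"
  let ?X = "{L. \<exists>g. valid_path g \<and> pathstart g = z \<and> pathfinish g = w \<and>
                             (fs_speed g has_integral L) {0..1}}"
  have inner: "inv_stereographic z \<bullet> inv_stereographic w = cos (2 * \<phi>)"
  proof -
    have "(cos \<phi>)\<^sup>2 + (cmod (u * of_real (sin \<phi>)))\<^sup>2 = 1" using u by (simp add: norm_mult)
    from norm_rotation[OF this, of z]
    have N: "(cmod (z * of_real (cos \<phi>) + u * of_real (sin \<phi>)))\<^sup>2 + (cmod ?d)\<^sup>2 = 1 + (cmod z)\<^sup>2" .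
    have w1: "1 + (cmod w)\<^sup>2 = (1 + (cmod z)\<^sup>2) / (cmod ?d)\<^sup>2"
      unfolding N[symmetric] unfolding w using d by (simp add: norm_divide power_divide field_simps)
    have "w - z = u * of_real (sin \<phi>) * (1 + z * cnj z) / ?d"
      unfolding w using d by (simp add: field_simps)
    moreover have "1 + z * cnj z = of_real (1 + (cmod z)\<^sup>2)" by (simp add: complex_norm_square[symmetric])
    ultimately have "(cmod (w - z))\<^sup>2 = (sin \<phi>)\<^sup>2 * (1 + (cmod z)\<^sup>2)\<^sup>2 / (cmod ?d)\<^sup>2"
      using u by (simp add: norm_mult norm_divide power_mult_distrib power_divide del: of_real_add)
    hence wz: "(cmod (w - z))\<^sup>2 = (sin \<phi>)\<^sup>2 * ((1 + (cmod z)\<^sup>2) * (1 + (cmod w)\<^sup>2))"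
      unfolding w1 by (simp add: power2_eq_square)
    have nz: "1 + (cmod z)\<^sup>2 \<noteq> 0" "1 + (cmod w)\<^sup>2 \<noteq> 0"
      using one_plus_pos[of z] one_plus_pos[of w] by linarith+
    have "inv_stereographic z \<bullet> inv_stereographic w =
       (4 * (z \<bullet> w) + ((cmod z)\<^sup>2 - 1) * ((cmod w)\<^sup>2 - 1)) / ((1 + (cmod z)\<^sup>2) * (1 + (cmod w)\<^sup>2))"
      unfolding inv_stereographic_def inner_Pair by (simp add: add_divide_distrib)
    also have "4 * (z \<bullet> w) + ((cmod z)\<^sup>2 - 1) * ((cmod w)\<^sup>2 - 1) =
       (1 + (cmod z)\<^sup>2) * (1 + (cmod w)\<^sup>2) - 2 * (cmod (w - z))\<^sup>2"
      unfolding power2_norm_eq_inner by (simp add: inner_diff_left inner_diff_right inner_commute algebra_simps)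
    also have "\<dots> / ((1 + (cmod z)\<^sup>2) * (1 + (cmod w)\<^sup>2)) = 1 - 2 * (sin \<phi>)\<^sup>2"
      unfolding wz using nz by (simp add: diff_divide_distrib)
    also have "\<dots> = cos (2 * \<phi>)" by (simp add: cos_double_sin)
    finally show ?thesis .
  qed
  have acos: "arccos (inv_stereographic z \<bullet> inv_stereographic w) = 2 * \<phi>"
    unfolding inner using \<phi> by (intro arccos_cos) auto
  have lower: "2 * \<phi> \<le> L" if "L \<in> ?X" for L
  proof -
    from that obtain g where "valid_path g" "g 0 = z" "g 1 = w" "(fs_speed g has_integral L) {0..1}"
      by (auto simp: pathstart_def pathfinish_def)
    thus ?thesis using fs_length_lower[of g L] acos by simp
  qed
  have upper: "\<exists>L\<in>?X. L \<le> 2 * \<phi> + \<epsilon>" if "\<epsilon> > 0" for \<epsilon>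
  proof -
    have "\<exists>\<delta>. 0 \<le> \<delta> \<and> \<delta> \<le> \<epsilon> / 2 \<and> (\<forall>t\<in>{0..1}. cos (\<phi> * t) - cnj z * (u * sin (\<phi> * t) * cis (\<delta> * t * (1 - t))) \<noteq> 0)"
    proof (cases "\<forall>t\<in>{0..1}. cos (\<phi> * t) - cnj z * (u * sin (\<phi> * t) * cis (0 * t * (1 - t))) \<noteq> 0")
      case True
      thus ?thesis using \<open>\<epsilon> > 0\<close> by (intro exI[of _ 0]) auto
    next
      case False
      then obtain t0 where t0: "complex_of_real (cos (\<phi> * t0)) = cnj z * u * sin (\<phi> * t0)"
        by (auto simp: mult.assoc)
      have s0: "sin (\<phi> * t0) \<noteq> 0"
        using t0 sin_cos_squared_add[of "\<phi> * t0"] by (cases "sin (\<phi> * t0) = 0") auto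
      define r where "r = cos (\<phi> * t0) / sin (\<phi> * t0)"
      have r: "cnj z * u = of_real r" using t0 s0 by (simp add: r_def field_simps)
      define \<delta> where "\<delta> = min (\<epsilon> / 2) 1"
      have \<delta>: "0 < \<delta>" "\<delta> \<le> \<epsilon> / 2" "\<delta> \<le> 1" using \<open>\<epsilon> > 0\<close> by (auto simp: \<delta>_def)
      have "cos (\<phi> * t) - cnj z * (u * sin (\<phi> * t) * cis (\<delta> * t * (1 - t))) \<noteq> 0" if t: "t \<in> {0..1}" for t
      proof
        assume "cos (\<phi> * t) - cnj z * (u * sin (\<phi> * t) * cis (\<delta> * t * (1 - t))) = 0"
        hence eq: "complex_of_real (cos (\<phi> * t)) = of_real (r * sin (\<phi> * t)) * cis (\<delta> * t * (1 - t))"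
          by (simp add: r[symmetric] mult_ac)
        consider "t = 0" | "t = 1" | "0 < t" "t < 1" using t by force
        thus False
        proof cases
          case 1
          thus ?thesis using eq by simp
        next
          case 2
          hence "?d = 0" using eq by (simp add: r[symmetric] mult_ac)
          thus ?thesis using d by simp
        next
          case 3
          have "\<delta> * t * (1 - t) \<le> 1 * 1 * 1" using 3 \<delta> by (intro mult_mono) auto
          moreover have "0 < \<delta> * t * (1 - t)" using 3 \<delta> by simp
          ultimately have "sin (\<delta> * t * (1 - t)) \<noteq> 0"
            using sin_gt_zero[of "\<delta> * t * (1 - t)"] pi_gt3 by linarith
          moreover have "r * sin (\<phi> * t) * sin (\<delta> * t * (1 - t)) = 0"
            using arg_cong[OF eq, of Im] by simp
          ultimately have "cos (\<phi> * t) = 0" using eq by auto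
          moreover have "\<phi> * t < pi / 2"
          proof (cases "\<phi> = 0")
            case False
            hence "\<phi> * t < \<phi> * 1" using 3 \<phi> by (intro mult_strict_left_mono) auto
            thus ?thesis using \<phi> by linarith
          qed simp
          moreover have "0 \<le> \<phi> * t" using 3 \<phi> by simp
          ultimately show False using cos_gt_zero_pi[of "\<phi> * t"] pi_gt_zero by linarith
        qed
      qed
      thus ?thesis using \<delta> by (intro exI[of _ \<delta>]) auto
    qed
    then obtain \<delta> where \<delta>: "0 \<le> \<delta>" "\<delta> \<le> \<epsilon> / 2"
      and nz: "\<And>t. t \<in> {0..1} \<Longrightarrow>
         cos (\<phi> * t) - cnj z * (u * sin (\<phi> * t) * cis (\<delta> * t * (1 - t))) \<noteq> 0"
      by blast
    have "cos (of_real \<phi> * of_real t) - cnj z * (u * sin (of_real \<phi> * of_real t) *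
            exp (\<i> * of_real \<delta> * of_real t * (1 - of_real t))) \<noteq> 0" if "t \<in> {0..1}" for t :: real
      using nz[OF that] by (simp add: cis_conv_exp cos_of_real[symmetric] sin_of_real[symmetric] mult.assoc)
    from fs_length_upper[OF u \<phi>(1) \<delta>(1) this] obtain L g where
      "L \<le> 2 * (\<phi> + \<delta>)" "valid_path g" "pathstart g = z" "pathfinish g = w"
      "(fs_speed g has_integral L) {0..1}"
      unfolding w by metis
    thus ?thesis using \<delta> by (intro bexI[of _ L]) auto
  qed
  have "Inf ?X = 2 * \<phi>"
  proof (rule antisym)
    show "Inf ?X \<le> 2 * \<phi>"
    proof (rule field_le_epsilon)
      fix \<epsilon> :: real assume "\<epsilon> > 0"
      from upper[OF this] obtain L where "L \<in> ?X" "L \<le> 2 * \<phi> + \<epsilon>" by blast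
      moreover have "bdd_below ?X" using lower by (intro bdd_belowI)
      ultimately show "Inf ?X \<le> 2 * \<phi> + \<epsilon>" by (rule cInf_lower2)
    qed
    show "2 * \<phi> \<le> Inf ?X" using upper[of 1] lower by (intro cInf_greatest) auto
  qed
  thus ?thesis by (simp add: fs_dist_def acos)
qed

end

theory Submission
  imports Defs "HOL-Complex_Analysis.Complex_Analysis"
begin

text \<open>
  Near a zero \<open>z\<close> write \<open>p(z + t) = (1 + |z|\<^sup>2)\<^bsup>n/2\<^esup> e\<^bsup>n V t\<^esup> f(t)\<close> with \<open>V = V_FS z\<close>. The second moments
  of \<open>f\<close> are bounded for \<open>|t| \<le> n\<^bsup>-1/2\<^esup>\<close>, so by Cauchy's formula \<open>f''\<close> is of order \<open>n\<close> there, whereas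
  \<open>f'(0)\<close> is typically of order \<open>n\<^bsup>1/2\<^esup>\<close>. Hence, for \<open>t = s/n\<close> with \<open>s\<close> bounded, the equation
  \<open>f'(t) + n V f(t) = 0\<close> for the critical points is a small perturbation of \<open>f'(0) (1 + V s) = 0\<close>, and
  the only critical point at distance \<open>O(1/n)\<close> from \<open>z\<close> is close to \<open>z - 1/(n V)\<close>.

  By the Kac--Rice formula the expected number of zeros in the annulus for which \<open>|f'(0)|\<close> is at most a
  constant times the \<open>L\<^sup>2\<close> mean of \<open>f\<close> over the circle \<open>|t| = n\<^bsup>-1/2\<^esup>\<close> is bounded in \<open>n\<close>: the weight
  \<open>|p'(z)|\<^sup>2\<close> is then dominated by a bounded second moment, so no lower tail estimate is needed. The total
  number of zeros in the annulus is of order \<open>n\<close>.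
\<close>

section \<open>The area formula for polynomials\<close>

text \<open>Badness of a zero is measured by an L2 mean over a circle and not by a supremum of |f|:
  by Fubini its expectation reduces to second moments at single points, and Cauchy's formula still
  turns the mean into a bound for f''. The conditional law given a zero at z is never constructed:
  a_0 is eliminated, and the resulting weighted integral over a_1, ..., a_n is bounded by the
  unconditional second moment, because projecting a linear form away from evaluation at z only
  shrinks it. The second moments of f stay bounded because (1 + |z + t|^2) / (1 + |z|^2) is at most
  exp (2 Re (V t) + |t|^2); the exponential factor removes the linear term and leaves exp (n |t|^2),
  which is e on the circle. The constant \<open>\<kappa>\<close> depends on the accuracy wanted, but
  not on n. A uniformly chosen zero is bad and in the annulus with probability O(1/n), while it is
  in the annulus with probability bounded below, so the conditional probability is O(1/n) as well.
  Since critical points are located only within O(1/n) of z in the affine coordinate, a comparison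
  of Fubini--Study distances must first show that a nearest one lies there.\<close>

definition vec2 :: "complex \<Rightarrow> real^2" where "vec2 z = vector [Re z, Im z]"
definition unvec2 :: "real^2 \<Rightarrow> complex" where "unvec2 v = Complex (v$1) (v$2)"

lemma unvec2_vec2 [simp]: "unvec2 (vec2 z) = z"
  by (simp add: vec2_def unvec2_def)

lemma vec2_unvec2 [simp]: "vec2 (unvec2 v) = v"
  by (simp add: vec2_def unvec2_def vec_eq_iff forall_2)

lemma linear_vec2: "linear vec2" and linear_unvec2: "linear unvec2"
  by (auto intro!: linearI simp: vec2_def unvec2_def vec_eq_iff forall_2 complex_eq_iff)

lemma bounded_linear_vec2: "bounded_linear vec2" and bounded_linear_unvec2: "bounded_linear unvec2"
  using linear_vec2 linear_unvec2 by (simp_all add: linear_conv_bounded_linear)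

lemma measurable_vec2 [measurable]: "vec2 \<in> borel_measurable borel"
  and measurable_unvec2 [measurable]: "unvec2 \<in> borel_measurable borel"
  using bounded_linear_vec2 bounded_linear_unvec2
  by (auto intro!: borel_measurable_continuous_onI linear_continuous_on)

lemma distr_lborel_vec2: "distr lborel borel vec2 = lborel"
proof (rule lborel_eqI[symmetric])
  fix l u :: "real^2" assume le: "\<And>b. b \<in> Basis \<Longrightarrow> l \<bullet> b \<le> u \<bullet> b"
  have le': "l $ i \<le> u $ i" for i
    using le[of "axis i 1"] by (auto simp: Basis_vec_def inner_axis)
  have "vec2 -` box l u = box (unvec2 l) (unvec2 u)"
    by (auto simp: vec2_def unvec2_def in_box_complex_iff mem_box Basis_vec_def inner_axis forall_2)
  hence "emeasure (distr lborel borel vec2) (box l u) = emeasure lborel (box (unvec2 l) (unvec2 u))"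
    by (subst emeasure_distr) auto
  also have "\<dots> = ennreal (\<Prod>b\<in>Basis. (unvec2 u - unvec2 l) \<bullet> b)"
    using le' by (subst emeasure_lborel_box) (auto simp: Basis_complex_def unvec2_def)
  also have "(\<Prod>b\<in>Basis. (unvec2 u - unvec2 l) \<bullet> b) = (u$1 - l$1) * (u$2 - l$2)"
    by (simp add: Basis_complex_def unvec2_def)
  also have "\<dots> = (\<Prod>b\<in>Basis. (u - l) \<bullet> b)"
  proof -
    have "(\<Prod>b\<in>Basis. (u - l) \<bullet> b) = (\<Prod>b\<in>range (\<lambda>i. axis i 1). (u - l) \<bullet> b)"
      by (rule prod.cong) (auto simp: Basis_vec_def)
    also have "\<dots> = (\<Prod>i\<in>UNIV. (u - l) \<bullet> axis i 1)"
      by (subst prod.reindex) (auto intro!: injI simp: axis_eq_axis)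
    finally show ?thesis by (simp add: inner_axis UNIV_2)
  qed
  finally show "emeasure (distr lborel borel vec2) (box l u) = (\<Prod>b\<in>Basis. (u - l) \<bullet> b)" .
qed simp

text \<open>The library's change of variables formula is stated for \<open>real^'n\<close> only, so it is transported along
  \<^const>\<open>vec2\<close>.\<close>

lemma emeasure_holomorphic_image:
  fixes P P' :: "complex \<Rightarrow> complex"
  assumes E: "E \<in> sets borel" "bounded E" and PE: "P ` E \<in> sets borel"
    and der: "\<And>z. (P has_field_derivative P' z) (at z)"
    and cont: "continuous_on UNIV P'" and inj: "inj_on P E"
  shows "emeasure lborel (P ` E) = (\<integral>\<^sup>+z. ennreal ((cmod (P' z))\<^sup>2) * indicator E z \<partial>lborel)"
proof -
  define f where "f = (\<lambda>v. vec2 (P (unvec2 v)))"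
  define f' where "f' = (\<lambda>v h. vec2 (P' (unvec2 v) * unvec2 h))"
  define S where "S = vec2 ` E"
  have S_vimage: "S = unvec2 -` E" and fS: "f ` S = unvec2 -` (P ` E)"
    unfolding S_def f_def by (auto simp: image_image) (metis imageI vec2_unvec2)+
  have Sb[measurable]: "S \<in> sets borel"
    using measurable_sets[OF measurable_unvec2 E(1)] by (simp add: S_vimage)
  have fSb[measurable]: "f ` S \<in> sets borel"
    using measurable_sets[OF measurable_unvec2 PE] by (simp add: fS)
  have P'm[measurable]: "P' \<in> borel_measurable borel"
    using cont by (rule borel_measurable_continuous_onI)
  have f'f: "(f has_derivative f' v) (at v within S)" for v
  proof -
    have 1: "(unvec2 has_derivative unvec2) (at v within S)"
      by (rule bounded_linear_imp_has_derivative[OF bounded_linear_unvec2])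
    have 2: "(P has_derivative (\<lambda>h. P' (unvec2 v) * h)) (at (unvec2 v))"
      using der[of "unvec2 v"] by (simp add: has_field_derivative_def)
    have 3: "((\<lambda>v. P (unvec2 v)) has_derivative (\<lambda>h. P' (unvec2 v) * unvec2 h)) (at v within S)"
      by (rule has_derivative_compose[OF 1 2])
    show ?thesis unfolding f_def f'_def
      by (rule bounded_linear.has_derivative[OF bounded_linear_vec2 3])
  qed
  \<comment> \<open>Multiplication by a complex number w has real determinant |w|^2; this is how the
    squared modulus of \<open>P'\<close> arises as the Jacobian.\<close>
  have det: "det (matrix (f' v)) = (cmod (P' (unvec2 v)))\<^sup>2" for v
    by (simp add: det_2 matrix_def f'_def vec2_def unvec2_def axis_def cmod_power2) (simp add: power2_eq_square)
  have injf: "inj_on f S"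
    using inj by (auto simp: inj_on_def f_def S_def dest!: arg_cong[where f = unvec2])
  obtain B where B: "\<And>z. z \<in> E \<Longrightarrow> cmod (P' z) \<le> B"
  proof -
    have "compact (closure E)" using E(2) by simp
    hence "compact (P' ` closure E)"
      using cont by (intro compact_continuous_image) (auto intro: continuous_on_subset)
    hence "bounded (P' ` closure E)" by (rule compact_imp_bounded)
    thus ?thesis using that closure_subset by (auto simp: bounded_iff)
  qed
  have Sbdd: "bounded S" unfolding S_def using E(2) bounded_linear_vec2 by (rule bounded_linear_image)
  define D where "D = (\<lambda>v. (cmod (P' (unvec2 v)))\<^sup>2)"
  have Dm[measurable]: "D \<in> borel_measurable borel" unfolding D_def by measurable
  \<comment> \<open>Boundedness of \<open>E\<close> makes the integral a finite real
    \<open>m\<close>, so that it can be fed to a change of variables theorem about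
    \<open>has_integral\<close>.\<close>
  have fin: "(\<integral>\<^sup>+v. ennreal (D v) * indicator S v \<partial>lborel) < \<infinity>"
  proof -
    have "(\<integral>\<^sup>+v. ennreal (D v) * indicator S v \<partial>lborel) \<le> (\<integral>\<^sup>+v. ennreal (B\<^sup>2) * indicator S v \<partial>lborel)"
    proof (intro nn_integral_mono)
      fix v :: "real^2"
      have "(cmod (P' (unvec2 v)))\<^sup>2 \<le> B\<^sup>2" if "v \<in> S"
        using B[of "unvec2 v"] that by (intro power_mono) (auto simp: S_def)
      thus "ennreal (D v) * indicator S v \<le> ennreal (B\<^sup>2) * indicator S v"
        by (auto simp: D_def split: split_indicator)
    qed
    also have "\<dots> = ennreal (B\<^sup>2) * emeasure lborel S" by (simp add: nn_integral_cmult_indicator)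
    also have "\<dots> < \<infinity>" using emeasure_bounded_finite[OF Sbdd] by (simp add: ennreal_mult_less_top)
    finally show ?thesis .
  qed
  then obtain m where m: "0 \<le> m" "(\<integral>\<^sup>+v. ennreal (D v) * indicator S v \<partial>lborel) = ennreal m"
    by (cases "\<integral>\<^sup>+v. ennreal (D v) * indicator S v \<partial>lborel") auto
  have "(D has_integral m) S"
  proof -
    have "((\<lambda>v. D v * indicator S v) has_integral m) UNIV"
    proof (rule nn_integral_has_integral)
      show "(\<integral>\<^sup>+v. ennreal (D v * indicator S v) \<partial>lborel) = ennreal m"
        unfolding m(2)[symmetric] by (intro nn_integral_cong) (auto split: split_indicator)
    qed (use m(1) in \<open>auto simp: D_def\<close>)
    also have "(\<lambda>v. D v * indicator S v) = (\<lambda>v. if v \<in> S then D v else 0)"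
      by (auto simp: fun_eq_iff)
    finally show ?thesis by (simp only: has_integral_restrict_UNIV)
  qed
  hence "((\<lambda>v. \<bar>det (matrix (f' v))\<bar>) has_integral m) S"
    by (simp add: det D_def)
  with has_measure_differentiable_image[of S f f' m] f'f injf
  have "f ` S \<in> lmeasurable" "measure lebesgue (f ` S) = m" by auto
  hence "ennreal m = emeasure lebesgue (f ` S)"
    using emeasure_eq_measure2[of "f ` S" lebesgue] by simp
  also have "\<dots> = emeasure lborel (f ` S)"
    using fSb by simp
  also have "\<dots> = emeasure (distr lborel borel vec2) (f ` S)"
    by (simp add: distr_lborel_vec2)
  also have "\<dots> = emeasure lborel (P ` E)"
    by (subst emeasure_distr) (use fSb in \<open>auto simp: fS vimage_def\<close>)
  finally have 1: "emeasure lborel (P ` E) = (\<integral>\<^sup>+v. ennreal (D v) * indicator S v \<partial>lborel)"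
    using m(2) by simp
  have "(\<integral>\<^sup>+v. ennreal (D v) * indicator S v \<partial>lborel) =
      (\<integral>\<^sup>+v. ennreal (D v) * indicator S v \<partial>distr lborel borel vec2)"
    by (simp add: distr_lborel_vec2)
  also have "\<dots> = (\<integral>\<^sup>+z. ennreal (D (vec2 z)) * indicator S (vec2 z) \<partial>lborel)"
    by (rule nn_integral_distr) measurable
  also have "\<dots> = (\<integral>\<^sup>+z. ennreal ((cmod (P' z))\<^sup>2) * indicator E z \<partial>lborel)"
    by (intro nn_integral_cong) (auto simp: D_def S_vimage split: split_indicator)
  finally show ?thesis using 1 by simp
qed

section \<open>Counting preimages through a labelling of the roots\<close>

text \<open>Injectivity leaves at most one point of \<open>E\<close> over \<open>y\<close>, and the
  nonvanishing derivative makes it a simple root, so exactly one label hits it although roots are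
  listed with multiplicity.\<close>

lemma sum_indicator_root_labelling:
  fixes P :: "complex poly" and \<xi> :: "'i \<Rightarrow> complex \<Rightarrow> complex"
  assumes I: "finite I" and deg: "degree P \<ge> 1"
    and roots: "proots (P - [:y:]) = image_mset (\<lambda>i. \<xi> i y) (mset_set I)"
    and inj: "inj_on (poly P) E" and nz: "\<And>z. z \<in> E \<Longrightarrow> poly (pderiv P) z \<noteq> 0"
  shows "(\<Sum>i\<in>I. indicator E (\<xi> i y)) = (indicator (poly P ` E) y :: ennreal)"
proof -
  have nz': "P - [:y:] \<noteq> 0" using deg by (auto simp: eq_iff_diff_eq_0[symmetric])
  have root: "poly P (\<xi> i y) = y" if "i \<in> I" for i
  proof -
    have "\<xi> i y \<in># proots (P - [:y:])" unfolding roots using that I by simp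
    thus ?thesis using nz' by simp
  qed
  have sum_eq: "(\<Sum>i\<in>I. indicator E (\<xi> i y)) = (of_nat (card {i\<in>I. \<xi> i y \<in> E}) :: ennreal)"
    using I by (simp add: indicator_def sum.If_cases Int_def)
  show ?thesis
  proof (cases "y \<in> poly P ` E")
    case True
    then obtain z where z: "z \<in> E" "poly P z = y" by auto
    have "order z (P - [:y:]) = Suc (order z (pderiv (P - [:y:])))"
    proof (rule order_pderiv)
      show "P - [:y:] \<noteq> 0" "poly (P - [:y:]) z = 0" using nz' z by simp_all
    qed
    also have "order z (pderiv (P - [:y:])) = 0"
      using nz[OF z(1)] by (intro order_0I) (simp add: pderiv_diff pderiv_pCons)
    finally have "count (proots (P - [:y:])) z = 1" using nz' by simp
    hence "card {i\<in>I. z = \<xi> i y} = 1"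
      unfolding roots using I by (simp add: count_image_mset')
    moreover have "{i\<in>I. z = \<xi> i y} = {i\<in>I. \<xi> i y \<in> E}"
      using z inj root by (auto simp: inj_on_def)
    ultimately show ?thesis using True sum_eq by simp
  next
    case False
    hence "{i\<in>I. \<xi> i y \<in> E} = {}" using root by (metis (mono_tags, lifting) Collect_empty_eq imageI)
    thus ?thesis using False sum_eq by (metis card.empty indicator_simps(2) of_nat_0)
  qed
qed

text \<open>Both sides integrate \<open>F\<close> against a measure: \<open>N1\<close> pushes
  Lebesgue measure forward under all labels, \<open>N2\<close> has density |P'|^2. They agree on
  bounded sets where P is injective and P' does not vanish, by the change of variables. On the
  critical set \<open>Z\<close> both vanish, since P maps \<open>Z\<close> to a finite set and the
  density is zero there. Countably many such pieces partition the plane.\<close>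

lemma nn_integral_root_labelling:
  fixes P :: "complex poly" and \<xi> :: "'i \<Rightarrow> complex \<Rightarrow> complex"
  assumes I: "finite I" and deg: "degree P \<ge> 1"
    and meas: "\<And>i. i \<in> I \<Longrightarrow> \<xi> i \<in> borel_measurable borel"
    and roots: "\<And>y. proots (P - [:y:]) = image_mset (\<lambda>i. \<xi> i y) (mset_set I)"
    and F[measurable]: "F \<in> borel_measurable borel"
  shows "(\<integral>\<^sup>+y. (\<Sum>i\<in>I. F (\<xi> i y)) \<partial>lborel) =
         (\<integral>\<^sup>+z. ennreal ((cmod (poly (pderiv P) z))\<^sup>2) * F z \<partial>lborel)"
proof -
  have contP: "continuous_on UNIV (poly p)" for p :: "complex poly"
    by (intro continuous_intros)
  have [measurable]: "poly p \<in> borel_measurable borel" for p :: "complex poly"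
    by (rule borel_measurable_continuous_onI[OF contP])
  \<comment> \<open>Putting a counting measure on the labels makes \<open>N1\<close> a single
    push-forward, and the sum over labels an instance of Fubini.\<close>
  have cs: "(\<lambda>(i, y). \<xi> i y) \<in> measurable (count_space I \<Otimes>\<^sub>M lborel) borel"
    using I meas by (intro measurable_pair_measure_countable1) (auto intro: countable_finite)
  define N1 where "N1 = distr (count_space I \<Otimes>\<^sub>M lborel) borel (\<lambda>(i, y). \<xi> i y)"
  define N2 where "N2 = density lborel (\<lambda>z. ennreal ((cmod (poly (pderiv P) z))\<^sup>2))"
  have N1: "(\<integral>\<^sup>+z. G z \<partial>N1) = (\<integral>\<^sup>+y. (\<Sum>i\<in>I. G (\<xi> i y)) \<partial>lborel)"
    if [measurable]: "G \<in> borel_measurable borel" for G :: "complex \<Rightarrow> ennreal"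
  proof -
    have m: "(\<lambda>(i, y). G (\<xi> i y)) \<in> borel_measurable (count_space I \<Otimes>\<^sub>M lborel)"
      using measurable_compose[OF cs that] by (simp add: case_prod_beta')
    have "(\<integral>\<^sup>+z. G z \<partial>N1) = (\<integral>\<^sup>+x. (\<lambda>(i, y). G (\<xi> i y)) x \<partial>(count_space I \<Otimes>\<^sub>M lborel))"
      unfolding N1_def by (subst nn_integral_distr[OF cs]) (auto simp: case_prod_beta')
    also have "\<dots> = (\<integral>\<^sup>+i. \<integral>\<^sup>+y. G (\<xi> i y) \<partial>lborel \<partial>count_space I)"
      by (subst lborel.nn_integral_fst[OF m, symmetric]) simp
    also have "\<dots> = (\<Sum>i\<in>I. \<integral>\<^sup>+y. G (\<xi> i y) \<partial>lborel)"
      using I by (rule nn_integral_count_space_finite)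
    also have "\<dots> = (\<integral>\<^sup>+y. (\<Sum>i\<in>I. G (\<xi> i y)) \<partial>lborel)"
      using meas by (intro nn_integral_sum[symmetric]) (auto intro: measurable_compose[OF _ that])
    finally show ?thesis .
  qed
  have N2: "(\<integral>\<^sup>+z. G z \<partial>N2) = (\<integral>\<^sup>+z. ennreal ((cmod (poly (pderiv P) z))\<^sup>2) * G z \<partial>lborel)"
    if [measurable]: "G \<in> borel_measurable borel" for G :: "complex \<Rightarrow> ennreal"
    unfolding N2_def by (subst nn_integral_density) auto
  define Z where "Z = {z. poly (pderiv P) z = 0}"
  have "pderiv P \<noteq> 0" using deg by (simp add: pderiv_eq_0_iff)
  hence Z: "finite Z" unfolding Z_def by (rule poly_roots_finite)
  have eqZ: "emeasure N1 E = emeasure N2 E" if E: "E \<in> sets borel" "E \<subseteq> Z" for E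
  proof -
    note [measurable] = E(1)
    have "(\<Sum>i\<in>I. indicator E (\<xi> i y)) = (0::ennreal)" if "y \<notin> poly P ` Z" for y
    proof (intro sum.neutral ballI)
      fix i assume i: "i \<in> I"
      have nz': "P - [:y:] \<noteq> 0" using deg by (auto simp: eq_iff_diff_eq_0[symmetric])
      have "\<xi> i y \<in># proots (P - [:y:])" unfolding roots using i I by simp
      hence "poly P (\<xi> i y) = y" using nz' by simp
      hence "\<xi> i y \<notin> E" using that E(2) by (metis imageI subsetD)
      thus "indicator E (\<xi> i y) = (0::ennreal)" by simp
    qed
    moreover have "AE y in lborel. y \<notin> poly P ` Z"
      using Z by (intro AE_not_in finite_imp_null_set_lborel) auto
    ultimately have "(\<integral>\<^sup>+y. (\<Sum>i\<in>I. indicator E (\<xi> i y)) \<partial>lborel) = (\<integral>\<^sup>+(y::complex). 0 \<partial>lborel)"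
      by (intro nn_integral_cong_AE) auto
    hence "emeasure N1 E = 0"
      using N1[of "indicator E"] E by (simp add: N1_def)
    moreover have "(\<lambda>z. ennreal ((cmod (poly (pderiv P) z))\<^sup>2) * indicator E z) = (\<lambda>z. 0)"
      using E(2) by (auto simp: Z_def fun_eq_iff split: split_indicator)
    hence "emeasure N2 E = 0"
      using N2[of "indicator E"] E by (simp add: N2_def)
    ultimately show ?thesis by simp
  qed
  have eqb: "emeasure N1 E = emeasure N2 E"
    if E: "E \<in> sets borel" "bounded E" "E \<inter> Z = {}" "inj_on (poly P) E" for E
  proof -
    note [measurable] = E(1)
    have ind: "(\<Sum>i\<in>I. indicator E (\<xi> i y)) = (indicator (poly P ` E) y :: ennreal)" for y
      using E by (intro sum_indicator_root_labelling[OF I deg roots]) (auto simp: Z_def)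
    \<comment> \<open>The image of \<open>E\<close> is Borel because its indicator is this finite
      sum of measurable functions of \<open>y\<close>.\<close>
    have "(\<lambda>y. \<Sum>i\<in>I. indicator E (\<xi> i y) :: ennreal) \<in> borel_measurable borel"
      using meas by (intro borel_measurable_sum) (auto intro!: measurable_compose[of _ borel borel])
    hence PE[measurable]: "poly P ` E \<in> sets borel"
      unfolding ind by (simp add: borel_measurable_indicator_iff)
    have "emeasure N1 E = (\<integral>\<^sup>+y. indicator (poly P ` E) y \<partial>lborel)"
      using N1[of "indicator E"] E by (simp add: N1_def ind)
    also have "\<dots> = emeasure lborel (poly P ` E)" by simp
    also have "\<dots> = (\<integral>\<^sup>+z. ennreal ((cmod (poly (pderiv P) z))\<^sup>2) * indicator E z \<partial>lborel)"
      using E by (intro emeasure_holomorphic_image contP poly_DERIV PE)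
    also have "\<dots> = emeasure N2 E"
      using N2[of "indicator E"] E by (simp add: N2_def)
    finally show ?thesis .
  qed
  define \<F> where "\<F> = {ball w r |w r. inj_on (poly P) (ball w r)}"
  obtain \<F>' where \<F>': "\<F>' \<subseteq> \<F>" "countable \<F>'" "\<Union>\<F>' = \<Union>\<F>"
    by (rule Lindelof[of \<F>]) (auto simp: \<F>_def)
  have cover: "- Z \<subseteq> \<Union>\<F>"
  proof
    fix w assume "w \<in> - Z"
    hence "deriv (poly P) w \<noteq> 0" by (simp add: Z_def DERIV_imp_deriv[OF poly_DERIV])
    moreover have "poly P holomorphic_on UNIV"
      by (auto simp: holomorphic_on_open intro: poly_DERIV)
    ultimately obtain r where "r > 0" "inj_on (poly P) (ball w r)"
      using has_complex_derivative_locally_injective[of "poly P" UNIV w] by auto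
    thus "w \<in> \<Union>\<F>" by (auto simp: \<F>_def intro!: exI[of _ "ball w r"])
  qed
  \<comment> \<open>Including \<open>Z\<close> makes the family nonempty, as an enumeration
    requires, and completes the injectivity balls to a cover of the plane.\<close>
  define b where "b = from_nat_into (insert Z \<F>')"
  have rb: "range b = insert Z \<F>'" unfolding b_def using \<F>'(2) by (intro range_from_nat_into) auto
  have bZ: "b k = Z \<or> (\<exists>w r. b k = ball w r \<and> inj_on (poly P) (ball w r))" for k
    using rangeI[of b k] \<F>'(1) unfolding rb \<F>_def by blast
  have Zb: "Z \<in> sets borel" using Z by (intro borel_closed finite_imp_closed)
  have bb: "b k \<in> sets borel" for k using bZ[of k] Zb by auto
  have dis: "disjoint_family (disjointed b)" by (rule disjoint_family_disjointed)
  have un: "(\<Union>k. disjointed b k) = UNIV"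
    using cover \<F>'(3) rb by (auto simp: UN_disjointed_eq)
  have db[measurable]: "disjointed b k \<in> sets borel" for k
    using bb by (auto simp: disjointed_def)
  have "N1 = N2"
  proof (rule measure_eqI)
    fix E assume "E \<in> sets N1"
    hence E[measurable]: "E \<in> sets borel" by (simp add: N1_def)
    have eqk: "emeasure N1 (E \<inter> disjointed b k) = emeasure N2 (E \<inter> disjointed b k)" for k
    proof -
      have sub: "E \<inter> disjointed b k \<subseteq> b k" using disjointed_subset[of b k] by auto
      have cut: "emeasure N (E \<inter> disjointed b k) =
          emeasure N (E \<inter> disjointed b k \<inter> Z) + emeasure N (E \<inter> disjointed b k - Z)"
        if "sets N = sets borel" for N
        using Zb that E db[of k] by (subst plus_emeasure) (auto intro!: arg_cong[where f = "emeasure N"])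
      have "emeasure N1 (E \<inter> disjointed b k - Z) = emeasure N2 (E \<inter> disjointed b k - Z)"
      proof (cases "b k = Z")
        case True
        thus ?thesis using sub by (auto intro!: arg_cong2[where f = emeasure] simp: Diff_eq_empty_iff[THEN iffD2])
      next
        case False
        then obtain w r where "b k = ball w r" "inj_on (poly P) (ball w r)" using bZ by blast
        thus ?thesis using sub E db[of k] Zb
          by (intro eqb) (auto intro: inj_on_subset bounded_subset[OF bounded_ball[of w r]])
      qed
      moreover have "emeasure N1 (E \<inter> disjointed b k \<inter> Z) = emeasure N2 (E \<inter> disjointed b k \<inter> Z)"
        using E db[of k] Zb by (intro eqZ) auto
      ultimately show ?thesis by (subst (1 2) cut) (auto simp: N1_def N2_def)
    qed
    have split: "emeasure N E = (\<Sum>k. emeasure N (E \<inter> disjointed b k))" if "sets N = sets borel" for N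
    proof -
      have "(\<Sum>k. emeasure N (E \<inter> disjointed b k)) = emeasure N (\<Union>k. E \<inter> disjointed b k)"
        using that dis by (intro suminf_emeasure) (auto simp: disjoint_family_on_def)
      also have "(\<Union>k. E \<inter> disjointed b k) = E" using un by auto
      finally show ?thesis by simp
    qed
    show "emeasure N1 E = emeasure N2 E"
      by (subst (1 2) split) (auto simp: N1_def[THEN arg_cong[where f=sets]] N2_def[THEN arg_cong[where f=sets]] eqk)
  qed (simp add: N1_def N2_def)
  thus ?thesis using N1[OF F] N2[OF F] by simp
qed

section \<open>Gaussian product measures\<close>

definition cgauss :: "complex measure" where
  "cgauss = density lborel (\<lambda>z. ennreal (exp (- (cmod z)\<^sup>2) / pi))"

lemma sets_cgauss [simp, measurable_cong]: "sets cgauss = sets borel"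
  and space_cgauss [simp]: "space cgauss = UNIV"
  by (simp_all add: cgauss_def)

lemma nn_integral_cgauss:
  "f \<in> borel_measurable borel \<Longrightarrow>
     (\<integral>\<^sup>+z. f z \<partial>cgauss) = (\<integral>\<^sup>+z. ennreal (exp (- (cmod z)\<^sup>2) / pi) * f z \<partial>lborel)"
  unfolding cgauss_def by (rule nn_integral_density) measurable

lemma measurable_Complex [measurable]:
  assumes [measurable]: "f \<in> borel_measurable M" "g \<in> borel_measurable M"
  shows "(\<lambda>x. Complex (f x) (g x)) \<in> borel_measurable M"
  unfolding Complex_eq by measurable

lemma lborel_complex: "lborel = distr (lborel \<Otimes>\<^sub>M lborel) borel (\<lambda>(x, y). Complex x y)"
proof (rule lborel_eqI)
  fix l u :: complex assume le: "\<And>b. b \<in> Basis \<Longrightarrow> l \<bullet> b \<le> u \<bullet> b"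
  have le': "Re l \<le> Re u" "Im l \<le> Im u"
    using le[of 1] le[of \<i>] by (simp_all add: Basis_complex_def)
  have "(\<lambda>(x, y). Complex x y) -` box l u = {Re l<..<Re u} \<times> {Im l<..<Im u}"
    by (auto simp: in_box_complex_iff)
  hence "emeasure (distr (lborel \<Otimes>\<^sub>M lborel) borel (\<lambda>(x, y). Complex x y)) (box l u) =
      emeasure (lborel \<Otimes>\<^sub>M lborel) ({Re l<..<Re u} \<times> {Im l<..<Im u})"
    by (subst emeasure_distr) (auto simp: space_pair_measure)
  also have "\<dots> = ennreal (Re u - Re l) * ennreal (Im u - Im l)"
    using le' by (subst lborel.emeasure_pair_measure_Times) auto
  also have "\<dots> = (\<Prod>b\<in>Basis. (u - l) \<bullet> b)"
    using le' by (simp add: Basis_complex_def ennreal_mult)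
  finally show "emeasure (distr (lborel \<Otimes>\<^sub>M lborel) borel (\<lambda>(x, y). Complex x y)) (box l u) =
      (\<Prod>b\<in>Basis. (u - l) \<bullet> b)" .
qed simp

lemma nn_integral_lborel_complex:
  assumes [measurable]: "f \<in> borel_measurable borel"
  shows "(\<integral>\<^sup>+z. f z \<partial>lborel) = (\<integral>\<^sup>+x. \<integral>\<^sup>+y. f (Complex x y) \<partial>lborel \<partial>lborel)"
proof -
  have "(\<integral>\<^sup>+z. f z \<partial>lborel) = (\<integral>\<^sup>+xy. (case xy of (x, y) \<Rightarrow> f (Complex x y)) \<partial>(lborel \<Otimes>\<^sub>M lborel))"
    by (subst lborel_complex, subst nn_integral_distr) (auto simp: case_prod_beta')
  also have "\<dots> = (\<integral>\<^sup>+x. \<integral>\<^sup>+y. f (Complex x y) \<partial>lborel \<partial>lborel)"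
    by (subst lborel.nn_integral_fst[symmetric]) simp_all
  finally show ?thesis .
qed

text \<open>The density factorises: real and imaginary part have variance 1/2 each, hence the
  standard deviation \<open>1 / sqrt 2\<close>, and 1/pi is the product of the two normalising
  constants.\<close>

lemma nn_integral_cgauss_normal:
  assumes [measurable]: "f \<in> borel_measurable borel"
  defines "n \<equiv> (\<lambda>x. ennreal (normal_density 0 (1 / sqrt 2) x))"
  shows "(\<integral>\<^sup>+z. f z \<partial>cgauss) = (\<integral>\<^sup>+x. n x * (\<integral>\<^sup>+y. n y * f (Complex x y) \<partial>lborel) \<partial>lborel)"
proof -
  have n: "ennreal (exp (- (cmod (Complex x y))\<^sup>2) / pi) = n x * n y" for x y
    by (simp add: n_def normal_density_def cmod_power2 power_divide ennreal_mult[symmetric] exp_add[symmetric])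
  have [measurable]: "n \<in> borel_measurable borel" unfolding n_def by measurable
  show ?thesis
    by (simp add: nn_integral_cgauss nn_integral_lborel_complex n nn_integral_cmult[symmetric] mult.assoc)
qed

lemma nn_integral_normal_half:
  defines "n \<equiv> (\<lambda>x. ennreal (normal_density 0 (1 / sqrt 2) x))"
  shows "(\<integral>\<^sup>+x. n x \<partial>lborel) = 1" "(\<integral>\<^sup>+x. n x * ennreal (x\<^sup>2) \<partial>lborel) = ennreal (1/2)"
proof -
  interpret prob_space "density lborel n"
    unfolding n_def by (intro prob_space_normal_density) simp
  show "(\<integral>\<^sup>+x. n x \<partial>lborel) = 1"
    using emeasure_space_1 by (simp add: emeasure_density n_def)
  have "has_bochner_integral lborel (\<lambda>x. normal_density 0 (1 / sqrt 2) x * (x - 0) ^ (2 * 1))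
      (fact (2 * 1) / ((2 / (1 / sqrt 2)\<^sup>2) ^ 1 * fact 1))"
    by (rule normal_moment_even) simp
  hence "has_bochner_integral lborel (\<lambda>x. normal_density 0 (1 / sqrt 2) x * x\<^sup>2) (1/2)"
    by (simp add: power_divide)
  hence i: "integrable lborel (\<lambda>x. normal_density 0 (1 / sqrt 2) x * x\<^sup>2)"
      "(LBINT x. normal_density 0 (1 / sqrt 2) x * x\<^sup>2) = 1/2"
    unfolding has_bochner_integral_iff by blast+
  have "(\<integral>\<^sup>+x. ennreal (normal_density 0 (1 / sqrt 2) x * x\<^sup>2) \<partial>lborel) = ennreal (1/2)"
    unfolding i(2)[symmetric] by (rule nn_integral_eq_integral[OF i(1)]) simp
  thus "(\<integral>\<^sup>+x. n x * ennreal (x\<^sup>2) \<partial>lborel) = ennreal (1/2)"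
    by (simp add: n_def ennreal_mult)
qed

lemma prob_space_cgauss: "prob_space cgauss"
proof
  have "emeasure cgauss (space cgauss) = (\<integral>\<^sup>+z. 1 \<partial>cgauss)" by simp
  also have "\<dots> = 1"
    by (subst nn_integral_cgauss_normal) (simp_all add: nn_integral_normal_half)
  finally show "emeasure cgauss (space cgauss) = 1" .
qed

interpretation cgauss: prob_space cgauss by (rule prob_space_cgauss)

interpretation cgauss_PiM: product_sigma_finite "\<lambda>_. cgauss" by standard

lemma second_moment_cgauss: "(\<integral>\<^sup>+z. ennreal ((cmod z)\<^sup>2) \<partial>cgauss) = 1"
  (is "?lhs = _")
proof -
  let ?n = "\<lambda>x. ennreal (normal_density 0 (1 / sqrt 2) x)"
  have "?lhs = (\<integral>\<^sup>+x. ?n x * (\<integral>\<^sup>+y. ?n y * ennreal (x\<^sup>2 + y\<^sup>2) \<partial>lborel) \<partial>lborel)"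
    by (subst nn_integral_cgauss_normal) (simp_all add: cmod_power2)
  also have "\<dots> = (\<integral>\<^sup>+x. ?n x * (ennreal (x\<^sup>2) + ennreal (1/2)) \<partial>lborel)"
    by (simp add: distrib_left nn_integral_add nn_integral_multc nn_integral_normal_half)
  also have "\<dots> = ennreal (1/2) + ennreal (1/2)"
    by (simp add: distrib_left nn_integral_add nn_integral_multc nn_integral_normal_half)
  also have "\<dots> = ennreal (1/2 + 1/2)" by (rule ennreal_plus[symmetric]) simp_all
  also have "\<dots> = 1" by simp
  finally show ?thesis .
qed

lemma nn_integral_lborel_shift:
  fixes c :: "'a::euclidean_space"
  assumes [measurable]: "f \<in> borel_measurable borel"
  shows "(\<integral>\<^sup>+x. f (x + c) \<partial>lborel) = (\<integral>\<^sup>+x. f x \<partial>lborel)"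
  using nn_integral_distr[of "(+) c" lborel borel f] by (simp add: lborel_distr_plus add.commute)

lemma nn_integral_lborel_scale:
  fixes f :: "'a::euclidean_space \<Rightarrow> ennreal"
  assumes [measurable]: "f \<in> borel_measurable borel" and c: "c \<noteq> 0"
  shows "(\<integral>\<^sup>+x. f x \<partial>lborel) = ennreal (\<bar>c\<bar> ^ DIM('a)) * (\<integral>\<^sup>+x. f (c *\<^sub>R x) \<partial>lborel)"
  by (subst lborel_affine[OF c, of 0])
     (simp add: nn_integral_density nn_integral_distr nn_integral_cmult)

text \<open>The law is symmetric, so \<open>l\<close> and \<open>- l\<close> give the same value; in
  their sum the parallelogram identity cancels the cross term. This stays within nonnegative
  integrals and uses no first moment.\<close>

lemma second_moment_affine_cgauss:
  "(\<integral>\<^sup>+z. ennreal ((cmod (c + l * z))\<^sup>2) \<partial>cgauss) = ennreal ((cmod c)\<^sup>2 + (cmod l)\<^sup>2)"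
proof -
  let ?I = "\<lambda>l. \<integral>\<^sup>+z. ennreal ((cmod (c + l * z))\<^sup>2) \<partial>cgauss"
  have "?I l = ?I (- l)"
    by (simp add: nn_integral_cgauss)
       (subst nn_integral_lborel_scale[of _ "-1"], simp_all)
  hence "2 * ?I l = ?I l + ?I (- l)" by (simp add: mult_2)
  also have "\<dots> = (\<integral>\<^sup>+z. ennreal ((cmod (c + l * z))\<^sup>2) + ennreal ((cmod (c + - l * z))\<^sup>2) \<partial>cgauss)"
    by (rule nn_integral_add[symmetric]) measurable
  also have "\<dots> = (\<integral>\<^sup>+z. ennreal (2 * (cmod c)\<^sup>2) + ennreal (2 * (cmod l)\<^sup>2) * ennreal ((cmod z)\<^sup>2) \<partial>cgauss)"
  proof (intro nn_integral_cong)
    fix z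
    have "(cmod (c + l * z))\<^sup>2 + (cmod (c - l * z))\<^sup>2 = 2 * (cmod c)\<^sup>2 + 2 * (cmod (l * z))\<^sup>2"
      unfolding cmod_power2 by (simp add: power2_eq_square algebra_simps)
    also have "\<dots> = 2 * (cmod c)\<^sup>2 + 2 * (cmod l)\<^sup>2 * (cmod z)\<^sup>2"
      by (simp add: norm_mult power_mult_distrib)
    finally show "ennreal ((cmod (c + l * z))\<^sup>2) + ennreal ((cmod (c + - l * z))\<^sup>2) =
        ennreal (2 * (cmod c)\<^sup>2) + ennreal (2 * (cmod l)\<^sup>2) * ennreal ((cmod z)\<^sup>2)"
      by (simp flip: ennreal_plus ennreal_mult)
  qed
  also have "\<dots> = ennreal (2 * (cmod c)\<^sup>2) + ennreal (2 * (cmod l)\<^sup>2)"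
    by (simp add: nn_integral_add nn_integral_cmult second_moment_cgauss cgauss.emeasure_space_1[simplified])
  also have "\<dots> = 2 * ennreal ((cmod c)\<^sup>2 + (cmod l)\<^sup>2)"
    unfolding ennreal_numeral[symmetric]
    by (simp add: ennreal_mult[symmetric] ennreal_plus[symmetric] distrib_left del: ennreal_plus ennreal_numeral)
  finally have "2 * ?I l = 2 * ennreal ((cmod c)\<^sup>2 + (cmod l)\<^sup>2)" .
  thus ?thesis unfolding ennreal_mult_cancel_left by simp
qed

text \<open>The constant \<open>c\<close> carries the induction: with one coordinate held fixed, its
  contribution is absorbed into the constant.\<close>

lemma second_moment_PiM_cgauss:
  assumes "finite J"
  shows "(\<integral>\<^sup>+a. ennreal ((cmod (c + (\<Sum>k\<in>J. l k * a k)))\<^sup>2) \<partial>PiM J (\<lambda>_. cgauss)) =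
         ennreal ((cmod c)\<^sup>2 + (\<Sum>k\<in>J. (cmod (l k))\<^sup>2))"
  using assms
proof (induction J arbitrary: c)
  case empty
  show ?case by (subst cgauss_PiM.nn_integral_empty) simp_all
next
  case (insert i J)
  have "(\<integral>\<^sup>+a. ennreal ((cmod (c + (\<Sum>k\<in>insert i J. l k * a k)))\<^sup>2) \<partial>PiM (insert i J) (\<lambda>_. cgauss)) =
      (\<integral>\<^sup>+x. \<integral>\<^sup>+a. ennreal ((cmod (c + (\<Sum>k\<in>insert i J. l k * (a(i := x)) k)))\<^sup>2) \<partial>PiM J (\<lambda>_. cgauss) \<partial>cgauss)"
    by (rule cgauss_PiM.product_nn_integral_insert_rev) (use insert in measurable)
  also have "\<dots> = (\<integral>\<^sup>+x. \<integral>\<^sup>+a. ennreal ((cmod ((c + l i * x) + (\<Sum>k\<in>J. l k * a k)))\<^sup>2) \<partial>PiM J (\<lambda>_. cgauss) \<partial>cgauss)"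
  proof (intro nn_integral_cong)
    fix x and a :: "'a \<Rightarrow> complex"
    have "(\<Sum>k\<in>J. l k * (a(i := x)) k) = (\<Sum>k\<in>J. l k * a k)"
      using insert.hyps by (intro sum.cong) auto
    thus "ennreal ((cmod (c + (\<Sum>k\<in>insert i J. l k * (a(i := x)) k)))\<^sup>2) =
      ennreal ((cmod ((c + l i * x) + (\<Sum>k\<in>J. l k * a k)))\<^sup>2)"
      using insert.hyps by (simp add: algebra_simps)
  qed
  also have "\<dots> = (\<integral>\<^sup>+x. ennreal ((cmod (c + l i * x))\<^sup>2) + ennreal (\<Sum>k\<in>J. (cmod (l k))\<^sup>2) \<partial>cgauss)"
    by (simp add: insert.IH sum_nonneg)
  also have "\<dots> = ennreal ((cmod c)\<^sup>2 + (cmod (l i))\<^sup>2) + ennreal (\<Sum>k\<in>J. (cmod (l k))\<^sup>2)"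
    by (subst nn_integral_add)
       (simp_all add: second_moment_affine_cgauss cgauss.emeasure_space_1[simplified])
  also have "\<dots> = ennreal ((cmod c)\<^sup>2 + (\<Sum>k\<in>insert i J. (cmod (l k))\<^sup>2))"
    using insert.hyps by (simp add: sum_nonneg ennreal_plus[symmetric] add.assoc del: ennreal_plus)
  finally show ?case .
qed

section \<open>Translations of Gaussian product measures\<close>

lemma nn_integral_cgauss_shift:
  assumes [measurable]: "f \<in> borel_measurable borel"
  shows "(\<integral>\<^sup>+x. f x \<partial>cgauss) =
    (\<integral>\<^sup>+x. f (x + v) * ennreal (exp (- (2 * Re (x * cnj v) + (cmod v)\<^sup>2))) \<partial>cgauss)"
proof -
  have e: "exp (- (cmod (x + v))\<^sup>2) / pi =
      exp (- (cmod x)\<^sup>2) / pi * exp (- (2 * Re (x * cnj v) + (cmod v)\<^sup>2))" for x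
    unfolding cmod_power2 times_divide_eq_left exp_add[symmetric]
    by (simp add: power2_eq_square algebra_simps)
  have "(\<integral>\<^sup>+x. f x \<partial>cgauss) =
      (\<integral>\<^sup>+x. ennreal (exp (- (cmod (x + v))\<^sup>2) / pi) * f (x + v) \<partial>lborel)"
    by (simp add: nn_integral_cgauss
        nn_integral_lborel_shift[of "\<lambda>x. ennreal (exp (- (cmod x)\<^sup>2) / pi) * f x"])
  also have "\<dots> = (\<integral>\<^sup>+x. f (x + v) * ennreal (exp (- (2 * Re (x * cnj v) + (cmod v)\<^sup>2))) \<partial>cgauss)"
    unfolding e
    by (subst nn_integral_cgauss)
       (auto intro!: nn_integral_cong simp only: ennreal_mult' ennreal_mult'' mult_ac exp_ge_zero, measurable)
  finally show ?thesis .
qed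

text \<open>The one-variable density ratios multiply. The shifted vector is restricted to
  \<open>J\<close> because points of the product space are \<open>undefined\<close> outside
  \<open>J\<close>.\<close>

lemma cameron_martin_PiM_cgauss:
  assumes "finite J" and "H \<in> borel_measurable (PiM J (\<lambda>_. cgauss))"
  shows "(\<integral>\<^sup>+a. H a \<partial>PiM J (\<lambda>_. cgauss)) =
    (\<integral>\<^sup>+a. H (\<lambda>k\<in>J. a k + v k) *
        ennreal (exp (- (\<Sum>k\<in>J. 2 * Re (a k * cnj (v k)) + (cmod (v k))\<^sup>2))) \<partial>PiM J (\<lambda>_. cgauss))"
  using assms
proof (induction J arbitrary: H)
  case empty
  show ?case by (subst (1 2) cgauss_PiM.nn_integral_empty) (simp_all add: restrict_def)
next
  case (insert i J)
  note [measurable] = insert.prems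
  define w where "w = (\<lambda>a k. 2 * Re (a * cnj (v k)) + (cmod (v k))\<^sup>2)"
  have [measurable]: "(\<lambda>a. w a k) \<in> borel_measurable borel" for k unfolding w_def by measurable
  have [measurable]: "(\<lambda>(a, x). H (a(i := x))) \<in> borel_measurable (PiM J (\<lambda>_. cgauss) \<Otimes>\<^sub>M cgauss)"
    using measurable_compose[OF measurable_add_dim insert.prems] by (simp add: case_prod_beta')
  have [measurable]: "(\<lambda>x. H (a(i := x))) \<in> borel_measurable borel"
    if "a \<in> space (PiM J (\<lambda>_. cgauss))" for a
    using measurable_compose[OF measurable_component_update[OF that insert.hyps(2)] insert.prems]
    unfolding measurable_cong_sets[OF sets_cgauss refl] by (simp add: fun_upd_def)
  \<comment> \<open>The new coordinate is integrated out already shifted and weighted, so the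
    induction hypothesis for \<open>H'\<close> has only the old coordinates left to shift.\<close>
  define H' where "H' = (\<lambda>a. \<integral>\<^sup>+x. H (a(i := x + v i)) * ennreal (exp (- w x i)) \<partial>cgauss)"
  have [measurable]: "(\<lambda>(a, x). H (a(i := x + v i)))
      \<in> borel_measurable (PiM J (\<lambda>_. cgauss) \<Otimes>\<^sub>M cgauss)"
    using measurable_compose[of "\<lambda>(a, x). (a, x + v i)" "PiM J (\<lambda>_. cgauss) \<Otimes>\<^sub>M cgauss"
       "PiM J (\<lambda>_. cgauss) \<Otimes>\<^sub>M cgauss" "\<lambda>(a, x). H (a(i := x))" borel]
    by (simp add: case_prod_beta')
  have H'm: "H' \<in> borel_measurable (PiM J (\<lambda>_. cgauss))"
    unfolding H'_def by measurable
  let ?W = "\<lambda>J a. ennreal (exp (- (\<Sum>k\<in>J. w (a k) k)))"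
  have "(\<integral>\<^sup>+a. H a \<partial>PiM (insert i J) (\<lambda>_. cgauss)) =
      (\<integral>\<^sup>+a. \<integral>\<^sup>+x. H (a(i := x)) \<partial>cgauss \<partial>PiM J (\<lambda>_. cgauss))"
    by (rule cgauss_PiM.product_nn_integral_insert) (use insert in auto)
  also have "\<dots> = (\<integral>\<^sup>+a. H' a \<partial>PiM J (\<lambda>_. cgauss))"
    unfolding H'_def w_def by (intro nn_integral_cong nn_integral_cgauss_shift) measurable
  also have "\<dots> = (\<integral>\<^sup>+a. H' (\<lambda>k\<in>J. a k + v k) * ?W J a \<partial>PiM J (\<lambda>_. cgauss))"
    unfolding w_def by (rule insert.IH[OF H'm])
  also have "\<dots> = (\<integral>\<^sup>+a. \<integral>\<^sup>+x. H (\<lambda>k\<in>insert i J. (a(i := x)) k + v k) * ?W (insert i J) (a(i := x))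
      \<partial>cgauss \<partial>PiM J (\<lambda>_. cgauss))"
  proof (intro nn_integral_cong)
    fix a assume a: "a \<in> space (PiM J (\<lambda>_. cgauss))"
    have a': "(\<lambda>k\<in>J. a k + v k) \<in> space (PiM J (\<lambda>_. cgauss))" by (simp add: space_PiM)
    have [measurable]: "(\<lambda>x. H ((\<lambda>k\<in>J. a k + v k)(i := x + v i))) \<in> borel_measurable borel"
      using measurable_compose[of "\<lambda>x. x + v i" borel borel "\<lambda>x. H ((\<lambda>k\<in>J. a k + v k)(i := x))" borel] a' by simp
    have 1: "(\<lambda>k\<in>insert i J. (a(i := x)) k + v k) = (\<lambda>k\<in>J. a k + v k)(i := x + v i)" for x
      using insert.hyps by (auto simp: fun_eq_iff)
    have 2: "(\<Sum>k\<in>insert i J. w ((a(i := x)) k) k) = w x i + (\<Sum>k\<in>J. w (a k) k)" for x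
    proof -
      have "(\<Sum>k\<in>J. w ((a(i := x)) k) k) = (\<Sum>k\<in>J. w (a k) k)"
        using insert.hyps by (intro sum.cong) auto
      thus ?thesis using insert.hyps by simp
    qed
    have 3: "ennreal (exp (- (s + t))) = ennreal (exp (- s)) * ennreal (exp (- t))" for s t
      by (simp flip: ennreal_mult exp_add)
    show "H' (\<lambda>k\<in>J. a k + v k) * ?W J a =
       (\<integral>\<^sup>+x. H (\<lambda>k\<in>insert i J. (a(i := x)) k + v k) * ?W (insert i J) (a(i := x)) \<partial>cgauss)"
      unfolding 1 2 3 H'_def by (subst nn_integral_multc[symmetric]) (auto simp: mult.assoc)
  qed
  also have "\<dots> = (\<integral>\<^sup>+a. H (\<lambda>k\<in>insert i J. a k + v k) * ?W (insert i J) a \<partial>PiM (insert i J) (\<lambda>_. cgauss))"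
  proof (rule cgauss_PiM.product_nn_integral_insert[symmetric])
    show "(\<lambda>a. H (\<lambda>k\<in>insert i J. a k + v k) * ?W (insert i J) a)
      \<in> borel_measurable (PiM (insert i J) (\<lambda>_. cgauss))"
      by measurable
  qed (use insert in auto)
  finally show ?case unfolding w_def .
qed

section \<open>Second moments conditional on a linear constraint\<close>

lemma nn_integral_gauss_scale:
  assumes K: "K > 0"
  shows "(\<integral>\<^sup>+w. ennreal (exp (- (cmod w)\<^sup>2 / K)) \<partial>lborel) = ennreal (pi * K)"
proof -
  have "(\<integral>\<^sup>+w. ennreal (exp (- (cmod w)\<^sup>2 / K)) \<partial>lborel) =
      ennreal K * (\<integral>\<^sup>+w. ennreal (exp (- (cmod w)\<^sup>2)) \<partial>lborel)"
    by (subst nn_integral_lborel_scale[of _ "sqrt K"])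
       (use K in \<open>simp_all add: power_mult_distrib power_divide\<close>)
  also have "(\<integral>\<^sup>+w. ennreal (exp (- (cmod w)\<^sup>2)) \<partial>lborel) =
      (\<integral>\<^sup>+(w::complex). ennreal pi * ennreal (exp (- (cmod w)\<^sup>2) / pi) \<partial>lborel)"
    by (intro nn_integral_cong) (simp flip: ennreal_mult)
  also have "\<dots> = ennreal pi * (\<integral>\<^sup>+w. 1 \<partial>cgauss)"
    by (subst nn_integral_cgauss) (auto simp: nn_integral_cmult)
  finally show ?thesis using K
    by (simp add: cgauss.emeasure_space_1[simplified] ennreal_mult[symmetric] mult.commute)
qed

text \<open>
  The conditional second moment of a linear form that is uncorrelated with \<open>h = x + \<Sum>\<^sub>k e\<^sub>k a\<^sub>k\<close>,
  given \<open>h = 0\<close>; the factor \<open>1 / (\<pi> K)\<close> is the density of \<open>h\<close> at \<open>0\<close>. Shifting \<open>a\<close> relates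
  the fibre over \<open>w\<close> to that over \<open>0\<close>, and integrating over \<open>w\<close> gives the unconditional moment.
\<close>

lemma conditional_second_moment_orthogonal:
  fixes e l :: "'k \<Rightarrow> complex"
  assumes J: "finite J"
  defines "K \<equiv> 1 + (\<Sum>k\<in>J. (cmod (e k))\<^sup>2)"
  assumes orth: "l0 + (\<Sum>k\<in>J. l k * cnj (e k)) = 0"
  shows "(\<integral>\<^sup>+a. ennreal (exp (- (cmod (\<Sum>k\<in>J. e k * a k))\<^sup>2) / pi) *
            ennreal ((cmod (- l0 * (\<Sum>k\<in>J. e k * a k) + (\<Sum>k\<in>J. l k * a k)))\<^sup>2)
            \<partial>PiM J (\<lambda>_. cgauss)) =
         ennreal (((cmod l0)\<^sup>2 + (\<Sum>k\<in>J. (cmod (l k))\<^sup>2)) / (pi * K))"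
proof -
  define h where "h = (\<lambda>a. \<Sum>k\<in>J. e k * a k)"
  define S where "S = (\<lambda>a. \<Sum>k\<in>J. l k * a k)"
  define T where "T = (cmod l0)\<^sup>2 + (\<Sum>k\<in>J. (cmod (l k))\<^sup>2)"
  have T0: "T \<ge> 0" unfolding T_def by (intro add_nonneg_nonneg sum_nonneg) auto
  have K1: "K \<ge> 1" unfolding K_def by (simp add: sum_nonneg)
  hence K0: "K > 0" and Kc: "complex_of_real K \<noteq> 0" by auto
  have Kc_def: "complex_of_real K = 1 + (\<Sum>k\<in>J. e k * cnj (e k))"
    unfolding K_def of_real_add of_real_sum by (simp add: complex_norm_square del: of_real_power)
  let ?P = "PiM J (\<lambda>_. cgauss)"
  interpret P: sigma_finite_measure ?P using J by (rule cgauss_PiM.sigma_finite)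
  have [measurable]: "h \<in> borel_measurable ?P" "S \<in> borel_measurable ?P"
    unfolding h_def S_def by measurable
  \<comment> \<open>On the fibre over \<open>w\<close> the eliminated variable x equals
    \<open>w - h a\<close>; the first factor of \<open>\<Phi>\<close> is its Gaussian density there,
    the second the squared linear form. The claim concerns \<open>w = 0\<close>.\<close>
  define \<Phi> where "\<Phi> = (\<lambda>w a. ennreal (exp (- (cmod (w - h a))\<^sup>2) / pi) *
       ennreal ((cmod (l0 * (w - h a) + S a))\<^sup>2))"
  have [measurable]: "(\<lambda>(w, a). \<Phi> w a) \<in> borel_measurable (borel \<Otimes>\<^sub>M ?P)"
    unfolding \<Phi>_def by measurable
  have [measurable]: "\<Phi> w \<in> borel_measurable ?P" for w unfolding \<Phi>_def by measurable
  have shift: "(\<integral>\<^sup>+a. \<Phi> w a \<partial>?P) = ennreal (exp (- (cmod w)\<^sup>2 / K)) * (\<integral>\<^sup>+a. \<Phi> 0 a \<partial>?P)" for w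
  proof -
    \<comment> \<open>This is the shift along the conjugate coefficient vector (1, cnj e) that
      changes the constraint by \<open>w\<close>: the listed coordinates contribute w (K - 1) / K
      and the eliminated one w / K. Orthogonality says that the linear form does not change along
      it.\<close>
    define v where "v = (\<lambda>k. w * cnj (e k) / of_real K)"
    have "(\<integral>\<^sup>+a. \<Phi> w a \<partial>?P) = (\<integral>\<^sup>+a. \<Phi> w (\<lambda>k\<in>J. a k + v k) *
        ennreal (exp (- (\<Sum>k\<in>J. 2 * Re (a k * cnj (v k)) + (cmod (v k))\<^sup>2))) \<partial>?P)"
      by (rule cameron_martin_PiM_cgauss[OF J]) measurable
    also have "\<dots> = (\<integral>\<^sup>+a. ennreal (exp (- (cmod w)\<^sup>2 / K)) * \<Phi> 0 a \<partial>?P)"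
    proof (intro nn_integral_cong)
      fix a :: "'k \<Rightarrow> complex"
      have "h (\<lambda>k\<in>J. a k + v k) = h a + (\<Sum>k\<in>J. e k * v k)"
        by (simp add: h_def algebra_simps sum.distrib cong: sum.cong)
      also have "(\<Sum>k\<in>J. e k * v k) = w / of_real K * (of_real K - 1)"
      proof -
        have "(\<Sum>k\<in>J. e k * v k) = w / of_real K * (\<Sum>k\<in>J. e k * cnj (e k))"
          unfolding v_def by (simp add: sum_distrib_left algebra_simps)
        thus ?thesis by (simp add: Kc_def)
      qed
      finally have h: "h (\<lambda>k\<in>J. a k + v k) = h a + w / of_real K * (of_real K - 1)" .
      have 1: "w - h (\<lambda>k\<in>J. a k + v k) = w / of_real K - h a"
        unfolding h using Kc by (simp add: field_simps)
      have "S (\<lambda>k\<in>J. a k + v k) = S a + (\<Sum>k\<in>J. l k * v k)"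
        by (simp add: S_def algebra_simps sum.distrib cong: sum.cong)
      also have "(\<Sum>k\<in>J. l k * v k) = w / of_real K * (\<Sum>k\<in>J. l k * cnj (e k))"
        unfolding v_def by (simp add: sum_distrib_left algebra_simps)
      also have "(\<Sum>k\<in>J. l k * cnj (e k)) = - l0" using orth by (simp add: add_eq_0_iff)
      finally have S: "S (\<lambda>k\<in>J. a k + v k) = S a + w / of_real K * - l0" .
      have 2: "l0 * (w / of_real K - h a) + S (\<lambda>k\<in>J. a k + v k) = l0 * (0 - h a) + S a"
        unfolding S by (simp add: algebra_simps)
      have "(\<Sum>k\<in>J. 2 * Re (a k * cnj (v k))) = 2 * Re (\<Sum>k\<in>J. a k * cnj (v k))"
        by (simp add: sum_distrib_left)
      also have "(\<Sum>k\<in>J. a k * cnj (v k)) = cnj w / of_real K * h a"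
        unfolding v_def h_def by (simp add: sum_distrib_left algebra_simps)
      finally have 3: "(\<Sum>k\<in>J. 2 * Re (a k * cnj (v k))) = 2 * Re (cnj w / of_real K * h a)" .
      have "(\<Sum>k\<in>J. (cmod (v k))\<^sup>2) = (cmod w / K)\<^sup>2 * (\<Sum>k\<in>J. (cmod (e k))\<^sup>2)"
        unfolding v_def using K0
        by (simp add: norm_mult norm_divide power_mult_distrib power_divide sum_distrib_left sum_divide_distrib algebra_simps)
      also have "(\<Sum>k\<in>J. (cmod (e k))\<^sup>2) = K - 1" by (simp add: K_def)
      finally have 4: "(\<Sum>k\<in>J. (cmod (v k))\<^sup>2) = (cmod w)\<^sup>2 / K - (cmod w / K)\<^sup>2"
        using K0 by (simp add: power_divide field_simps power2_eq_square)
      have 5: "(cmod (w / of_real K - h a))\<^sup>2 =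
          (cmod w / K)\<^sup>2 - 2 * Re (cnj w / of_real K * h a) + (cmod (0 - h a))\<^sup>2"
      proof -
        have "(cmod (x - y))\<^sup>2 = (cmod x)\<^sup>2 - 2 * Re (cnj x * y) + (cmod y)\<^sup>2" for x y
          unfolding cmod_power2 by (simp add: power2_eq_square algebra_simps)
        from this[of "w / of_real K" "h a"] show ?thesis using K0 by (simp add: norm_divide)
      qed
      \<comment> \<open>The terms mixing \<open>w\<close> with \<open>h a\<close> cancel, and so do
        the two copies of |w/K|^2; only the marginal exponent |w|^2 / K survives.\<close>
      have "exp (- (cmod (w / of_real K - h a))\<^sup>2) / pi *
            exp (- (\<Sum>k\<in>J. 2 * Re (a k * cnj (v k)) + (cmod (v k))\<^sup>2)) =
            exp (- (cmod w)\<^sup>2 / K) * (exp (- (cmod (0 - h a))\<^sup>2) / pi)"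
        unfolding sum.distrib 3 4 5 times_divide_eq_left times_divide_eq_right exp_add[symmetric] by simp
      hence "ennreal (exp (- (cmod (w / of_real K - h a))\<^sup>2) / pi) *
            ennreal (exp (- (\<Sum>k\<in>J. 2 * Re (a k * cnj (v k)) + (cmod (v k))\<^sup>2))) =
            ennreal (exp (- (cmod w)\<^sup>2 / K)) * ennreal (exp (- (cmod (0 - h a))\<^sup>2) / pi)"
        by (simp only: ennreal_mult[symmetric] exp_ge_zero divide_nonneg_nonneg pi_ge_zero)
      thus "\<Phi> w (\<lambda>k\<in>J. a k + v k) * ennreal (exp (- (\<Sum>k\<in>J. 2 * Re (a k * cnj (v k)) + (cmod (v k))\<^sup>2))) =
          ennreal (exp (- (cmod w)\<^sup>2 / K)) * \<Phi> 0 a"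
        unfolding \<Phi>_def 1 2 by (simp only: mult_ac)
    qed
    also have "\<dots> = ennreal (exp (- (cmod w)\<^sup>2 / K)) * (\<integral>\<^sup>+a. \<Phi> 0 a \<partial>?P)"
      by (rule nn_integral_cmult) measurable
    finally show ?thesis .
  qed
  have "(\<integral>\<^sup>+w. \<integral>\<^sup>+a. \<Phi> w a \<partial>?P \<partial>lborel) = ennreal (pi * K) * (\<integral>\<^sup>+a. \<Phi> 0 a \<partial>?P)"
  proof -
    have "(\<integral>\<^sup>+w. \<integral>\<^sup>+a. \<Phi> w a \<partial>?P \<partial>lborel) =
        (\<integral>\<^sup>+w. ennreal (exp (- (cmod w)\<^sup>2 / K)) * (\<integral>\<^sup>+a. \<Phi> 0 a \<partial>?P) \<partial>lborel)"
      by (intro nn_integral_cong shift)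
    also have "\<dots> = ennreal (pi * K) * (\<integral>\<^sup>+a. \<Phi> 0 a \<partial>?P)"
      by (subst nn_integral_multc) (measurable, simp only: nn_integral_gauss_scale[OF K0])
    finally show ?thesis .
  qed
  moreover have "(\<integral>\<^sup>+w. \<integral>\<^sup>+a. \<Phi> w a \<partial>?P \<partial>lborel) = ennreal T"
  proof -
    interpret pair_sigma_finite lborel ?P
      by (intro pair_sigma_finite.intro sigma_finite_lborel P.sigma_finite_measure_axioms)
    have "(\<integral>\<^sup>+w. \<integral>\<^sup>+a. \<Phi> w a \<partial>?P \<partial>lborel) = (\<integral>\<^sup>+a. \<integral>\<^sup>+w. \<Phi> w a \<partial>lborel \<partial>?P)"
      by (rule Fubini'[symmetric]) measurable
    also have "\<dots> = (\<integral>\<^sup>+a. \<integral>\<^sup>+x. ennreal ((cmod (S a + l0 * x))\<^sup>2) \<partial>cgauss \<partial>?P)"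
    proof (intro nn_integral_cong)
      fix a
      have "(\<integral>\<^sup>+w. \<Phi> w a \<partial>lborel) = (\<integral>\<^sup>+w. ennreal (exp (- (cmod w)\<^sup>2) / pi) * ennreal ((cmod (l0 * w + S a))\<^sup>2) \<partial>lborel)"
        unfolding \<Phi>_def
        using nn_integral_lborel_shift[of "\<lambda>w. ennreal (exp (- (cmod w)\<^sup>2) / pi) * ennreal ((cmod (l0 * w + S a))\<^sup>2)" "- h a"]
        by simp
      also have "\<dots> = (\<integral>\<^sup>+x. ennreal ((cmod (S a + l0 * x))\<^sup>2) \<partial>cgauss)"
        by (subst nn_integral_cgauss) (simp_all add: add.commute)
      finally show "(\<integral>\<^sup>+w. \<Phi> w a \<partial>lborel) = (\<integral>\<^sup>+x. ennreal ((cmod (S a + l0 * x))\<^sup>2) \<partial>cgauss)" .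
    qed
    also have "\<dots> = (\<integral>\<^sup>+a. ennreal ((cmod (0 + (\<Sum>k\<in>J. l k * a k)))\<^sup>2) + ennreal ((cmod l0)\<^sup>2) \<partial>?P)"
      unfolding second_moment_affine_cgauss by (simp add: S_def)
    also have "\<dots> = ennreal T"
    proof (subst nn_integral_add)
      have "emeasure ?P (space ?P) = 1"
        using J by (intro prob_space.emeasure_space_1 prob_space_PiM prob_space_cgauss)
      thus "(\<integral>\<^sup>+a. ennreal ((cmod (0 + (\<Sum>k\<in>J. l k * a k)))\<^sup>2) \<partial>?P) + (\<integral>\<^sup>+a. ennreal ((cmod l0)\<^sup>2) \<partial>?P) = ennreal T"
        unfolding second_moment_PiM_cgauss[OF J]
        by (simp add: T_def ennreal_plus[symmetric] sum_nonneg add.commute del: ennreal_plus)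
    qed measurable
    finally show ?thesis .
  qed
  ultimately have "ennreal (pi * K) * (\<integral>\<^sup>+a. \<Phi> 0 a \<partial>?P) = ennreal (pi * K) * ennreal (T / (pi * K))"
    using K0 T0 by (simp flip: ennreal_mult)
  hence "(\<integral>\<^sup>+a. \<Phi> 0 a \<partial>?P) = ennreal (T / (pi * K))"
    unfolding ennreal_mult_cancel_left using K0 by simp
  thus ?thesis by (simp add: \<Phi>_def T_def h_def S_def)
qed

text \<open>Here \<open>c\<close> is the regression coefficient of the form on the constraint.
  Subtracting \<open>c\<close> times the constraint makes the form uncorrelated with it, and on the
  fibre where the constraint vanishes this changes nothing.\<close>

lemma conditional_second_moment:
  fixes e l :: "'k \<Rightarrow> complex" and l0 :: complex
  assumes J: "finite J"
  defines "K \<equiv> 1 + (\<Sum>k\<in>J. (cmod (e k))\<^sup>2)"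
  defines "c \<equiv> (l0 + (\<Sum>k\<in>J. l k * cnj (e k))) / of_real K"
  shows "(\<integral>\<^sup>+a. ennreal (exp (- (cmod (\<Sum>k\<in>J. e k * a k))\<^sup>2) / pi) *
            ennreal ((cmod (- l0 * (\<Sum>k\<in>J. e k * a k) + (\<Sum>k\<in>J. l k * a k)))\<^sup>2)
            \<partial>PiM J (\<lambda>_. cgauss)) =
         ennreal (((cmod (l0 - c))\<^sup>2 + (\<Sum>k\<in>J. (cmod (l k - c * e k))\<^sup>2)) / (pi * K))"
proof -
  have K0: "K > 0" unfolding K_def by (simp add: sum_nonneg add_pos_nonneg)
  have Ke: "complex_of_real K = 1 + (\<Sum>k\<in>J. e k * cnj (e k))"
    unfolding K_def of_real_add of_real_sum by (simp add: complex_norm_square del: of_real_power)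
  have cK: "c * of_real K = l0 + (\<Sum>k\<in>J. l k * cnj (e k))" using K0 by (simp add: c_def)
  have "(l0 - c) + (\<Sum>k\<in>J. (l k - c * e k) * cnj (e k)) = 0"
  proof -
    have "(\<Sum>k\<in>J. (l k - c * e k) * cnj (e k)) = (\<Sum>k\<in>J. l k * cnj (e k)) - c * (\<Sum>k\<in>J. e k * cnj (e k))"
      by (simp only: left_diff_distrib sum_subtractf mult.assoc sum_distrib_left)
    thus ?thesis using Ke cK by (simp add: distrib_left) (simp add: algebra_simps)
  qed
  note conditional_second_moment_orthogonal[OF J this, folded K_def]
  moreover have "- (l0 - c) * (\<Sum>k\<in>J. e k * a k) + (\<Sum>k\<in>J. (l k - c * e k) * a k) =
      - l0 * (\<Sum>k\<in>J. e k * a k) + (\<Sum>k\<in>J. l k * a k)" for a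
  proof -
    have "(\<Sum>k\<in>J. (l k - c * e k) * a k) = (\<Sum>k\<in>J. l k * a k) - c * (\<Sum>k\<in>J. e k * a k)"
      by (simp only: left_diff_distrib sum_subtractf mult.assoc sum_distrib_left)
    thus ?thesis by (simp add: algebra_simps)
  qed
  ultimately show ?thesis by (simp only:)
qed

text \<open>Pythagoras: removing the projection on the constraint lowers the squared norm by |c|^2
  K. This inequality serves the upper bound on bad zeros; the exact formula serves the lower bound
  on all zeros.\<close>

lemma conditional_second_moment_le:
  fixes e l :: "'k \<Rightarrow> complex" and l0 :: complex
  assumes J: "finite J"
  defines "K \<equiv> 1 + (\<Sum>k\<in>J. (cmod (e k))\<^sup>2)"
  shows "(\<integral>\<^sup>+a. ennreal (exp (- (cmod (\<Sum>k\<in>J. e k * a k))\<^sup>2) / pi) *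
            ennreal ((cmod (- l0 * (\<Sum>k\<in>J. e k * a k) + (\<Sum>k\<in>J. l k * a k)))\<^sup>2)
            \<partial>PiM J (\<lambda>_. cgauss)) \<le>
         ennreal (((cmod l0)\<^sup>2 + (\<Sum>k\<in>J. (cmod (l k))\<^sup>2)) / (pi * K))"
proof -
  define c where "c = (l0 + (\<Sum>k\<in>J. l k * cnj (e k))) / of_real K"
  have K0: "K > 0" unfolding K_def by (simp add: sum_nonneg add_pos_nonneg)
  have c: "l0 + (\<Sum>k\<in>J. l k * cnj (e k)) = c * of_real K" using K0 by (simp add: c_def)
  have sq: "(cmod (x - c * y))\<^sup>2 = (cmod x)\<^sup>2 - 2 * Re (cnj c * (x * cnj y)) + (cmod c)\<^sup>2 * (cmod y)\<^sup>2" for x y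
    unfolding cmod_power2 by (simp add: power2_eq_square algebra_simps)
  have "(\<Sum>k\<in>J. (cmod (l k - c * e k))\<^sup>2) = (\<Sum>k\<in>J. (cmod (l k))\<^sup>2) -
      2 * Re (cnj c * (\<Sum>k\<in>J. l k * cnj (e k))) + (cmod c)\<^sup>2 * (\<Sum>k\<in>J. (cmod (e k))\<^sup>2)"
    unfolding sq by (simp only: sum.distrib sum_subtractf sum_distrib_left Re_sum)
  moreover have "(cmod (l0 - c))\<^sup>2 = (cmod l0)\<^sup>2 - 2 * Re (cnj c * l0) + (cmod c)\<^sup>2"
    using sq[of l0 1] by simp
  ultimately have "(cmod (l0 - c))\<^sup>2 + (\<Sum>k\<in>J. (cmod (l k - c * e k))\<^sup>2) =
      ((cmod l0)\<^sup>2 + (\<Sum>k\<in>J. (cmod (l k))\<^sup>2)) -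
      2 * Re (cnj c * (l0 + (\<Sum>k\<in>J. l k * cnj (e k)))) + (cmod c)\<^sup>2 * K"
    unfolding K_def distrib_left plus_complex.sel by simp
  also have "cnj c * (l0 + (\<Sum>k\<in>J. l k * cnj (e k))) = of_real ((cmod c)\<^sup>2 * K)"
    unfolding c by (simp add: complex_norm_square mult_ac del: of_real_power)
  also have "((cmod l0)\<^sup>2 + (\<Sum>k\<in>J. (cmod (l k))\<^sup>2)) - 2 * Re (of_real ((cmod c)\<^sup>2 * K)) + (cmod c)\<^sup>2 * K \<le>
      (cmod l0)\<^sup>2 + (\<Sum>k\<in>J. (cmod (l k))\<^sup>2)"
    using K0 by (simp del: of_real_mult)
  finally show ?thesis
    unfolding conditional_second_moment[OF J] K_def[symmetric] c_def[symmetric] using K0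
    by (intro ennreal_leI divide_right_mono) auto
qed

section \<open>The Kac--Rice formula\<close>

definition su2_basis :: "nat \<Rightarrow> complex \<Rightarrow> nat \<Rightarrow> complex" where
  "su2_basis n z k = of_real (sqrt (real (n choose k))) * z ^ k"

text \<open>At \<open>k = 0\<close> the truncated exponent \<open>k - 1\<close> is again 0, but the
  factor \<open>k\<close> kills the term.\<close>

definition su2_basis_deriv :: "nat \<Rightarrow> complex \<Rightarrow> nat \<Rightarrow> complex" where
  "su2_basis_deriv n z k = of_real (sqrt (real (n choose k))) * (of_nat k * z ^ (k - 1))"

lemma poly_su2_poly: "poly (su2_poly n a) z = (\<Sum>k\<le>n. su2_basis n z k * a k)"
  by (simp add: su2_poly_def su2_basis_def poly_sum poly_monom mult_ac)

lemma poly_pderiv_su2_poly: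
  "poly (pderiv (su2_poly n a)) z = (\<Sum>k\<le>n. su2_basis_deriv n z k * a k)"
  by (simp add: su2_poly_def su2_basis_deriv_def higher_pderiv_sum[where n = 1, simplified]
      pderiv_monom poly_sum poly_monom mult_ac)

lemma coeff_su2_poly: "k \<le> n \<Longrightarrow> coeff (su2_poly n a) k = a k * of_real (sqrt (real (n choose k)))"
  by (simp add: su2_poly_def coeff_sum coeff_monom sum.delta)

lemma degree_su2_poly: "a n \<noteq> 0 \<Longrightarrow> degree (su2_poly n a) = n"
proof (intro antisym le_degree)
  show "degree (su2_poly n a) \<le> n"
    unfolding su2_poly_def by (intro degree_sum_le) (auto intro: degree_monom_le[THEN order_trans])
qed (simp add: coeff_su2_poly)

lemma atMost_eq_insert_0: "{..n} = insert 0 {1..n::nat}"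
  by auto

text \<open>This singles out a_0: it enters p(z) with coefficient 1 and p'(z) not at all, so p(z) =
  0 can be solved for a_0 without affecting the weight |p'(z)|^2.\<close>

lemma su2_basis_0 [simp]: "su2_basis n z 0 = 1"
  and su2_basis_deriv_0 [simp]: "su2_basis_deriv n z 0 = 0"
  by (simp_all add: su2_basis_def su2_basis_deriv_def)

lemma measurable_su2_basis [measurable]:
  "(\<lambda>z. su2_basis n z k) \<in> borel_measurable borel"
  "(\<lambda>z. su2_basis_deriv n z k) \<in> borel_measurable borel"
  unfolding su2_basis_def su2_basis_deriv_def by measurable

lemma AE_cgauss_nonzero: "AE x in cgauss. x \<noteq> 0"
proof -
  have "AE x in lborel. x \<noteq> (0::complex)" by (rule AE_lborel_singleton)
  thus ?thesis unfolding cgauss_def by (subst AE_density) auto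
qed

lemma AE_PiM_cgauss_nonzero: "k \<in> J \<Longrightarrow> AE a in PiM J (\<lambda>_. cgauss). a k \<noteq> 0"
  by (rule AE_PiM_component[OF prob_space_cgauss _ AE_cgauss_nonzero])

lemma sets_PiM_cgauss [measurable_cong]: "sets (PiM J (\<lambda>_. cgauss)) = sets (PiM J (\<lambda>_. borel))"
  by (intro sets_PiM_cong) auto

text \<open>
  For fixed \<open>a\<^sub>1, \<dots>, a\<^sub>n\<close> the zeros are the preimages of \<open>- a\<^sub>0\<close>
  under a polynomial, so that the area formula applies in the variable \<open>a\<^sub>0\<close>.
\<close>

lemma kac_rice:
  fixes G :: "complex \<Rightarrow> (nat \<Rightarrow> complex) \<Rightarrow> ennreal"
  assumes n: "n \<ge> 1" and lab: "zero_labelling n \<zeta>"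
    and G[measurable]: "(\<lambda>(z, a). G z a) \<in> borel_measurable (borel \<Otimes>\<^sub>M PiM {..n} (\<lambda>_. cgauss))"
  defines "h \<equiv> \<lambda>z a. \<Sum>k\<in>{1..n}. su2_basis n z k * a k"
    and "h' \<equiv> \<lambda>z a. \<Sum>k\<in>{1..n}. su2_basis_deriv n z k * a k"
  shows "(\<integral>\<^sup>+a. (\<Sum>i\<in>{1..n}. G (\<zeta> a i) a) \<partial>PiM {..n} (\<lambda>_. cgauss)) =
    (\<integral>\<^sup>+z. \<integral>\<^sup>+a. ennreal (exp (- (cmod (h z a))\<^sup>2) / pi) * ennreal ((cmod (h' z a))\<^sup>2) * G z (a(0 := - h z a))
       \<partial>PiM {1..n} (\<lambda>_. cgauss) \<partial>lborel)"
proof -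
  let ?Q = "PiM {..n} (\<lambda>_. cgauss)" and ?P = "PiM {1..n} (\<lambda>_. cgauss)"
  interpret P: sigma_finite_measure ?P by (rule cgauss_PiM.sigma_finite) simp
  interpret pair_sigma_finite lborel ?P
    by (intro pair_sigma_finite.intro sigma_finite_lborel P.sigma_finite_measure_axioms)
  have \<zeta>_meas[measurable]: "(\<lambda>a. \<zeta> a i) \<in> borel_measurable ?Q" if "i \<in> {1..n}" for i
    using lab that unfolding zero_labelling_def by (simp cong: measurable_cong_sets[OF sets_PiM_cgauss])
  have upd: "(\<lambda>(a, x). a(0 := x)) \<in> measurable (?P \<Otimes>\<^sub>M cgauss) ?Q"
    using measurable_add_dim[of 0 "{1..n}" "\<lambda>_. cgauss"] by (simp add: atMost_eq_insert_0)
  have upd': "(\<lambda>x. (f x)(0 := g x)) \<in> measurable N ?Q"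
    if "f \<in> measurable N ?P" "g \<in> measurable N borel" for f g and N :: "'z measure"
    using measurable_compose[OF measurable_Pair[OF that(1) that(2)[folded measurable_cong_sets[OF refl sets_cgauss]]] upd]
    by simp
  have [measurable]: "(\<lambda>(z, a). h z a) \<in> borel_measurable (borel \<Otimes>\<^sub>M ?P)"
    "(\<lambda>(z, a). h' z a) \<in> borel_measurable (borel \<Otimes>\<^sub>M ?P)"
    unfolding h_def h'_def by measurable
  have GG: "(\<lambda>x. G (f x) (g x)) \<in> borel_measurable N"
    if "f \<in> measurable N borel" "g \<in> measurable N ?Q" for f g and N :: "'z measure"
    using measurable_compose[OF measurable_Pair[OF that] G] by simp
  have Gm[measurable]: "(\<lambda>(z, a). G z (a(0 := - h z a))) \<in> borel_measurable (borel \<Otimes>\<^sub>M ?P)"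
    unfolding case_prod_beta' by (intro GG upd') measurable
  have "(\<integral>\<^sup>+a. (\<Sum>i\<in>{1..n}. G (\<zeta> a i) a) \<partial>?Q) =
      (\<integral>\<^sup>+a. \<integral>\<^sup>+x. (\<Sum>i\<in>{1..n}. G (\<zeta> (a(0 := x)) i) (a(0 := x))) \<partial>cgauss \<partial>?P)"
    unfolding atMost_eq_insert_0
  proof (rule cgauss_PiM.product_nn_integral_insert)
    show "(\<lambda>a. \<Sum>i = 1..n. G (\<zeta> a i) a) \<in> borel_measurable (PiM (insert 0 {1..n}) (\<lambda>_. cgauss))"
      unfolding atMost_eq_insert_0[symmetric]
      by (intro borel_measurable_sum GG \<zeta>_meas) auto
  qed auto
  also have "\<dots> = (\<integral>\<^sup>+a. \<integral>\<^sup>+z. ennreal (exp (- (cmod (h z a))\<^sup>2) / pi) *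
      ennreal ((cmod (h' z a))\<^sup>2) * G z (a(0 := - h z a)) \<partial>lborel \<partial>?P)"
  proof (intro nn_integral_cong_AE)
    have nz: "AE a in ?P. a n \<noteq> 0" using n by (intro AE_PiM_cgauss_nonzero) auto
    have fibre: "(\<integral>\<^sup>+x. (\<Sum>i\<in>{1..n}. G (\<zeta> (a(0 := x)) i) (a(0 := x))) \<partial>cgauss) =
        (\<integral>\<^sup>+z. ennreal (exp (- (cmod (h z a))\<^sup>2) / pi) * ennreal ((cmod (h' z a))\<^sup>2) * G z (a(0 := - h z a)) \<partial>lborel)"
      if a: "a \<in> space ?P" "a n \<noteq> 0" for a
    proof -
      define P where "P = su2_poly n (a(0 := 0))"
      have a_const[measurable]: "(\<lambda>_. a) \<in> measurable N ?P" for N :: "'z measure" using a by simp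
      have P: "poly P z = h z a" and P': "poly (pderiv P) z = h' z a" for z
        unfolding P_def poly_su2_poly poly_pderiv_su2_poly h_def h'_def atMost_eq_insert_0
        by (auto intro!: sum.cong)
      have deg: "degree P = n" unfolding P_def using a n by (intro degree_su2_poly) auto
      have diff: "su2_poly n (a(0 := - y)) = P - [:y:]" for y
      proof (rule poly_eqI)
        fix k
        show "coeff (su2_poly n (a(0 := - y))) k = coeff (P - [:y:]) k"
          unfolding P_def using n
          by (cases "k \<le> n"; cases "k = 0")
             (auto simp: coeff_su2_poly su2_poly_def coeff_sum coeff_monom coeff_pCons split: nat.splits)
      qed
      \<comment> \<open>The sign is that of y = - a_0: solutions of P = y are zeros of the
        polynomial with constant coefficient - y.\<close>
      define \<xi> where "\<xi> = (\<lambda>i y. \<zeta> (a(0 := - y)) i)"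
      have \<xi>[measurable]: "\<xi> i \<in> borel_measurable borel" if "i \<in> {1..n}" for i
        unfolding \<xi>_def
        by (rule measurable_compose[OF upd' \<zeta>_meas[OF that]]) measurable
      have roots: "proots (P - [:y:]) = image_mset (\<lambda>i. \<xi> i y) (mset_set {1..n})" for y
      proof -
        have "a(0 := - y) \<in> PiE {..n} (\<lambda>_. UNIV)"
          using a(1) by (auto simp: space_PiM PiE_def extensional_def)
        moreover have "(a(0 := - y)) n \<noteq> 0" using a n by simp
        ultimately show ?thesis
          using lab unfolding zero_labelling_def \<xi>_def diff[symmetric] by blast
      qed
      have root: "poly P (\<xi> i y) = y" if "i \<in> {1..n}" for i y
      proof -
        have "\<xi> i y \<in># proots (P - [:y:])" unfolding roots using that by simp
        moreover have "P - [:y:] \<noteq> 0" using deg n by (auto simp: eq_iff_diff_eq_0[symmetric])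
        ultimately show ?thesis by simp
      qed
      \<comment> \<open>At a solution of P = y the level y is \<open>h z a\<close>. Substituting
        this turns the whole integrand, Gaussian density included, into a function of the root
        alone, as the area formula demands.\<close>
      define F where "F = (\<lambda>z. ennreal (exp (- (cmod (h z a))\<^sup>2) / pi) * G z (a(0 := - h z a)))"
      have [measurable]: "(\<lambda>z. h z a) \<in> borel_measurable borel" unfolding h_def by measurable
      have [measurable]: "(\<lambda>z. G z (a(0 := - h z a))) \<in> borel_measurable borel"
        by (intro GG upd') measurable
      have F[measurable]: "F \<in> borel_measurable borel" unfolding F_def by measurable
      have m: "(\<lambda>x. \<Sum>i\<in>{1..n}. G (\<zeta> (a(0 := x)) i) (a(0 := x))) \<in> borel_measurable borel"
        by (intro borel_measurable_sum GG upd' measurable_compose[OF upd' \<zeta>_meas]) measurable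
      have "(\<integral>\<^sup>+x. (\<Sum>i\<in>{1..n}. G (\<zeta> (a(0 := x)) i) (a(0 := x))) \<partial>cgauss) =
          (\<integral>\<^sup>+x. ennreal (exp (- (cmod x)\<^sup>2) / pi) * (\<Sum>i\<in>{1..n}. G (\<zeta> (a(0 := x)) i) (a(0 := x))) \<partial>lborel)"
        by (rule nn_integral_cgauss[OF m])
      also have "\<dots> = (\<integral>\<^sup>+y. ennreal (exp (- (cmod (- y))\<^sup>2) / pi) * (\<Sum>i\<in>{1..n}. G (\<zeta> (a(0 := - y)) i) (a(0 := - y))) \<partial>lborel)"
        using m by (subst nn_integral_lborel_scale[of _ "-1"]) auto
      also have "\<dots> = (\<integral>\<^sup>+y. (\<Sum>i\<in>{1..n}. F (\<xi> i y)) \<partial>lborel)"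
      proof (intro nn_integral_cong)
        fix y
        have "(\<Sum>i\<in>{1..n}. F (\<xi> i y)) = (\<Sum>i\<in>{1..n}. ennreal (exp (- (cmod y)\<^sup>2) / pi) * G (\<xi> i y) (a(0 := - y)))"
          unfolding F_def P[symmetric] by (intro sum.cong) (auto simp: root)
        thus "ennreal (exp (- (cmod (- y))\<^sup>2) / pi) * (\<Sum>i\<in>{1..n}. G (\<zeta> (a(0 := - y)) i) (a(0 := - y))) =
            (\<Sum>i\<in>{1..n}. F (\<xi> i y))"
          by (simp add: sum_distrib_left \<xi>_def)
      qed
      also have "\<dots> = (\<integral>\<^sup>+z. ennreal ((cmod (poly (pderiv P) z))\<^sup>2) * F z \<partial>lborel)"
        using deg n by (intro nn_integral_root_labelling \<xi> roots F) auto
      finally show ?thesis by (simp add: P' F_def mult_ac)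
    qed
    show "AE a in ?P. (\<integral>\<^sup>+x. (\<Sum>i\<in>{1..n}. G (\<zeta> (a(0 := x)) i) (a(0 := x))) \<partial>cgauss) =
        (\<integral>\<^sup>+z. ennreal (exp (- (cmod (h z a))\<^sup>2) / pi) * ennreal ((cmod (h' z a))\<^sup>2) * G z (a(0 := - h z a)) \<partial>lborel)"
      using nz AE_space by eventually_elim (rule fibre)
  qed
  also have "\<dots> = (\<integral>\<^sup>+z. \<integral>\<^sup>+a. ennreal (exp (- (cmod (h z a))\<^sup>2) / pi) *
      ennreal ((cmod (h' z a))\<^sup>2) * G z (a(0 := - h z a)) \<partial>?P \<partial>lborel)"
    by (rule Fubini') measurable
  finally show ?thesis .
qed

section \<open>Expected numbers of zeros\<close>

lemma sum_norm_su2_basis: "(\<Sum>k\<le>n. (cmod (su2_basis n z k))\<^sup>2) = (1 + (cmod z)\<^sup>2) ^ n"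
proof -
  have "(1 + (cmod z)\<^sup>2) ^ n = ((cmod z)\<^sup>2 + 1) ^ n" by (simp add: add.commute)
  also have "\<dots> = (\<Sum>k\<le>n. (cmod (su2_basis n z k))\<^sup>2)"
    unfolding binomial_ring
    by (intro sum.cong)
       (auto simp: su2_basis_def norm_mult norm_power power_mult_distrib power_mult[symmetric] mult.commute)
  finally show ?thesis by simp
qed

lemma sum_norm_su2_basis': "1 + (\<Sum>k\<in>{1..n}. (cmod (su2_basis n z k))\<^sup>2) = (1 + (cmod z)\<^sup>2) ^ n"
  unfolding sum_norm_su2_basis[symmetric] atMost_eq_insert_0 by simp

text \<open>Variance plus squared bias of a binomial variable about a complex centre
  \<open>m\<close>. Writing k^2 as k (k - 1) + k reduces it to the factorial moments of the
  Bernstein weights.\<close>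

lemma sum_Bernstein_square_deviation:
  fixes m :: complex
  shows "(\<Sum>k\<le>n. Bernstein n k x * (cmod (of_nat k - m))\<^sup>2) =
    real n * x * (1 - x) + (cmod (of_real (real n * x) - m))\<^sup>2"
proof -
  have dev: "(cmod (of_nat k - m))\<^sup>2 = real k * (real k - 1) + real k * (1 - 2 * Re m) + (cmod m)\<^sup>2" for k
    unfolding cmod_power2 by (simp add: power2_eq_square algebra_simps)
  have "(\<Sum>k\<le>n. Bernstein n k x * (cmod (of_nat k - m))\<^sup>2) =
      (\<Sum>k\<le>n. real k * (real k - 1) * Bernstein n k x) + (1 - 2 * Re m) * (\<Sum>k\<le>n. real k * Bernstein n k x) +
      (cmod m)\<^sup>2 * (\<Sum>k\<le>n. Bernstein n k x)"
    unfolding dev sum_distrib_left sum.distrib[symmetric] by (intro sum.cong) (auto simp: algebra_simps)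
  also have "\<dots> = real n * (real n - 1) * x\<^sup>2 + (1 - 2 * Re m) * (real n * x) + (cmod m)\<^sup>2"
    by simp
  also have "\<dots> = real n * x * (1 - x) + (cmod (of_real (real n * x) - m))\<^sup>2"
    unfolding cmod_power2 by (simp add: power2_eq_square algebra_simps)
  finally show ?thesis .
qed

text \<open>Up to the factor \<open>(1 + |z|\<^sup>2)\<^sup>n / |z|\<^sup>2\<close> the sum is the mean square deviation of a binomial variable
  from \<open>c z\<close>, hence at least its variance.\<close>

lemma sum_norm_su2_basis_deriv_ge:
  assumes z: "z \<noteq> 0"
  shows "(\<Sum>k\<le>n. (cmod (su2_basis_deriv n z k - c * su2_basis n z k))\<^sup>2) \<ge>
    real n * (1 + (cmod z)\<^sup>2) ^ n / (1 + (cmod z)\<^sup>2)\<^sup>2"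
proof -
  define y where "y = 1 + (cmod z)\<^sup>2"
  define x where "x = (cmod z)\<^sup>2 / y"
  have y0: "y > 0" and z0: "(cmod z)\<^sup>2 > 0" using z one_plus_pos[of z] by (auto simp: y_def)
  have x1: "1 - x = 1 / y" using y0 by (simp add: x_def y_def field_simps)
  have B: "Bernstein n k x = real (n choose k) * (cmod z) ^ (2 * k) / y ^ n" if "k \<le> n" for k
  proof -
    have "y ^ n = y ^ k * y ^ (n - k)" using that by (simp flip: power_add)
    thus ?thesis unfolding Bernstein_def x1 by (simp add: x_def power_divide power_mult)
  qed
  have summand: "(cmod (su2_basis_deriv n z k - c * su2_basis n z k))\<^sup>2 =
      y ^ n / (cmod z)\<^sup>2 * (Bernstein n k x * (cmod (of_nat k - c * z))\<^sup>2)" if "k \<le> n" for k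
  proof -
    \<comment> \<open>Multiplication by z turns k z^(k-1) into k z^k, so that the two vectors differ
      by the factor k - c z; undoing it needs z nonzero.\<close>
    have "z * (su2_basis_deriv n z k - c * su2_basis n z k) =
        of_real (sqrt (real (n choose k))) * z ^ k * (of_nat k - c * z)"
      by (cases k) (simp_all add: su2_basis_def su2_basis_deriv_def algebra_simps)
    hence "(cmod z)\<^sup>2 * (cmod (su2_basis_deriv n z k - c * su2_basis n z k))\<^sup>2 =
        real (n choose k) * (cmod z) ^ (2 * k) * (cmod (of_nat k - c * z))\<^sup>2"
      unfolding power_mult_distrib[symmetric] norm_mult[symmetric]
      by (simp add: norm_mult norm_power power_mult_distrib power_mult[symmetric] mult.commute)
    thus ?thesis using z0 y0 unfolding B[OF that] by (simp add: field_simps)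
  qed
  have "real n * y ^ n / y\<^sup>2 = y ^ n / (cmod z)\<^sup>2 * (real n * x * (1 - x))"
    using z z0 y0 unfolding x1 by (simp add: x_def field_simps power2_eq_square)
  also have "\<dots> \<le> y ^ n / (cmod z)\<^sup>2 * (\<Sum>k\<le>n. Bernstein n k x * (cmod (of_nat k - c * z))\<^sup>2)"
    unfolding sum_Bernstein_square_deviation using y0 by (intro mult_left_mono) auto
  also have "\<dots> = (\<Sum>k\<le>n. (cmod (su2_basis_deriv n z k - c * su2_basis n z k))\<^sup>2)"
    unfolding sum_distrib_left by (intro sum.cong) (auto simp: summand)
  finally show ?thesis by (simp add: y_def)
qed

text \<open>The Kac--Rice density at z is the residual variance of p'(z) after regression on p(z),
  divided by pi (1 + |z|^2)^n. The bound is the rotation-invariant density of n points on the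
  sphere, in the affine coordinate.\<close>

lemma zero_density_ge:
  assumes z: "z \<noteq> 0"
  shows "(\<integral>\<^sup>+a. ennreal (exp (- (cmod (\<Sum>k\<in>{1..n}. su2_basis n z k * a k))\<^sup>2) / pi) *
            ennreal ((cmod (\<Sum>k\<in>{1..n}. su2_basis_deriv n z k * a k))\<^sup>2)
            \<partial>PiM {1..n} (\<lambda>_. cgauss)) \<ge>
         ennreal (real n / (pi * (1 + (cmod z)\<^sup>2)\<^sup>2))"
proof -
  define K where "K = (1 + (cmod z)\<^sup>2) ^ n"
  have K0: "K > 0" unfolding K_def by (simp add: one_plus_pos)
  define c where "c = (0 + (\<Sum>k\<in>{1..n}. su2_basis_deriv n z k * cnj (su2_basis n z k))) / of_real K"
  have "(cmod (0 - c))\<^sup>2 + (\<Sum>k\<in>{1..n}. (cmod (su2_basis_deriv n z k - c * su2_basis n z k))\<^sup>2) =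
      (\<Sum>k\<le>n. (cmod (su2_basis_deriv n z k - c * su2_basis n z k))\<^sup>2)"
    unfolding atMost_eq_insert_0 by simp
  also have "\<dots> \<ge> real n * K / (1 + (cmod z)\<^sup>2)\<^sup>2"
    unfolding K_def by (rule sum_norm_su2_basis_deriv_ge[OF z])
  finally have le: "real n * K / (1 + (cmod z)\<^sup>2)\<^sup>2 / (pi * K) \<le>
      ((cmod (0 - c))\<^sup>2 + (\<Sum>k\<in>{1..n}. (cmod (su2_basis_deriv n z k - c * su2_basis n z k))\<^sup>2)) / (pi * K)"
    using K0 by (intro divide_right_mono) auto
  have eq1: "real n * K / (1 + (cmod z)\<^sup>2)\<^sup>2 / (pi * K) = real n / (pi * (1 + (cmod z)\<^sup>2)\<^sup>2)"
    using K0 by (simp add: field_simps)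
  have eq2: "(\<integral>\<^sup>+a. ennreal (exp (- (cmod (\<Sum>k\<in>{1..n}. su2_basis n z k * a k))\<^sup>2) / pi) *
            ennreal ((cmod (\<Sum>k\<in>{1..n}. su2_basis_deriv n z k * a k))\<^sup>2)
            \<partial>PiM {1..n} (\<lambda>_. cgauss)) =
      ennreal (((cmod (0 - c))\<^sup>2 + (\<Sum>k\<in>{1..n}. (cmod (su2_basis_deriv n z k - c * su2_basis n z k))\<^sup>2)) / (pi * K))"
    using conditional_second_moment[of "{1..n}" "su2_basis n z" 0 "su2_basis_deriv n z"]
    unfolding sum_norm_su2_basis' c_def[symmetric] K_def[symmetric] by simp
  show ?thesis unfolding eq2 using le unfolding eq1 by (rule ennreal_leI)
qed

text \<open>The polynomial near \<open>z\<close>, divided by the size \<open>(1 + |z|\<^sup>2)\<^bsup>n/2\<^esup> e\<^bsup>n V t\<^esup>\<close> it has at \<open>z + t\<close> on the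
  scale \<open>|t| \<sim> n\<^bsup>-1/2\<^esup>\<close>.\<close>

definition su2_local :: "nat \<Rightarrow> (nat \<Rightarrow> complex) \<Rightarrow> complex \<Rightarrow> complex \<Rightarrow> complex" where
  "su2_local n a z t = poly (su2_poly n a) (z + t) * exp (- (of_nat n * V_FS z * t)) /
     of_real (sqrt ((1 + (cmod z)\<^sup>2) ^ n))"

section \<open>Energy on a small circle and bad zeros\<close>

text \<open>The parameter interval has length 1, so this is the mean square over the circle. As an
  \<open>ennreal\<close> integral it is jointly measurable and can be exchanged with the integral
  over the coefficients.\<close>

definition circle_energy :: "nat \<Rightarrow> (nat \<Rightarrow> complex) \<Rightarrow> complex \<Rightarrow> ennreal" where
  "circle_energy n a z = (\<integral>\<^sup>+\<theta>. ennreal ((cmod (su2_local n a z (circlepath 0 (1 / sqrt n) \<theta>)))\<^sup>2) *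
     indicator {0..1} \<theta> \<partial>lborel)"

text \<open>At a zero the left-hand side is \<kappa>^2 |f'(0)|^2, because the term of f'(0)
  containing p(z) vanishes. Writing it with p' makes it directly comparable with the Kac--Rice
  weight.\<close>

definition bad_zero :: "real \<Rightarrow> nat \<Rightarrow> (nat \<Rightarrow> complex) \<Rightarrow> complex \<Rightarrow> bool" where
  "bad_zero \<kappa> n a z \<longleftrightarrow>
     ennreal (\<kappa>\<^sup>2 * (cmod (poly (pderiv (su2_poly n a)) z))\<^sup>2 / (1 + (cmod z)\<^sup>2) ^ n) \<le> circle_energy n a z"

definition su2_local_coeff :: "nat \<Rightarrow> complex \<Rightarrow> complex \<Rightarrow> nat \<Rightarrow> complex" where
  "su2_local_coeff n z t k = su2_basis n (z + t) k * exp (- (of_nat n * V_FS z * t)) /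
     of_real (sqrt ((1 + (cmod z)\<^sup>2) ^ n))"

lemma su2_local_eq_sum: "su2_local n a z t = (\<Sum>k\<le>n. su2_local_coeff n z t k * a k)"
  by (simp add: su2_local_def su2_local_coeff_def poly_su2_poly sum_distrib_left sum_distrib_right
      sum_divide_distrib mult_ac)

text \<open>\<open>V_FS\<close> is the z-derivative of log (1 + |z|^2), so the exponential factor
  cancels exactly the term linear in t of the logarithm of the variance. The rest is 1 + x \<le> exp
  x, raised to the n-th power.\<close>

lemma sum_norm_su2_local_coeff_le: "(\<Sum>k\<le>n. (cmod (su2_local_coeff n z t k))\<^sup>2) \<le> exp (real n * (cmod t)\<^sup>2)"
proof -
  define y where "y = 1 + (cmod z)\<^sup>2"
  have y0: "y > 0" "y \<ge> 1" using one_plus_pos[of z] by (auto simp: y_def)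
  have "(\<Sum>k\<le>n. (cmod (su2_local_coeff n z t k))\<^sup>2) =
      (\<Sum>k\<le>n. (cmod (su2_basis n (z + t) k))\<^sup>2) * ((cmod (exp (- (of_nat n * V_FS z * t))))\<^sup>2 / y ^ n)"
    using y0 unfolding su2_local_coeff_def y_def[symmetric]
    unfolding sum_distrib_right
    by (intro sum.cong) (simp_all add: norm_mult norm_divide power_mult_distrib power_divide del: norm_exp_eq_Re)
  also have "\<dots> = ((1 + (cmod (z + t))\<^sup>2) / y) ^ n * exp (- (2 * real n * Re (V_FS z * t)))"
    unfolding sum_norm_su2_basis norm_exp_eq_Re
    by (simp add: power_divide exp_double[symmetric] mult.assoc)
  also have "\<dots> \<le> exp (2 * Re (V_FS z * t) + (cmod t)\<^sup>2) ^ n * exp (- (2 * real n * Re (V_FS z * t)))"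
  proof (intro mult_right_mono power_mono)
    have Re: "Re (V_FS z * t) = Re (cnj z * t) / y"
      by (simp add: V_FS_def y_def[symmetric] Re_divide_of_real[symmetric] del: of_real_add)
    have "(1 + (cmod (z + t))\<^sup>2) = y + 2 * Re (cnj z * t) + (cmod t)\<^sup>2"
      unfolding cmod_power2 y_def by (simp add: power2_eq_square algebra_simps)
    hence "(1 + (cmod (z + t))\<^sup>2) / y = 1 + 2 * Re (V_FS z * t) + (cmod t)\<^sup>2 / y"
      using y0 unfolding Re by (simp add: field_simps)
    also have "(cmod t)\<^sup>2 / y \<le> (cmod t)\<^sup>2" 
      using y0 mult_left_mono[OF y0(2), of "(cmod t)\<^sup>2"] by (simp add: divide_le_eq)
    also have "1 + 2 * Re (V_FS z * t) + (cmod t)\<^sup>2 \<le> exp (2 * Re (V_FS z * t) + (cmod t)\<^sup>2)"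
      using exp_ge_add_one_self[of "2 * Re (V_FS z * t) + (cmod t)\<^sup>2"] by (simp add: add.assoc)
    finally show "(1 + (cmod (z + t))\<^sup>2) / y \<le> exp (2 * Re (V_FS z * t) + (cmod t)\<^sup>2)" by simp
  qed (use y0 in auto)
  also have "\<dots> = exp (real n * (cmod t)\<^sup>2)"
    unfolding exp_of_nat_mult[symmetric] exp_add[symmetric] by (simp add: algebra_simps)
  finally show ?thesis .
qed

lemma conditional_energy_le:
  fixes n :: nat
  defines "h \<equiv> \<lambda>z a. \<Sum>k\<in>{1..n}. su2_basis n z k * a k"
  shows "(\<integral>\<^sup>+a. ennreal (exp (- (cmod (h z a))\<^sup>2) / pi) *
            ennreal ((cmod (su2_local n (a(0 := - h z a)) z t))\<^sup>2)
            \<partial>PiM {1..n} (\<lambda>_. cgauss)) \<le>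
         ennreal (exp (real n * (cmod t)\<^sup>2) / (pi * (1 + (cmod z)\<^sup>2) ^ n))"
proof -
  define l where "l = su2_local_coeff n z t"
  have eq: "su2_local n (a(0 := - h z a)) z t =
      - l 0 * (\<Sum>k\<in>{1..n}. su2_basis n z k * a k) + (\<Sum>k\<in>{1..n}. l k * a k)" for a
    unfolding su2_local_eq_sum l_def[symmetric] atMost_eq_insert_0 h_def
    by (subst sum.insert) (auto intro!: sum.cong)
  have "(cmod (l 0))\<^sup>2 + (\<Sum>k\<in>{1..n}. (cmod (l k))\<^sup>2) \<le> exp (real n * (cmod t)\<^sup>2)"
    using sum_norm_su2_local_coeff_le[of n z t] unfolding l_def atMost_eq_insert_0 by simp
  moreover have "0 < pi * (1 + (cmod z)\<^sup>2) ^ n" by (simp add: one_plus_pos)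
  ultimately have "ennreal (((cmod (l 0))\<^sup>2 + (\<Sum>k\<in>{1..n}. (cmod (l k))\<^sup>2)) / (pi * (1 + (cmod z)\<^sup>2) ^ n)) \<le>
      ennreal (exp (real n * (cmod t)\<^sup>2) / (pi * (1 + (cmod z)\<^sup>2) ^ n))"
    by (intro ennreal_leI divide_right_mono) auto
  note le = this
  have "(\<integral>\<^sup>+a. ennreal (exp (- (cmod (h z a))\<^sup>2) / pi) *
            ennreal ((cmod (su2_local n (a(0 := - h z a)) z t))\<^sup>2) \<partial>PiM {1..n} (\<lambda>_. cgauss)) \<le>
      ennreal (((cmod (l 0))\<^sup>2 + (\<Sum>k\<in>{1..n}. (cmod (l k))\<^sup>2)) / (pi * (1 + (cmod z)\<^sup>2) ^ n))"
    unfolding eq unfolding h_def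
    using conditional_second_moment_le[of "{1..n}" "su2_basis n z" "l 0" l]
    unfolding sum_norm_su2_basis' by blast
  thus ?thesis using le by (rule order_trans)
qed

section \<open>Measurability, and the size of the annulus\<close>

lemma measurable_poly_su2_poly [measurable]:
  assumes [measurable]: "f \<in> borel_measurable N" and g: "g \<in> measurable N (PiM {..n} (\<lambda>_. cgauss))"
  shows "(\<lambda>x. poly (su2_poly n (g x)) (f x)) \<in> borel_measurable N"
    and "(\<lambda>x. poly (pderiv (su2_poly n (g x))) (f x)) \<in> borel_measurable N"
proof -
  have [measurable]: "(\<lambda>x. g x k) \<in> borel_measurable N" if "k \<in> {..n}" for k
    using measurable_compose[OF g measurable_component_singleton[OF that]]
    unfolding measurable_cong_sets[OF refl sets_cgauss] .
  show "(\<lambda>x. poly (su2_poly n (g x)) (f x)) \<in> borel_measurable N"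
    unfolding poly_su2_poly by measurable
  show "(\<lambda>x. poly (pderiv (su2_poly n (g x))) (f x)) \<in> borel_measurable N"
    unfolding poly_pderiv_su2_poly by measurable
qed

lemma measurable_V_FS [measurable]: "V_FS \<in> borel_measurable borel"
proof (rule borel_measurable_continuous_onI)
  have "complex_of_real (1 + (cmod z)\<^sup>2) \<noteq> 0" for z
    using one_plus_pos[of z] by (simp only: of_real_eq_0_iff)
  thus "continuous_on UNIV V_FS"
    unfolding V_FS_def[abs_def] by (intro continuous_intros) auto
qed

lemma measurable_circlepath [measurable]: "circlepath z r \<in> borel_measurable borel"
  unfolding circlepath by measurable

lemma measurable_su2_local [measurable]:
  assumes [measurable]: "f \<in> borel_measurable N" "t \<in> borel_measurable N"
    and [measurable]: "g \<in> measurable N (PiM {..n} (\<lambda>_. cgauss))"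
  shows "(\<lambda>x. su2_local n (g x) (f x) (t x)) \<in> borel_measurable N"
  unfolding su2_local_def by measurable

lemma measurable_circle_energy [measurable]:
  assumes [measurable]: "f \<in> borel_measurable N"
    and [measurable]: "g \<in> measurable N (PiM {..n} (\<lambda>_. cgauss))"
  shows "(\<lambda>x. circle_energy n (g x) (f x)) \<in> borel_measurable N"
  unfolding circle_energy_def by measurable

lemma pred_bad_zero [measurable]:
  assumes [measurable]: "f \<in> borel_measurable N"
    and [measurable]: "g \<in> measurable N (PiM {..n} (\<lambda>_. cgauss))"
  shows "Measurable.pred N (\<lambda>x. bad_zero \<kappa> n (g x) (f x))"
  unfolding bad_zero_def by measurable

lemma borel_annulus [measurable]: "annulus R \<in> sets borel"
  unfolding annulus_def by measurable

lemma bounded_annulus: "bounded (annulus R)"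
  by (rule bounded_subset[of "cball 0 R"]) (auto simp: annulus_def)

lemma emeasure_annulus: "emeasure lborel (annulus R) = ennreal (measure lborel (annulus R))"
  using emeasure_bounded_finite[OF bounded_annulus[of R]]
  by (intro emeasure_eq_ennreal_measure) (simp add: less_top)

lemma measure_annulus_pos:
  assumes "R > 1"
  shows "measure lborel (annulus R) > 0"
proof -
  \<comment> \<open>A ball of this radius about 1 stays outside |z| < 1/R by choice of r, and inside
    |z| \<le> R because R + 1/R \<ge> 2.\<close>
  define r where "r = 1 - inverse R"
  have r: "0 < r" "inverse R < 1" using assms by (auto simp: r_def inverse_less_1_iff)
  have "R + inverse R \<ge> 2"
    using assms sum_squares_ge_zero[of "R - 1" 0] by (simp add: field_simps power2_eq_square)
  hence rR: "1 + r \<le> R" by (simp add: r_def)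
  have sub: "ball 1 r \<subseteq> annulus R"
  proof
    fix z :: complex assume "z \<in> ball 1 r"
    hence "cmod (1 - z) < r" by (simp add: dist_norm)
    moreover have "1 - cmod z \<le> cmod (1 - z)" using norm_triangle_ineq2[of 1 z] by simp
    moreover have "cmod z - 1 \<le> cmod (1 - z)" using norm_triangle_ineq2[of z 1] by (simp add: norm_minus_commute)
    ultimately show "z \<in> annulus R" using rR by (auto simp: annulus_def r_def)
  qed
  have "0 < measure lborel (ball (1::complex) r)"
    using content_ball_pos[OF r(1), of "1::complex"] by simp
  also have "\<dots> \<le> measure lborel (annulus R)"
    using sub emeasure_annulus[of R] by (intro measure_mono_fmeasurable) (auto intro!: fmeasurableI)
  finally show ?thesis .
qed

lemma annulus_nonzero: "R > 1 \<Longrightarrow> z \<in> annulus R \<Longrightarrow> z \<noteq> 0"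
  by (auto simp: annulus_def)

section \<open>Expected counts in the annulus\<close>

text \<open>On the annulus the density is at least its value at |z| = R. Growth linear in
  \<open>n\<close> is what keeps the probability of the conditioning event away from 0.\<close>

lemma expected_zeros_annulus_ge:
  assumes n: "n \<ge> 1" and lab: "zero_labelling n \<zeta>" and R: "R > 1"
  shows "(\<integral>\<^sup>+a. (\<Sum>i\<in>{1..n}. indicator (annulus R) (\<zeta> a i)) \<partial>PiM {..n} (\<lambda>_. cgauss)) \<ge>
    ennreal (real n * (measure lborel (annulus R) / (pi * (1 + R\<^sup>2)\<^sup>2)))"
proof -
  have [measurable]: "(\<lambda>(z, a). indicator (annulus R) z :: ennreal) \<in>
      borel_measurable (borel \<Otimes>\<^sub>M PiM {..n} (\<lambda>_. cgauss))" by measurable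
  have "ennreal (real n * (measure lborel (annulus R) / (pi * (1 + R\<^sup>2)\<^sup>2))) =
      (\<integral>\<^sup>+z. ennreal (real n / (pi * (1 + R\<^sup>2)\<^sup>2)) * indicator (annulus R) z \<partial>lborel)"
    by (subst nn_integral_cmult_indicator) (simp_all add: emeasure_annulus ennreal_mult[symmetric])
  also have "\<dots> \<le> (\<integral>\<^sup>+z. \<integral>\<^sup>+a. ennreal (exp (- (cmod (\<Sum>k\<in>{1..n}. su2_basis n z k * a k))\<^sup>2) / pi) *
            ennreal ((cmod (\<Sum>k\<in>{1..n}. su2_basis_deriv n z k * a k))\<^sup>2) * indicator (annulus R) z
            \<partial>PiM {1..n} (\<lambda>_. cgauss) \<partial>lborel)"
  proof (intro nn_integral_mono)
    fix z :: complex
    show "ennreal (real n / (pi * (1 + R\<^sup>2)\<^sup>2)) * indicator (annulus R) z \<le>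
        (\<integral>\<^sup>+a. ennreal (exp (- (cmod (\<Sum>k\<in>{1..n}. su2_basis n z k * a k))\<^sup>2) / pi) *
            ennreal ((cmod (\<Sum>k\<in>{1..n}. su2_basis_deriv n z k * a k))\<^sup>2) * indicator (annulus R) z
            \<partial>PiM {1..n} (\<lambda>_. cgauss))"
    proof (cases "z \<in> annulus R")
      case True
      have "(1 + (cmod z)\<^sup>2)\<^sup>2 \<le> (1 + R\<^sup>2)\<^sup>2"
        using True by (intro power_mono add_left_mono) (auto simp: annulus_def)
      moreover have "0 < (1 + (cmod z)\<^sup>2)\<^sup>2" "0 < (1 + R\<^sup>2)\<^sup>2"
        by (intro zero_less_power add_pos_nonneg; simp)+
      ultimately have "ennreal (real n / (pi * (1 + R\<^sup>2)\<^sup>2)) \<le> ennreal (real n / (pi * (1 + (cmod z)\<^sup>2)\<^sup>2))"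
        by (intro ennreal_leI divide_left_mono mult_left_mono mult_pos_pos) simp_all
      also note zero_density_ge[OF annulus_nonzero[OF R True], of n]
      finally show ?thesis using True by simp
    qed simp
  qed
  also have "\<dots> = (\<integral>\<^sup>+a. (\<Sum>i\<in>{1..n}. indicator (annulus R) (\<zeta> a i)) \<partial>PiM {..n} (\<lambda>_. cgauss))"
    by (rule kac_rice[OF n lab, symmetric]) measurable
  finally show ?thesis .
qed

text \<open>At a bad zero \<open>|p'|\<^sup>2\<close> is at most a multiple of the energy, so the weight \<open>|p'|\<^sup>2\<close> in the Kac--Rice
  formula can be replaced by a quantity that is bounded, rather than of order \<open>n\<close>, in the mean.\<close>

lemma expected_bad_zeros_le:
  assumes n: "n \<ge> 1" and lab: "zero_labelling n \<zeta>" and \<kappa>: "\<kappa> > 0"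
  shows "(\<integral>\<^sup>+a. (\<Sum>i\<in>{1..n}. indicator (annulus R) (\<zeta> a i) * indicator {z. bad_zero \<kappa> n a z} (\<zeta> a i))
       \<partial>PiM {..n} (\<lambda>_. cgauss)) \<le> ennreal (measure lborel (annulus R) * exp 1 / (pi * \<kappa>\<^sup>2))"
proof -
  let ?P = "PiM {1..n} (\<lambda>_. cgauss)" and ?Q = "PiM {..n} (\<lambda>_. cgauss)"
  define h where "h = (\<lambda>z a. \<Sum>k\<in>{1..n}. su2_basis n z k * a k)"
  define h' where "h' = (\<lambda>z a. \<Sum>k\<in>{1..n}. su2_basis_deriv n z k * a k)"
  define G where "G = (\<lambda>z a. indicator (annulus R) z * indicator {z. bad_zero \<kappa> n a z} z :: ennreal)"
  have sf: "sigma_finite_measure ?P" by (rule cgauss_PiM.sigma_finite) simp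
  have h_meas[measurable]: "(\<lambda>(z, a). h z a) \<in> borel_measurable (borel \<Otimes>\<^sub>M ?P)"
    "(\<lambda>(z, a). h' z a) \<in> borel_measurable (borel \<Otimes>\<^sub>M ?P)" "h z \<in> borel_measurable ?P" for z
    unfolding h_def h'_def by measurable
  have upd: "(\<lambda>(a, x). a(0 := x)) \<in> measurable (?P \<Otimes>\<^sub>M cgauss) ?Q"
    using measurable_add_dim[of 0 "{1..n}" "\<lambda>_. cgauss"] by (simp add: atMost_eq_insert_0)
  have upd'[measurable]: "(\<lambda>x. (f x)(0 := g x)) \<in> measurable N ?Q"
    if "f \<in> measurable N ?P" "g \<in> measurable N borel" for f g and N :: "'z measure"
    using measurable_compose[OF measurable_Pair[OF that(1) that(2)[folded measurable_cong_sets[OF refl sets_cgauss]]] upd]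
    by simp
  have G[measurable]: "(\<lambda>(z, a). G z a) \<in> borel_measurable (borel \<Otimes>\<^sub>M ?Q)"
    unfolding G_def indicator_def by measurable
  have "(\<integral>\<^sup>+a. (\<Sum>i\<in>{1..n}. indicator (annulus R) (\<zeta> a i) * indicator {z. bad_zero \<kappa> n a z} (\<zeta> a i)) \<partial>?Q) =
      (\<integral>\<^sup>+z. \<integral>\<^sup>+a. ennreal (exp (- (cmod (h z a))\<^sup>2) / pi) * ennreal ((cmod (h' z a))\<^sup>2) * G z (a(0 := - h z a))
       \<partial>?P \<partial>lborel)"
    using kac_rice[OF n lab G] unfolding h_def h'_def by (simp only: G_def)
  also have "\<dots> \<le> (\<integral>\<^sup>+z. ennreal (exp 1 / (pi * \<kappa>\<^sup>2)) * indicator (annulus R) z \<partial>lborel)"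
  proof (intro nn_integral_mono)
    fix z :: complex
    define y where "y = (1 + (cmod z)\<^sup>2) ^ n"
    have y0: "y > 0" by (simp add: y_def one_plus_pos)
    let ?g = "\<lambda>a. ennreal (exp (- (cmod (h z a))\<^sup>2) / pi)"
    let ?E = "\<lambda>a \<theta>. ennreal ((cmod (su2_local n (a(0 := - h z a)) z (circlepath 0 (1 / sqrt n) \<theta>)))\<^sup>2)"
    have pd: "poly (pderiv (su2_poly n (a(0 := - h z a)))) z = h' z a" for a
      unfolding poly_pderiv_su2_poly h'_def atMost_eq_insert_0 by (auto intro!: sum.cong)
    have le: "ennreal ((cmod (h' z a))\<^sup>2) * G z (a(0 := - h z a)) \<le>
        ennreal (y / \<kappa>\<^sup>2) * circle_energy n (a(0 := - h z a)) z" for a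
    proof (cases "bad_zero \<kappa> n (a(0 := - h z a)) z")
      case True
      have "ennreal ((cmod (h' z a))\<^sup>2) * G z (a(0 := - h z a)) \<le> ennreal ((cmod (h' z a))\<^sup>2)"
        by (auto simp: G_def split: split_indicator)
      also have "\<dots> = ennreal (y / \<kappa>\<^sup>2) * ennreal (\<kappa>\<^sup>2 * (cmod (h' z a))\<^sup>2 / y)"
        using \<kappa> y0 by (simp add: ennreal_mult[symmetric])
      also have "\<dots> \<le> ennreal (y / \<kappa>\<^sup>2) * circle_energy n (a(0 := - h z a)) z"
        using True unfolding bad_zero_def pd y_def by (rule mult_left_mono) simp
      finally show ?thesis .
    qed (simp add: G_def)
    show "(\<integral>\<^sup>+a. ?g a * ennreal ((cmod (h' z a))\<^sup>2) * G z (a(0 := - h z a)) \<partial>?P) \<le>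
        ennreal (exp 1 / (pi * \<kappa>\<^sup>2)) * indicator (annulus R) z"
    proof (cases "z \<in> annulus R")
      case True
      have "(\<integral>\<^sup>+a. ?g a * ennreal ((cmod (h' z a))\<^sup>2) * G z (a(0 := - h z a)) \<partial>?P) \<le>
          (\<integral>\<^sup>+a. ennreal (y / \<kappa>\<^sup>2) * (\<integral>\<^sup>+\<theta>. ?g a * ?E a \<theta> * indicator {0..1} \<theta> \<partial>lborel) \<partial>?P)"
      proof (intro nn_integral_mono)
        fix a assume "a \<in> space ?P"
        hence [measurable]: "(\<lambda>_. a(0 := - h z a)) \<in> measurable N ?Q" for N :: "real measure"
          by (intro upd') auto
        have "?g a * ennreal ((cmod (h' z a))\<^sup>2) * G z (a(0 := - h z a)) \<le>
            ?g a * (ennreal (y / \<kappa>\<^sup>2) * circle_energy n (a(0 := - h z a)) z)"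
          unfolding mult.assoc by (intro mult_left_mono le) simp
        also have "\<dots> = ennreal (y / \<kappa>\<^sup>2) * (\<integral>\<^sup>+\<theta>. ?g a * ?E a \<theta> * indicator {0..1} \<theta> \<partial>lborel)"
          unfolding circle_energy_def
          by (simp add: mult.assoc nn_integral_cmult mult.left_commute)
        finally show "?g a * ennreal ((cmod (h' z a))\<^sup>2) * G z (a(0 := - h z a)) \<le>
            ennreal (y / \<kappa>\<^sup>2) * (\<integral>\<^sup>+\<theta>. ?g a * ?E a \<theta> * indicator {0..1} \<theta> \<partial>lborel)" .
      qed
      also have "\<dots> = ennreal (y / \<kappa>\<^sup>2) * (\<integral>\<^sup>+a. \<integral>\<^sup>+\<theta>. ?g a * ?E a \<theta> * indicator {0..1} \<theta> \<partial>lborel \<partial>?P)"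
        by (rule nn_integral_cmult) measurable
      also have "(\<integral>\<^sup>+a. \<integral>\<^sup>+\<theta>. ?g a * ?E a \<theta> * indicator {0..1} \<theta> \<partial>lborel \<partial>?P) =
          (\<integral>\<^sup>+\<theta>. \<integral>\<^sup>+a. ?g a * ?E a \<theta> * indicator {0..1} \<theta> \<partial>?P \<partial>lborel)"
      proof -
        interpret R: pair_sigma_finite "lborel :: real measure" ?P
          using sf by (intro pair_sigma_finite.intro sigma_finite_lborel)
        show ?thesis by (rule R.Fubini') measurable
      qed
      also have "\<dots> \<le> (\<integral>\<^sup>+\<theta>. ennreal (exp 1 / (pi * y)) * indicator {0..1::real} \<theta> \<partial>lborel)"
      proof (intro nn_integral_mono)
        fix \<theta> :: real
        \<comment> \<open>The radius is chosen for this: n |t|^2 = 1 on the circle, so the second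
          moment bound is the constant e.\<close>
        have "real n * (cmod (circlepath 0 (1 / sqrt n) \<theta>))\<^sup>2 = 1"
          using n by (simp add: circlepath norm_mult power_divide norm_divide)
        hence "(\<integral>\<^sup>+a. ?g a * ?E a \<theta> \<partial>?P) \<le> ennreal (exp 1 / (pi * y))"
          using conditional_energy_le[of n z "circlepath 0 (1 / sqrt n) \<theta>"]
          unfolding h_def y_def by simp
        thus "(\<integral>\<^sup>+a. ?g a * ?E a \<theta> * indicator {0..1} \<theta> \<partial>?P) \<le> ennreal (exp 1 / (pi * y)) * indicator {0..1} \<theta>"
          by (auto split: split_indicator)
      qed
      also have "\<dots> = ennreal (exp 1 / (pi * y))"
        by (subst nn_integral_cmult_indicator) auto
      \<comment> \<open>The normalisation \<open>y\<close> of f cancels against the density of p(z)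
        at 0, which leaves a bound free of \<open>n\<close> and z.\<close>
      also have "ennreal (y / \<kappa>\<^sup>2) * ennreal (exp 1 / (pi * y)) = ennreal (exp 1 / (pi * \<kappa>\<^sup>2))"
        using y0 \<kappa> by (simp add: ennreal_mult[symmetric] field_simps)
      finally show ?thesis using True by (simp add: mult_left_mono fun_upd_def)
    qed (simp add: G_def)
  qed
  also have "\<dots> = ennreal (measure lborel (annulus R) * exp 1 / (pi * \<kappa>\<^sup>2))"
    by (subst nn_integral_cmult_indicator) (simp_all add: emeasure_annulus ennreal_mult[symmetric] mult.commute)
  finally show ?thesis .
qed

section \<open>The critical point near a zero\<close>

text \<open>Half the Euclidean distance of the two points on the unit sphere, that is, the sine of
  half the angle between them.\<close>

definition half_chord :: "complex \<Rightarrow> complex \<Rightarrow> real" where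
  "half_chord z w = cmod (w - z) / sqrt ((1 + (cmod z)\<^sup>2) * (1 + (cmod w)\<^sup>2))"

text \<open>Unit vectors at chord 2 s have inner product 1 - 2 s^2, the cosine of twice the arcsine
  of s. Unlike the arccosine at 1, the arcsine is smooth at 0, where short distances are
  compared.\<close>

lemma fs_dist_eq_arcsin:
  shows "fs_dist z w = 2 * arcsin (half_chord z w)" and "0 \<le> half_chord z w" and "half_chord z w \<le> 1"
proof -
  have pos: "0 < (1 + (cmod z)\<^sup>2) * (1 + (cmod w)\<^sup>2)" by (simp add: one_plus_pos)
  have nz: "1 + (cmod z)\<^sup>2 \<noteq> 0" "1 + (cmod w)\<^sup>2 \<noteq> 0"
    using one_plus_pos[of z] one_plus_pos[of w] by linarith+
  have sq: "(half_chord z w)\<^sup>2 = (cmod (w - z))\<^sup>2 / ((1 + (cmod z)\<^sup>2) * (1 + (cmod w)\<^sup>2))"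
    unfolding half_chord_def power_divide using pos by simp
  have "inv_stereographic z \<bullet> inv_stereographic w =
     (4 * (z \<bullet> w) + ((cmod z)\<^sup>2 - 1) * ((cmod w)\<^sup>2 - 1)) / ((1 + (cmod z)\<^sup>2) * (1 + (cmod w)\<^sup>2))"
    unfolding inv_stereographic_def inner_Pair by (simp add: add_divide_distrib)
  also have "4 * (z \<bullet> w) + ((cmod z)\<^sup>2 - 1) * ((cmod w)\<^sup>2 - 1) =
     (1 + (cmod z)\<^sup>2) * (1 + (cmod w)\<^sup>2) - 2 * (cmod (w - z))\<^sup>2"
    unfolding power2_norm_eq_inner by (simp add: inner_diff_left inner_diff_right inner_commute algebra_simps)
  also have "\<dots> / ((1 + (cmod z)\<^sup>2) * (1 + (cmod w)\<^sup>2)) = 1 - 2 * (half_chord z w)\<^sup>2"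
    unfolding sq using nz by (simp add: diff_divide_distrib)
  finally have inner: "inv_stereographic z \<bullet> inv_stereographic w = 1 - 2 * (half_chord z w)\<^sup>2" .
  show 0: "0 \<le> half_chord z w" unfolding half_chord_def by simp
  have "\<bar>inv_stereographic z \<bullet> inv_stereographic w\<bar> \<le> 1"
    using Cauchy_Schwarz_ineq2[of "inv_stereographic z" "inv_stereographic w"]
    by (simp add: norm_eq_sqrt_inner norm_inv_stereographic)
  hence "(half_chord z w)\<^sup>2 \<le> 1\<^sup>2" unfolding inner by simp
  thus 1: "half_chord z w \<le> 1" by (rule power2_le_imp_le) simp
  have "cos (2 * arcsin (half_chord z w)) = 1 - 2 * (half_chord z w)\<^sup>2"
    using 0 1 by (simp add: cos_double_sin)
  moreover have "0 \<le> arcsin (half_chord z w)" "arcsin (half_chord z w) \<le> pi / 2"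
    using 0 1 arcsin_le_arcsin[of 0 "half_chord z w"] arcsin_bounded[of "half_chord z w"] by auto
  ultimately show "fs_dist z w = 2 * arcsin (half_chord z w)"
    unfolding fs_dist_eq_spherical inner by (metis arccos_cos mult_nonneg_nonneg mult_2 field_sum_of_halves add_mono zero_le_numeral)
qed

lemma norm_V_FS: "cmod (V_FS z) = cmod z / (1 + (cmod z)\<^sup>2)"
  unfolding V_FS_def norm_divide norm_of_real using one_plus_pos[of z] by simp

text \<open>Since 1 / |V| = |z| + 1/|z|, staying away from 0 and from infinity bounds it by 2
  R.\<close>

lemma V_FS_annulus:
  assumes R: "R > 1" and z: "z \<in> annulus R"
  shows "V_FS z \<noteq> 0" "cmod (V_FS z) \<le> 1" "1 / cmod (V_FS z) \<le> 2 * R"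
    "1 / cmod (V_FS z) = (1 + (cmod z)\<^sup>2) / cmod z"
proof -
  have zb: "inverse R \<le> cmod z" "cmod z \<le> R" using z by (auto simp: annulus_def)
  have "0 < inverse R" using R by simp
  hence z0: "cmod z > 0" using zb by linarith
  show "V_FS z \<noteq> 0" using z0 one_plus_pos[of z] norm_V_FS[of z] by auto
  have "cmod z \<le> 1 + (cmod z)\<^sup>2"
    using sum_squares_ge_zero[of "cmod z - 1" "cmod z"] by (simp add: power2_eq_square algebra_simps)
  thus "cmod (V_FS z) \<le> 1" unfolding norm_V_FS using one_plus_pos[of z] by (simp add: divide_le_eq)
  show eq: "1 / cmod (V_FS z) = (1 + (cmod z)\<^sup>2) / cmod z" unfolding norm_V_FS by simp
  have "(1 + (cmod z)\<^sup>2) / cmod z = inverse (cmod z) + cmod z"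
    using z0 by (simp add: field_simps power2_eq_square)
  also have "inverse (cmod z) \<le> inverse (inverse R)" using zb R by (intro le_imp_inverse_le) auto
  finally show "1 / cmod (V_FS z) \<le> 2 * R" unfolding eq using zb by simp
qed

section \<open>Complex-analytic estimates for the local function\<close>

text \<open>Cauchy's formula with t at distance at least r/2 from the circle: the kernel is at most
  8 / r^3, and (2! / (2 pi)) (2 pi r) (8 / r^3) = 16 / r^2.\<close>

lemma norm_higher_deriv_2_le_circle_mean:
  assumes f: "f holomorphic_on UNIV" and r: "r > 0" and t: "cmod t \<le> r / 2"
  shows "cmod ((deriv ^^ 2) f t) \<le> 16 / r\<^sup>2 * integral {0..1} (\<lambda>x. cmod (f (circlepath 0 r x)))"
proof -
  have cf: "continuous_on A f" for A
    using f holomorphic_on_imp_continuous_on continuous_on_subset by blast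
  have cp: "continuous_on {0..1} (circlepath 0 r)"
    unfolding circlepath by (intro continuous_intros)
  have cfp: "continuous_on {0..1} (\<lambda>x. f (circlepath 0 r x))"
    by (rule continuous_on_compose2[OF cf[of UNIV] cp]) auto
  have norm_cp: "cmod (circlepath 0 r x) = r" for x
    using r by (simp add: circlepath norm_mult)
  have dist_cp: "cmod (circlepath 0 r x - t) \<ge> r / 2" for x
    using norm_triangle_ineq2[of "circlepath 0 r x" t] t unfolding norm_cp by linarith
  have vd: "vector_derivative (circlepath 0 r) (at x) = 2 * pi * \<i> * r * exp (2 * of_real pi * \<i> * x)" for x
    using vector_derivative_at[OF has_vector_derivative_circlepath[of 0 r x UNIV]] by simp
  have "(deriv ^^ 2) f t = fact 2 / (2 * pi * \<i>) * contour_integral (circlepath 0 r) (\<lambda>u. f u / (u - t) ^ Suc 2)"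
    using r t f by (intro Cauchy_higher_derivative_integral_circlepath(2) cf) (auto intro: holomorphic_on_subset)
  also have "contour_integral (circlepath 0 r) (\<lambda>u. f u / (u - t) ^ Suc 2) =
      integral {0..1} (\<lambda>x. f (circlepath 0 r x) / (circlepath 0 r x - t) ^ Suc 2 * vector_derivative (circlepath 0 r) (at x))"
    by (rule contour_integral_integral)
  also have "cmod (fact 2 / (2 * pi * \<i>) * \<dots>) \<le>
      1 / pi * integral {0..1} (\<lambda>x. cmod (f (circlepath 0 r x)) * (16 * pi / r\<^sup>2))"
  proof -
    let ?F = "\<lambda>x. f (circlepath 0 r x) / (circlepath 0 r x - t) ^ Suc 2 * vector_derivative (circlepath 0 r) (at x)"
    have "cmod (integral {0..1} ?F) \<le> integral {0..1} (\<lambda>x. cmod (f (circlepath 0 r x)) * (16 * pi / r\<^sup>2))"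
    proof (rule integral_norm_bound_integral)
      have "circlepath 0 r x - t \<noteq> 0" for x using dist_cp[of x] r by auto
      thus "?F integrable_on {0..1}"
        unfolding vd by (intro integrable_continuous_real continuous_intros cfp cp) auto
      show "(\<lambda>x. cmod (f (circlepath 0 r x)) * (16 * pi / r\<^sup>2)) integrable_on {0..1}"
        by (intro integrable_continuous_real continuous_intros cfp)
      fix x :: real
      have "cmod (?F x) = cmod (f (circlepath 0 r x)) * (2 * pi * r / cmod (circlepath 0 r x - t) ^ 3)"
        using r unfolding vd by (simp add: norm_mult norm_divide norm_power eval_nat_numeral)
      also have "\<dots> \<le> cmod (f (circlepath 0 r x)) * (2 * pi * r / (r / 2) ^ 3)"
        using r dist_cp[of x] by (intro mult_left_mono divide_left_mono power_mono mult_pos_pos zero_less_power) auto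
      also have "2 * pi * r / (r / 2) ^ 3 = 16 * pi / r\<^sup>2"
        using r by (simp add: field_simps eval_nat_numeral)
      finally show "cmod (?F x) \<le> cmod (f (circlepath 0 r x)) * (16 * pi / r\<^sup>2)" .
    qed
    moreover have "cmod (fact 2 / (2 * pi * \<i>)) = 1 / pi" by (simp add: norm_divide norm_mult)
    ultimately show ?thesis unfolding norm_mult by (intro mult_mono) auto
  qed
  also have "\<dots> = 16 / r\<^sup>2 * integral {0..1} (\<lambda>x. cmod (f (circlepath 0 r x)))"
    by simp
  finally show ?thesis .
qed

text \<open>The mean value inequality is applied to f', and then to f(t) - f'(0) t with the bound
  just obtained for its derivative.\<close>

lemma entire_linearization_bound:
  assumes f: "f holomorphic_on UNIV" and f0: "f 0 = 0" and t: "cmod t \<le> r"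
    and B: "\<And>s. cmod s \<le> r \<Longrightarrow> cmod ((deriv ^^ 2) f s) \<le> B"
  shows "cmod (deriv f t - deriv f 0) \<le> B * cmod t"
    and "cmod (f t - deriv f 0 * t) \<le> B * (cmod t)\<^sup>2"
proof -
  have d1: "(f has_field_derivative deriv f s) (at s within A)" for s A
    using f by (meson UNIV_I has_field_derivative_at_within holomorphic_derivI open_UNIV)
  have d2: "(deriv f has_field_derivative (deriv ^^ 2) f s) (at s within A)" for s A
    using holomorphic_deriv[OF f open_UNIV]
    by (auto simp: numeral_2_eq_2 intro: has_field_derivative_at_within holomorphic_derivI)
  have df: "cmod (deriv f s - deriv f 0) \<le> B * cmod t" if "cmod s \<le> cmod t" for s
  proof -
    have "cmod (deriv f s - deriv f 0) \<le> B * cmod (s - 0)"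
      using that t
      by (intro field_differentiable_bound[of "cball 0 (cmod t)" "deriv f" "(deriv ^^ 2) f"] d2 B) auto
    also have "\<dots> \<le> B * cmod t"
    proof -
      have "0 \<le> B" using B[of t] t norm_ge_zero order_trans by blast
      thus ?thesis using that by (intro mult_left_mono) auto
    qed
    finally show ?thesis .
  qed
  show "cmod (deriv f t - deriv f 0) \<le> B * cmod t" by (rule df) simp
  have "cmod ((f t - deriv f 0 * t) - (f 0 - deriv f 0 * 0)) \<le> (B * cmod t) * cmod (t - 0)"
    by (intro field_differentiable_bound[of "cball 0 (cmod t)" "\<lambda>t. f t - deriv f 0 * t" "\<lambda>s. deriv f s - deriv f 0"])
       (auto intro!: derivative_eq_intros d1 df)
  thus "cmod (f t - deriv f 0 * t) \<le> B * (cmod t)\<^sup>2" using f0 by (simp add: power2_eq_square mult.assoc)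
qed

lemma one_plus_nz: "1 + (cmod z)\<^sup>2 \<noteq> 0"
  using one_plus_pos[of z] by linarith

lemma su2_local_deriv:
  "(su2_local n a z has_field_derivative
    (poly (pderiv (su2_poly n a)) (z + t) - of_nat n * V_FS z * poly (su2_poly n a) (z + t)) *
       exp (- (of_nat n * V_FS z * t)) / of_real (sqrt ((1 + (cmod z)\<^sup>2) ^ n))) (at t)"
proof -
  have "((\<lambda>t. poly q (z + t) * exp (- (c * t)) / y) has_field_derivative
      (poly (pderiv q) (z + t) - c * poly q (z + t)) * exp (- (c * t)) / y) (at t)" for q c y
    by (intro DERIV_cdivide) (auto intro!: derivative_eq_intros DERIV_chain2[OF poly_DERIV] simp: algebra_simps)
  thus ?thesis unfolding su2_local_def[abs_def] .
qed

lemma su2_local_holomorphic: "su2_local n a z holomorphic_on UNIV"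
  unfolding holomorphic_on_open[OF open_UNIV] by (blast intro: su2_local_deriv)

text \<open>Adding n V f undoes the derivative of the exponential factor and leaves p' times a
  nonvanishing function.\<close>

lemma critical_points_su2_local:
  "z + t \<in> critical_points (su2_poly n a) \<longleftrightarrow>
     deriv (su2_local n a z) t + of_nat n * V_FS z * su2_local n a z t = 0"
proof -
  define y where "y = complex_of_real (sqrt ((1 + (cmod z)\<^sup>2) ^ n))"
  have y: "y \<noteq> 0" using one_plus_nz[of z] by (simp add: y_def)
  have "deriv (su2_local n a z) t + of_nat n * V_FS z * su2_local n a z t =
      poly (pderiv (su2_poly n a)) (z + t) * exp (- (of_nat n * V_FS z * t)) / y"
    unfolding DERIV_imp_deriv[OF su2_local_deriv] su2_local_def y_def[symmetric]
    using y by (simp add: field_simps)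
  thus ?thesis using y by (simp add: critical_points_def)
qed

text \<open>Badness is quadratic, whereas Cauchy's estimate wants the mean of |f|. With c = \<kappa>
  |f'(0)| the pointwise inequality |f| \<le> (c + |f|^2 / c) / 2 connects them. The strict
  inequality at a good zero also yields f'(0) \<noteq> 0.\<close>

lemma circle_mean_le:
  assumes good: "\<not> bad_zero \<kappa> n a z" and root: "poly (su2_poly n a) z = 0" and n: "n \<ge> 1" and \<kappa>: "\<kappa> > 0"
  defines "f \<equiv> su2_local n a z"
  shows "deriv f 0 \<noteq> 0"
    and "integral {0..1} (\<lambda>x. cmod (f (circlepath 0 (1 / sqrt n) x))) \<le> \<kappa> * cmod (deriv f 0)"
proof -
  let ?p = "circlepath 0 (1 / sqrt n)"
  have d: "(cmod (deriv f 0))\<^sup>2 = (cmod (poly (pderiv (su2_poly n a)) z))\<^sup>2 / (1 + (cmod z)\<^sup>2) ^ n"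
    unfolding f_def DERIV_imp_deriv[OF su2_local_deriv]
    using root one_plus_pos[of z] by (simp add: norm_divide power_divide)
  have cfp: "continuous_on {0..1} (\<lambda>x. f (?p x))"
    using holomorphic_on_imp_continuous_on[OF su2_local_holomorphic, of n a z, folded f_def]
    by (rule continuous_on_compose2) (use n in \<open>auto simp: circlepath intro!: continuous_intros\<close>)
  define J where "J = integral {0..1} (\<lambda>x. (cmod (f (?p x)))\<^sup>2)"
  have J: "((\<lambda>x. (cmod (f (?p x)))\<^sup>2) has_integral J) {0..1}"
    unfolding J_def by (intro integrable_integral integrable_continuous_real continuous_intros cfp)
  have J0: "J \<ge> 0" using has_integral_nonneg[OF J] by simp
  have "circle_energy n a z = ennreal J"
    unfolding circle_energy_def f_def[symmetric]
    using nn_integral_has_integral_lebesgue'[OF _ J] by simp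
  hence "J < \<kappa>\<^sup>2 * (cmod (deriv f 0))\<^sup>2"
    using good J0 unfolding bad_zero_def d by (simp add: ennreal_le_iff2 not_le)
  hence J': "J < (\<kappa> * cmod (deriv f 0))\<^sup>2" by (simp add: power_mult_distrib)
  thus nz: "deriv f 0 \<noteq> 0" using J0 by auto
  define c where "c = \<kappa> * cmod (deriv f 0)"
  have c: "c > 0" using nz \<kappa> by (simp add: c_def)
  have "integral {0..1} (\<lambda>x. cmod (f (?p x))) \<le> (c + J / c) / 2"
  proof (rule has_integral_le)
    show "((\<lambda>x. cmod (f (?p x))) has_integral integral {0..1} (\<lambda>x. cmod (f (?p x)))) {0..1}"
      by (intro integrable_integral integrable_continuous_real continuous_intros cfp)
    have "((\<lambda>x::real. c) has_integral c) {0..1}" using has_integral_const_real[of c 0 1] by simp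
    from has_integral_divide[OF has_integral_add[OF this has_integral_divide[OF J, of c]], of 2]
    show "((\<lambda>x. (c + (cmod (f (?p x)))\<^sup>2 / c) / 2) has_integral (c + J / c) / 2) {0..1}" by simp
    fix x :: real
    have "0 \<le> (c - cmod (f (?p x)))\<^sup>2" by simp
    thus "cmod (f (?p x)) \<le> (c + (cmod (f (?p x)))\<^sup>2 / c) / 2"
      using c by (simp add: field_simps power2_eq_square)
  qed
  also have "J / c \<le> c" using J' c by (simp add: c_def[symmetric] divide_le_eq power2_eq_square)
  finally show "integral {0..1} (\<lambda>x. cmod (f (?p x))) \<le> \<kappa> * cmod (deriv f 0)"
    by (simp add: c_def)
qed

section \<open>The rescaled equation for critical points\<close>

text \<open>On the circle of radius 1 / sqrt n Cauchy gives |f''| \<le> 16 n \<kappa> |f'(0)|. At t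
  = s/n this costs 16 \<kappa> S in f' and 16 \<kappa> S^2 in n V f, relative to f'(0), so all
  powers of n cancel. The condition 4 S^2 \<le> n keeps s/n within half the radius.\<close>

lemma critical_point_linearization:
  assumes good: "\<not> bad_zero \<kappa> n a z" and root: "poly (su2_poly n a) z = 0"
    and n: "n \<ge> 1" "4 * S\<^sup>2 \<le> real n" and \<kappa>: "\<kappa> > 0" and V: "cmod (V_FS z) \<le> 1"
    and s: "cmod s \<le> S"
  defines "f \<equiv> su2_local n a z"
  shows "cmod ((deriv f (s / of_nat n) + of_nat n * V_FS z * f (s / of_nat n)) / deriv f 0 -
    (1 + V_FS z * s)) \<le> 16 * \<kappa> * (S + S\<^sup>2)"
proof -
  define d where "d = deriv f 0"
  define B where "B = 16 * real n * (\<kappa> * cmod d)"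
  note mean = circle_mean_le[OF good root n(1) \<kappa>, folded f_def, folded d_def]
  have d0: "cmod d > 0" using mean(1) by simp
  have S0: "S \<ge> 0" using s norm_ge_zero order_trans by blast
  have hol: "f holomorphic_on UNIV" unfolding f_def by (rule su2_local_holomorphic)
  have f0: "f 0 = 0" using root by (simp add: f_def su2_local_def)
  have n0: "real n > 0" using n by simp
  let ?r = "1 / sqrt (real n) / 2"
  have B: "cmod ((deriv ^^ 2) f t) \<le> B" if "cmod t \<le> ?r" for t
  proof -
    have "cmod ((deriv ^^ 2) f t) \<le> 16 / (1 / sqrt n)\<^sup>2 * integral {0..1} (\<lambda>x. cmod (f (circlepath 0 (1 / sqrt n) x)))"
      using that n0 by (intro norm_higher_deriv_2_le_circle_mean hol) auto
    also have "\<dots> \<le> 16 / (1 / sqrt n)\<^sup>2 * (\<kappa> * cmod d)"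
      using mean(2) by (intro mult_left_mono) auto
    finally show ?thesis using n0 by (simp add: B_def power_divide)
  qed
  have "2 * S \<le> sqrt (real n)" using n(2) S0 by (intro real_le_rsqrt) (simp add: power_mult_distrib)
  hence "2 * S * sqrt n \<le> sqrt n * sqrt n" by (intro mult_right_mono) auto
  hence Sn: "S / real n \<le> ?r" using n0 by (simp add: field_simps)
  define t where "t = s / of_nat n"
  have t: "cmod t \<le> S / real n" using s n0 by (simp add: t_def norm_divide divide_right_mono)
  note lin = entire_linearization_bound[OF hol f0 order_trans[OF t Sn] B, folded d_def]
  have s_eq: "s = of_nat n * t" using n0 by (simp add: t_def)
  have "(deriv f t + of_nat n * V_FS z * f t) - d * (1 + V_FS z * s) =
      (deriv f t - d) + of_nat n * V_FS z * (f t - d * t)"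
    by (simp add: s_eq algebra_simps)
  also have "cmod \<dots> \<le> cmod (deriv f t - d) + cmod (of_nat n * V_FS z * (f t - d * t))"
    by (rule norm_triangle_ineq)
  also have "\<dots> \<le> B * cmod t + real n * (B * (cmod t)\<^sup>2)"
  proof (intro add_mono lin(1))
    have "cmod (of_nat n * V_FS z * (f t - d * t)) = real n * (cmod (V_FS z) * cmod (f t - d * t))"
      by (simp add: norm_mult)
    also have "\<dots> \<le> real n * (1 * (B * (cmod t)\<^sup>2))"
      using V lin(2) by (intro mult_left_mono mult_mono) auto
    finally show "cmod (of_nat n * V_FS z * (f t - d * t)) \<le> real n * (B * (cmod t)\<^sup>2)" by simp
  qed
  also have "\<dots> \<le> B * (S / real n) + real n * (B * (S / real n)\<^sup>2)"
    using t \<kappa> d0 by (intro add_mono mult_left_mono power_mono) (auto simp: B_def)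
  also have "\<dots> = 16 * \<kappa> * (S + S\<^sup>2) * cmod d"
    using n0 by (simp add: B_def field_simps power2_eq_square)
  finally have le: "cmod ((deriv f t + of_nat n * V_FS z * f t) - d * (1 + V_FS z * s)) \<le>
      16 * \<kappa> * (S + S\<^sup>2) * cmod d" .
  have "(deriv f t + of_nat n * V_FS z * f t) / d - (1 + V_FS z * s) =
      ((deriv f t + of_nat n * V_FS z * f t) - d * (1 + V_FS z * s)) / d"
    using mean(1) by (simp add: field_simps)
  thus ?thesis using le d0 unfolding t_def[symmetric] d_def[symmetric]
    by (simp add: norm_divide divide_le_eq)
qed

text \<open>Let \<epsilon> be the linearization error and s0 = -1/V. On |s - s0| = r the linear
  function has modulus r |V| > 2 \<epsilon>, so \<open>\<psi>\<close> is larger there than at s0,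
  and the minimum principle gives a zero inside. Conversely, a zero with |s| \<le> S satisfies |V|
  |s - s0| \<le> \<epsilon>. The constant 32 is twice the 16 of the linearization.\<close>

lemma critical_point_near_zero:
  assumes good: "\<not> bad_zero \<kappa> n a z" and root: "poly (su2_poly n a) z = 0"
    and n: "n \<ge> 1" "4 * S\<^sup>2 \<le> real n" and \<kappa>: "\<kappa> > 0" and V: "V_FS z \<noteq> 0" "cmod (V_FS z) \<le> 1"
    and r: "r > 0" "32 * \<kappa> * (S + S\<^sup>2) < r * cmod (V_FS z)" and S: "1 / cmod (V_FS z) + r \<le> S"
  shows "\<exists>\<beta>\<in>critical_points (su2_poly n a). cmod (of_nat n * (\<beta> - z) + 1 / V_FS z) < r"
    and "\<And>\<beta>. \<beta> \<in> critical_points (su2_poly n a) \<Longrightarrow> cmod (of_nat n * (\<beta> - z)) \<le> S \<Longrightarrow>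
           cmod (of_nat n * (\<beta> - z) + 1 / V_FS z) < r"
proof -
  define f where "f = su2_local n a z"
  define \<psi> where "\<psi> = (\<lambda>s. (deriv f (s / of_nat n) + of_nat n * V_FS z * f (s / of_nat n)) / deriv f 0)"
  define \<epsilon> where "\<epsilon> = 16 * \<kappa> * (S + S\<^sup>2)"
  have lin: "cmod (\<psi> s - (1 + V_FS z * s)) \<le> \<epsilon>" if "cmod s \<le> S" for s
    unfolding \<psi>_def f_def \<epsilon>_def using that by (intro critical_point_linearization good root n \<kappa> V)
  have d0: "deriv f 0 \<noteq> 0" unfolding f_def by (rule circle_mean_le(1)[OF good root n(1) \<kappa>])
  have \<epsilon>: "2 * \<epsilon> < r * cmod (V_FS z)" using r(2) by (simp add: \<epsilon>_def)
  have crit: "z + s / of_nat n \<in> critical_points (su2_poly n a) \<longleftrightarrow> \<psi> s = 0" for s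
    unfolding critical_points_su2_local \<psi>_def f_def[symmetric] using d0 by simp
  have f_hol: "f holomorphic_on UNIV" unfolding f_def by (rule su2_local_holomorphic)
  have df_hol: "deriv f holomorphic_on UNIV" by (rule holomorphic_deriv[OF f_hol open_UNIV])
  have \<psi>_hol: "\<psi> holomorphic_on UNIV"
    unfolding \<psi>_def using d0 n
    by (intro holomorphic_intros holomorphic_on_compose_gen[OF _ df_hol, unfolded o_def]
        holomorphic_on_compose_gen[OF _ f_hol, unfolded o_def]) auto
  define s0 where "s0 = - 1 / V_FS z"
  have s0: "1 + V_FS z * s0 = 0" "cmod s0 = 1 / cmod (V_FS z)"
    using V by (simp_all add: s0_def norm_divide)
  have lin0: "1 + V_FS z * s = V_FS z * (s - s0)" for s using s0(1) by (simp add: algebra_simps)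
  have le_S: "cmod s \<le> S" if "cmod (s0 - s) \<le> r" for s
    using norm_triangle_ineq2[of s s0] that S s0(2) by (simp add: norm_minus_commute)
  obtain s where s: "s \<in> ball s0 r" "\<psi> s = 0"
  proof (rule holomorphic_contract_to_zero[of s0 r \<psi>])
    show "continuous_on (cball s0 r) \<psi>"
      using \<psi>_hol holomorphic_on_imp_continuous_on continuous_on_subset by blast
    show "\<psi> holomorphic_on ball s0 r" using \<psi>_hol by (rule holomorphic_on_subset) simp
    fix s assume s: "cmod (s0 - s) = r"
    have "cmod (V_FS z * (s - s0)) = r * cmod (V_FS z)"
      using s by (simp add: norm_mult norm_minus_commute)
    moreover have "cmod (\<psi> s - V_FS z * (s - s0)) \<le> \<epsilon>" using lin[OF le_S[of s]] s lin0 by simp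
    moreover have "cmod (\<psi> s0) \<le> \<epsilon>" using lin[OF le_S[of s0]] s0(1) r(1) by simp
    moreover have "cmod (V_FS z * (s - s0)) \<le> cmod (\<psi> s) + cmod (\<psi> s - V_FS z * (s - s0))"
      using norm_triangle_ineq4[of "\<psi> s" "\<psi> s - V_FS z * (s - s0)"] by simp
    ultimately show "cmod (\<psi> s0) < cmod (\<psi> s)" using \<epsilon> by linarith
  qed (use r in auto)
  show "\<exists>\<beta>\<in>critical_points (su2_poly n a). cmod (of_nat n * (\<beta> - z) + 1 / V_FS z) < r"
  proof (rule bexI)
    show "z + s / of_nat n \<in> critical_points (su2_poly n a)" using s(2) crit by simp
    show "cmod (of_nat n * (z + s / of_nat n - z) + 1 / V_FS z) < r"
      using s(1) n by (simp add: s0_def dist_norm norm_minus_commute)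
  qed
  fix \<beta> assume \<beta>: "\<beta> \<in> critical_points (su2_poly n a)" "cmod (of_nat n * (\<beta> - z)) \<le> S"
  define s' where "s' = of_nat n * (\<beta> - z)"
  have "\<psi> s' = 0" using \<beta>(1) crit[of s'] n by (simp add: s'_def)
  hence "cmod (V_FS z * (s' - s0)) \<le> \<epsilon>"
    using lin[of s'] \<beta>(2) unfolding lin0 by (simp add: s'_def norm_minus_cancel)
  moreover from this have "\<epsilon> \<ge> 0" using norm_ge_zero order_trans by blast
  ultimately have "cmod (V_FS z) * cmod (s' - s0) < cmod (V_FS z) * r"
    using \<epsilon> by (simp add: norm_mult mult.commute[of r])
  hence "cmod (s' - s0) < r" by (rule mult_left_less_imp_less) simp
  thus "cmod (of_nat n * (\<beta> - z) + 1 / V_FS z) < r" by (simp add: s'_def s0_def)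
qed

section \<open>Locating every nearest critical point\<close>

text \<open>Comparing half chords leaves a factor 1 + R + |\<beta> - z| that involves the unknown
  itself. The smallness assumption gives its |\<beta> - z| part a coefficient at most 1/2, so it is
  absorbed on the left.\<close>

lemma norm_le_of_fs_dist_le:
  assumes le: "fs_dist z \<beta> \<le> fs_dist z w" and z: "cmod z \<le> R"
    and small: "2 * (1 + R) * cmod (w - z) \<le> 1"
  shows "cmod (\<beta> - z) \<le> 2 * (1 + R)\<^sup>2 * cmod (w - z)"
proof -
  have R0: "R \<ge> 0" using z norm_ge_zero order_trans by blast
  have sqrt_le: "sqrt (1 + (cmod x)\<^sup>2) \<le> 1 + cmod x" for x
    by (rule real_le_lsqrt) (auto simp: power2_eq_square algebra_simps)
  have sqrt_ge: "1 \<le> sqrt (1 + (cmod x)\<^sup>2)" for x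
    by (rule real_le_rsqrt) simp
  have "arcsin (half_chord z \<beta>) \<le> arcsin (half_chord z w)"
    using le unfolding fs_dist_eq_arcsin by simp
  hence "half_chord z \<beta> \<le> half_chord z w"
    using fs_dist_eq_arcsin(2,3)[of z \<beta>] fs_dist_eq_arcsin(2,3)[of z w]
    by (subst (asm) arcsin_le_mono) auto
  also have "\<dots> \<le> cmod (w - z) / 1"
    unfolding half_chord_def real_sqrt_mult
    using mult_mono[OF sqrt_ge[of z] sqrt_ge[of w]] sqrt_ge[of z]
    by (intro divide_left_mono) auto
  finally have hc: "half_chord z \<beta> \<le> cmod (w - z)" by simp
  have "cmod (\<beta> - z) = half_chord z \<beta> * (sqrt (1 + (cmod z)\<^sup>2) * sqrt (1 + (cmod \<beta>)\<^sup>2))"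
    unfolding half_chord_def real_sqrt_mult using one_plus_nz[of z] one_plus_nz[of \<beta>] by simp
  also have "\<dots> \<le> cmod (w - z) * ((1 + R) * (1 + (R + cmod (\<beta> - z))))"
  proof (intro mult_mono hc)
    show "sqrt (1 + (cmod z)\<^sup>2) \<le> 1 + R" using sqrt_le[of z] z by linarith
    show "sqrt (1 + (cmod \<beta>)\<^sup>2) \<le> 1 + (R + cmod (\<beta> - z))"
      using sqrt_le[of \<beta>] z norm_triangle_sub[of \<beta> z] by linarith
  qed (use R0 in auto)
  also have "\<dots> = (1 + R)\<^sup>2 * cmod (w - z) + ((1 + R) * cmod (w - z)) * cmod (\<beta> - z)"
    by (simp add: power2_eq_square algebra_simps)
  also have "\<dots> \<le> (1 + R)\<^sup>2 * cmod (w - z) + 1/2 * cmod (\<beta> - z)"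
    using small by (intro add_left_mono mult_right_mono) (simp_all add: algebra_simps)
  finally show ?thesis by simp
qed

text \<open>A critical point w near z - 1/(n V) exists, a nearest one cannot be much farther from z
  than w, and within that range the critical equation forces it close to z - 1/(n V). Both
  \<open>\<kappa>\<close> and \<open>N\<close> are uniform in the coefficients and in z.\<close>

lemma nearest_critical_point_of_good_zero:
  assumes R: "R > 1" and r: "0 < r" "r \<le> 1"
  shows "\<exists>\<kappa>>0. \<exists>N. \<forall>n\<ge>N. \<forall>a. \<forall>z\<in>annulus R. poly (su2_poly n a) z = 0 \<longrightarrow> \<not> bad_zero \<kappa> n a z \<longrightarrow>
    critical_points (su2_poly n a) \<noteq> {} \<and>
    (\<forall>\<beta>\<in>critical_points (su2_poly n a). (\<forall>b\<in>critical_points (su2_poly n a). fs_dist z \<beta> \<le> fs_dist z b) \<longrightarrow>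
       cmod (of_nat n * (\<beta> - z) + 1 / V_FS z) < r)"
proof -
  \<comment> \<open>The critical point w found first has n |w - z| \<le> 2 R + 1; passing to a
    nearest one costs the factor 2 (1 + R)^2.\<close>
  define S where "S = 2 * (1 + R)\<^sup>2 * (2 * R + 1)"
  \<comment> \<open>Chosen so that 32 \<kappa> (S + S^2) = r / (4 R), half of the lower bound r / (2
    R) for r |V|.\<close>
  define \<kappa> where "\<kappa> = r / (128 * R * (S + S\<^sup>2))"
  have "1 \<le> (1 + R)\<^sup>2" using R by (intro one_le_power) auto
  also have "\<dots> \<le> 2 * (1 + R)\<^sup>2" by simp
  finally have "1 * (2 * R + 1) \<le> 2 * (1 + R)\<^sup>2 * (2 * R + 1)" using R by (intro mult_right_mono) auto
  hence S: "2 * R + 1 \<le> S" by (simp add: S_def)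
  hence S0: "S > 0" using R by linarith
  hence SS: "S + S\<^sup>2 > 0" by (simp add: add_pos_pos)
  have \<kappa>: "\<kappa> > 0" unfolding \<kappa>_def using R r SS by simp
  \<comment> \<open>The three thresholds: \<open>n\<close> positive, rescaled radius S inside the
    Cauchy circle, and |w - z| small enough to compare affine distances.\<close>
  define N where "N = nat \<lceil>max 1 (max (4 * S\<^sup>2) (2 * (1 + R) * (2 * R + 1)))\<rceil>"
  show ?thesis
  proof (intro exI[of _ \<kappa>] conjI \<kappa> exI[of _ N] allI impI ballI)
    fix n a z assume n: "N \<le> n" and z: "z \<in> annulus R" and root: "poly (su2_poly n a) z = 0"
      and good: "\<not> bad_zero \<kappa> n a z"
    have "max 1 (max (4 * S\<^sup>2) (2 * (1 + R) * (2 * R + 1))) \<le> real n"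
      using n unfolding N_def by (simp only: nat_le_iff ceiling_le_iff of_int_of_nat_eq)
    hence n1: "n \<ge> 1" and nS: "4 * S\<^sup>2 \<le> real n" and nR: "2 * (1 + R) * (2 * R + 1) \<le> real n" by auto
    note V = V_FS_annulus[OF R z]
    have rV: "32 * \<kappa> * (S + S\<^sup>2) < r * cmod (V_FS z)"
    proof -
      have "1 \<le> 2 * R * cmod (V_FS z)" using V(1,3) by (simp add: divide_le_eq)
      hence "1 / (2 * R) \<le> cmod (V_FS z)" using R by (simp add: divide_le_eq mult.commute)
      hence "r * (1 / (2 * R)) \<le> r * cmod (V_FS z)" using r by (intro mult_left_mono) auto
      moreover have "32 * (r / (128 * R * T)) * T = r / (4 * R)" if "T > 0" for T
        using that R by (simp add: field_simps)
      hence "32 * \<kappa> * (S + S\<^sup>2) = r / (4 * R)" unfolding \<kappa>_def using SS by blast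
      moreover have "r / (4 * R) < r * (1 / (2 * R))" using R r by (simp add: field_simps)
      ultimately show ?thesis by (simp only:)
    qed
    have VS: "1 / cmod (V_FS z) + r \<le> S" using V(3) r S by linarith
    note near = critical_point_near_zero[OF good root n1 nS \<kappa> V(1,2) r(1) rV VS]
    then obtain w where w: "w \<in> critical_points (su2_poly n a)" "cmod (of_nat n * (w - z) + 1 / V_FS z) < r"
      by blast
    thus "critical_points (su2_poly n a) \<noteq> {}" by auto
    have nw: "real n * cmod (w - z) \<le> 2 * R + 1"
    proof -
      have "real n * cmod (w - z) = cmod ((of_nat n * (w - z) + 1 / V_FS z) - 1 / V_FS z)"
        by (simp add: norm_mult)
      also have "\<dots> \<le> cmod (of_nat n * (w - z) + 1 / V_FS z) + 1 / cmod (V_FS z)"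
        using norm_triangle_ineq4 by (metis norm_divide norm_one)
      finally show ?thesis using w(2) V(3) r by linarith
    qed
    fix \<beta> assume \<beta>: "\<beta> \<in> critical_points (su2_poly n a)"
      "\<forall>b\<in>critical_points (su2_poly n a). fs_dist z \<beta> \<le> fs_dist z b"
    have n0: "real n > 0" using n1 by simp
    have "cmod (\<beta> - z) \<le> 2 * (1 + R)\<^sup>2 * cmod (w - z)"
    proof (rule norm_le_of_fs_dist_le)
      show "fs_dist z \<beta> \<le> fs_dist z w" using \<beta>(2) w(1) by blast
      show "cmod z \<le> R" using z by (simp add: annulus_def)
      have "2 * (1 + R) * (real n * cmod (w - z)) \<le> 2 * (1 + R) * (2 * R + 1)"
        using R by (intro mult_left_mono nw) auto
      also note nR
      finally have "real n * (2 * (1 + R) * cmod (w - z)) \<le> real n * 1" by (simp add: mult_ac)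
      thus "2 * (1 + R) * cmod (w - z) \<le> 1" using n0 by (simp only: mult_le_cancel_left_pos)
    qed
    hence "real n * cmod (\<beta> - z) \<le> real n * (2 * (1 + R)\<^sup>2 * cmod (w - z))" by (rule mult_left_mono) simp
    also have "\<dots> \<le> S" unfolding S_def using mult_left_mono[OF nw, of "2 * (1 + R)\<^sup>2"] by (simp add: mult_ac)
    finally show "cmod (of_nat n * (\<beta> - z) + 1 / V_FS z) < r"
      using near(2)[OF \<beta>(1)] by (simp add: norm_mult)
  qed
qed

section \<open>From the affine displacement to the spherical distance\<close>

text \<open>The square root is the modulus of 1 + i x, so this is the reverse triangle
  inequality.\<close>

lemma abs_sqrt_one_plus_diff_le: "\<bar>sqrt (1 + x\<^sup>2) - sqrt (1 + y\<^sup>2)\<bar> \<le> \<bar>x - y\<bar>"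
proof -
  have "Complex 1 x - Complex 1 y = Complex 0 (x - y)" by (simp add: complex_eq_iff)
  thus ?thesis using norm_triangle_ineq3[of "Complex 1 x" "Complex 1 y"] by (simp add: complex_norm)
qed

text \<open>With x = n |\<beta> - z|, three replacements: arcsine by its argument, the conformal
  factor at \<beta> by the one at z, and x by 1 / |V| = (1 + |z|^2) / |z|. The errors \<eta>/4,
  \<eta>/8 and \<eta>/8 add up to \<eta>/2, and the distance is twice the arcsine.\<close>

lemma fs_dist_asymptotics:
  assumes R: "R > 1" and \<eta>: "\<eta> > 0"
  shows "\<exists>r N. 0 < r \<and> r \<le> 1 \<and> (\<forall>n\<ge>N. \<forall>z\<in>annulus R. \<forall>\<beta>. cmod (of_nat n * (\<beta> - z) + 1 / V_FS z) < r \<longrightarrow>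
    \<bar>real n * fs_dist z \<beta> - 2 / cmod z\<bar> \<le> \<eta>)"
proof -
  define e where "e = \<eta> / (4 * (2 * R + 1))"
  have e: "e > 0" using \<eta> R by (simp add: e_def)
  have "(arcsin has_derivative (\<lambda>x. x)) (at 0)"
  proof -
    have "(*) (1::real) = (\<lambda>x. x)" by auto
    thus ?thesis using DERIV_arcsin[of 0] by (simp add: has_field_derivative_def)
  qed
  then obtain d where d: "d > 0" "\<And>x. \<bar>x\<bar> < d \<Longrightarrow> \<bar>arcsin x - x\<bar> \<le> e * \<bar>x\<bar>"
    using e unfolding has_derivative_at_alt by (auto simp: real_norm_def)
  define r where "r = min 1 (\<eta> / 8)"
  have r: "0 < r" "r \<le> 1" "r \<le> \<eta> / 8" using \<eta> by (auto simp: r_def)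
  \<comment> \<open>The second threshold keeps the half chord below \<open>d\<close>, where the
    arcsine is nearly linear; the third makes (2 R + 1)^2 / n at most \<eta>/8.\<close>
  define N where "N = nat \<lceil>max 1 (max (2 * (2 * R + 1) / d) (8 * (2 * R + 1)\<^sup>2 / \<eta>))\<rceil>"
  show ?thesis
  proof (intro exI[of _ r] exI[of _ N] conjI r allI impI ballI)
    fix n z \<beta> assume n: "N \<le> n" and z: "z \<in> annulus R" and \<beta>: "cmod (of_nat n * (\<beta> - z) + 1 / V_FS z) < r"
    have nm: "max 1 (max (2 * (2 * R + 1) / d) (8 * (2 * R + 1)\<^sup>2 / \<eta>)) \<le> real n"
      using n unfolding N_def by (simp only: nat_le_iff ceiling_le_iff of_int_of_nat_eq)
    hence n0: "real n > 0" and nd: "2 * (2 * R + 1) / d \<le> real n" and n\<eta>: "8 * (2 * R + 1)\<^sup>2 / \<eta> \<le> real n" by auto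
    note V = V_FS_annulus[OF R z]
    define x where "x = real n * cmod (\<beta> - z)"
    have "\<bar>cmod (of_nat n * (\<beta> - z)) - cmod (- (1 / V_FS z))\<bar> \<le> cmod (of_nat n * (\<beta> - z) - - (1 / V_FS z))"
      by (rule norm_triangle_ineq3)
    hence xV: "\<bar>x - 1 / cmod (V_FS z)\<bar> \<le> r"
      using \<beta> by (simp add: x_def norm_mult norm_divide)
    have x0: "0 \<le> x" and xR: "x \<le> 2 * R + 1" using xV V(3) r by (auto simp: x_def)
    define y1 where "y1 = sqrt (1 + (cmod z)\<^sup>2)"
    define y2 where "y2 = sqrt (1 + (cmod \<beta>)\<^sup>2)"
    have y: "1 \<le> y1" "1 \<le> y2" unfolding y1_def y2_def by simp_all
    have y1sq: "y1\<^sup>2 = 1 + (cmod z)\<^sup>2" unfolding y1_def by simp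
    have hc: "real n * half_chord z \<beta> = x / (y1 * y2)"
      by (simp add: half_chord_def real_sqrt_mult y1_def y2_def x_def)
    have yy: "1 \<le> y1 * y2" using mult_mono[OF y] y by simp
    have "x / (y1 * y2) \<le> x / 1" using yy x0 by (intro divide_left_mono) auto
    hence hx: "real n * half_chord z \<beta> \<le> 2 * R + 1" using hc xR by simp
    have hc0: "0 \<le> half_chord z \<beta>" by (rule fs_dist_eq_arcsin(2))
    have "2 * R + 1 < real n * d"
    proof -
      have "2 * R + 1 < 2 * (2 * R + 1)" using R by simp
      also have "2 * (2 * R + 1) \<le> real n * d" using nd d(1) by (simp add: divide_le_eq)
      finally show ?thesis .
    qed
    hence "real n * half_chord z \<beta> < real n * d" using hx by linarith
    hence "half_chord z \<beta> < d" using n0 by simp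
    hence "\<bar>arcsin (half_chord z \<beta>) - half_chord z \<beta>\<bar> \<le> e * half_chord z \<beta>"
      using d(2)[of "half_chord z \<beta>"] hc0 by simp
    hence "real n * \<bar>arcsin (half_chord z \<beta>) - half_chord z \<beta>\<bar> \<le> real n * (e * half_chord z \<beta>)"
      by (rule mult_left_mono) simp
    also have "\<dots> \<le> e * (2 * R + 1)" using mult_left_mono[OF hx, of e] e by (simp add: mult_ac)
    also have "\<dots> = \<eta> / 4" using R by (simp add: e_def field_simps)
    finally have 1: "\<bar>real n * arcsin (half_chord z \<beta>) - real n * half_chord z \<beta>\<bar> \<le> \<eta> / 4"
      using n0 by (simp add: abs_mult right_diff_distrib[symmetric])
    have 2: "\<bar>x / (y1 * y2) - x / y1\<^sup>2\<bar> \<le> \<eta> / 8"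
    proof -
      have "x / (y1 * y2) - x / y1\<^sup>2 = x * (y1 - y2) / (y1\<^sup>2 * y2)"
        using y by (simp add: field_simps power2_eq_square)
      hence "\<bar>x / (y1 * y2) - x / y1\<^sup>2\<bar> = x * \<bar>y1 - y2\<bar> / (y1\<^sup>2 * y2)"
        using x0 y by (simp add: abs_mult)
      also have "\<dots> \<le> x * \<bar>y1 - y2\<bar> / 1"
        using x0 y mult_mono[of 1 "y1\<^sup>2" 1 y2] by (intro divide_left_mono) auto
      also have "\<bar>y1 - y2\<bar> \<le> \<bar>cmod z - cmod \<beta>\<bar>"
        unfolding y1_def y2_def by (rule abs_sqrt_one_plus_diff_le)
      also have "\<bar>cmod z - cmod \<beta>\<bar> \<le> cmod (\<beta> - z)" by (metis norm_minus_commute norm_triangle_ineq3)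
      also have "cmod (\<beta> - z) = x / real n" using n0 by (simp add: x_def)
      finally have "\<bar>x / (y1 * y2) - x / y1\<^sup>2\<bar> \<le> x * (x / real n)" using x0 by (simp add: mult_left_mono)
      also have "\<dots> = x\<^sup>2 / real n" by (simp add: power2_eq_square)
      also have "\<dots> \<le> (2 * R + 1)\<^sup>2 / real n" using x0 xR by (intro divide_right_mono power_mono) auto
      also have "\<dots> \<le> \<eta> / 8" using n\<eta> n0 \<eta> by (simp add: field_simps)
      finally show ?thesis .
    qed
    have 3: "\<bar>x / y1\<^sup>2 - 1 / cmod z\<bar> \<le> \<eta> / 8"
    proof -
      have "x / y1\<^sup>2 - 1 / cmod z = (x - 1 / cmod (V_FS z)) / y1\<^sup>2"
        unfolding V(4) y1sq using one_plus_nz[of z] by (simp add: diff_divide_distrib)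
      hence "\<bar>x / y1\<^sup>2 - 1 / cmod z\<bar> = \<bar>x - 1 / cmod (V_FS z)\<bar> / y1\<^sup>2" by simp
      also have "\<dots> \<le> \<bar>x - 1 / cmod (V_FS z)\<bar> / 1" using y by (intro divide_left_mono) auto
      finally show ?thesis using xV r by simp
    qed
    have fs: "real n * fs_dist z \<beta> = 2 * (real n * arcsin (half_chord z \<beta>))"
      unfolding fs_dist_eq_arcsin by simp
    show "\<bar>real n * fs_dist z \<beta> - 2 / cmod z\<bar> \<le> \<eta>"
    proof -
      have tri: "\<bar>2 * u - 2 * t\<bar> \<le> \<eta>"
        if "\<bar>u - v\<bar> \<le> \<eta> / 4" "\<bar>v - w\<bar> \<le> \<eta> / 8" "\<bar>w - t\<bar> \<le> \<eta> / 8" for t u v w :: real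
        using that \<eta> by linarith
      show ?thesis using tri[OF 1[unfolded hc] 2 3] unfolding fs by simp
    qed
  qed
qed

section \<open>The random zero\<close>

lemma distr_gaussian_coefficients:
  fixes n :: nat and a :: "nat \<Rightarrow> 'w \<Rightarrow> complex"
  assumes "prob_space M" and gauss: "\<And>k. k \<le> n \<Longrightarrow> std_complex_gaussian M (a k)"
    and indep: "prob_space.indep_vars M (\<lambda>_. borel) a {..n}"
  shows "distr M (PiM {..n} (\<lambda>_. borel)) (\<lambda>\<omega>. \<lambda>k\<in>{..n}. a k \<omega>) = PiM {..n} (\<lambda>_. cgauss)"
proof -
  interpret prob_space M by fact
  have meas: "random_variable borel (a k)" if "k \<in> {..n}" for k
    using gauss[of k] that by (simp add: std_complex_gaussian_def distributed_def)
  have "distr M borel (a k) = cgauss" if "k \<in> {..n}" for k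
  proof -
    have "distr M borel (a k) = distr M lborel (a k)" by (rule distr_cong) auto
    thus ?thesis using gauss[of k] that
      by (simp add: std_complex_gaussian_def distributed_distr_eq_density cgauss_def)
  qed
  hence "PiM {..n} (\<lambda>k. distr M borel (a k)) = PiM {..n} (\<lambda>_. cgauss)"
    by (intro PiM_cong) auto
  thus ?thesis using indep_vars_iff_distr_eq_PiM'[where I = "{..n}" and M' = "\<lambda>_. borel" and X = a] meas indep by auto
qed

text \<open>Splitting by the value of the label, independence gives each piece the factor 1/n, and
  what is summed is a statistic over all zeros, as the Kac--Rice formula requires. The predicate
  sees the coefficients too, because badness depends on them.\<close>

lemma emeasure_uniform_zero:
  fixes M :: "'w measure" and a :: "nat \<Rightarrow> 'w \<Rightarrow> complex" and \<zeta> :: "(nat \<Rightarrow> complex) \<Rightarrow> nat \<Rightarrow> complex"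
  assumes "prob_space M" and n: "n \<ge> 1"
    and law: "distr M (PiM {..n} (\<lambda>_. borel)) (\<lambda>\<omega>. \<lambda>k\<in>{..n}. a k \<omega>) = PiM {..n} (\<lambda>_. cgauss)"
    and lab: "zero_labelling n \<zeta>"
    and I_meas: "I \<in> measurable M (count_space {1..n})"
    and I_uniform: "distr M (count_space {1..n}) I = uniform_count_measure {1..n}"
    and I_indep: "indep_var2 M (count_space {1..n}) I (PiM {..n} (\<lambda>_. borel)) (\<lambda>\<omega>. \<lambda>k\<in>{..n}. a k \<omega>)"
    and Q: "Measurable.pred (borel \<Otimes>\<^sub>M PiM {..n} (\<lambda>_. cgauss)) (\<lambda>(z, a). Q z a)"
  defines "A \<equiv> \<lambda>\<omega>. \<lambda>k\<in>{..n}. a k \<omega>"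
  defines "E \<equiv> {\<omega> \<in> space M. Q (\<zeta> (A \<omega>) (I \<omega>)) (A \<omega>)}"
  shows "E \<in> sets M"
    and "emeasure M E = ennreal (1 / real n) *
      (\<integral>\<^sup>+a. (\<Sum>i\<in>{1..n}. indicator {z. Q z a} (\<zeta> a i)) \<partial>PiM {..n} (\<lambda>_. cgauss))"
proof -
  interpret prob_space M by fact
  let ?B = "PiM {..n} (\<lambda>_. borel :: complex measure)" and ?Q = "PiM {..n} (\<lambda>_. cgauss)"
  have A[measurable]: "A \<in> measurable M ?B"
    using I_indep by (simp add: indep_var2_def A_def)
  have A'[measurable]: "A \<in> measurable M ?Q"
    using A unfolding measurable_cong_sets[OF refl sets_PiM_cgauss] .
  have \<zeta>_meas: "(\<lambda>a. \<zeta> a i) \<in> borel_measurable ?Q" if "i \<in> {1..n}" for i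
    using lab that unfolding zero_labelling_def by (simp cong: measurable_cong_sets[OF sets_PiM_cgauss])
  define T where "T = (\<lambda>i. {a \<in> space ?Q. Q (\<zeta> a i) a})"
  have T: "T i \<in> sets ?Q" if "i \<in> {1..n}" for i
  proof -
    have "(\<lambda>a. (\<zeta> a i, a)) \<in> measurable ?Q (borel \<Otimes>\<^sub>M ?Q)" using \<zeta>_meas[OF that] by simp
    from measurable_compose[OF this Q] have "Measurable.pred ?Q (\<lambda>a. Q (\<zeta> a i) a)" by simp
    thus ?thesis unfolding T_def by (simp add: pred_def)
  qed
  define EI where "EI = (\<lambda>i. (I -` {i} \<inter> space M) \<inter> (A -` T i \<inter> space M))"
  have EI_sets: "I -` {i} \<inter> space M \<in> sets M" "A -` T i \<inter> space M \<in> sets M" if "i \<in> {1..n}" for i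
    using measurable_sets[OF I_meas, of "{i}"] measurable_sets[OF A' T[OF that]] that by auto
  have I_range: "I \<omega> \<in> {1..n}" if "\<omega> \<in> space M" for \<omega>
    using measurable_space[OF I_meas that] by simp
  have E_eq: "E = (\<Union>i\<in>{1..n}. EI i)"
    unfolding E_def EI_def T_def using I_range measurable_space[OF A'] by fastforce
  show "E \<in> sets M" unfolding E_eq EI_def using EI_sets by (intro sets.finite_UN) auto
  have "emeasure M E = (\<Sum>i\<in>{1..n}. emeasure M (EI i))"
    unfolding E_eq
    by (rule sum_emeasure[symmetric]) (use EI_sets in \<open>auto simp: EI_def disjoint_family_on_def\<close>)
  also have "\<dots> = (\<Sum>i\<in>{1..n}. ennreal (1 / real n) * emeasure ?Q (T i))"
  proof (rule sum.cong)
    fix i assume i: "i \<in> {1..n}"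
    have "prob (EI i) = prob (I -` {i} \<inter> space M) * prob (A -` T i \<inter> space M)"
      unfolding EI_def
    proof (rule indep_setD)
      show "indep_set {I -` B \<inter> space M |B. B \<in> sets (count_space {1..n})} {A -` B \<inter> space M |B. B \<in> sets ?B}"
        using I_indep unfolding indep_var2_def A_def by blast
      show "I -` {i} \<inter> space M \<in> {I -` B \<inter> space M |B. B \<in> sets (count_space {1..n})}" using i by (intro CollectI exI[of _ "{i}"]) auto
      show "A -` T i \<inter> space M \<in> {A -` B \<inter> space M |B. B \<in> sets ?B}"
        using T[OF i] unfolding sets_PiM_cgauss by blast
    qed
    moreover have "prob (I -` {i} \<inter> space M) = 1 / real n"
    proof -
      have "prob (I -` {i} \<inter> space M) = measure (distr M (count_space {1..n}) I) {i}"
        using i I_meas by (simp add: measure_distr)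
      also have "\<dots> = 1 / real n" unfolding I_uniform using i by (simp add: measure_uniform_count_measure)
      finally show ?thesis .
    qed
    moreover have "emeasure M (A -` T i \<inter> space M) = emeasure ?Q (T i)"
    proof -
      have "T i \<in> sets ?B" using T[OF i] unfolding sets_PiM_cgauss .
      thus ?thesis unfolding law[symmetric] A_def[symmetric] by (simp add: emeasure_distr)
    qed
    moreover have "emeasure M (EI i) = ennreal (prob (EI i))" by (rule emeasure_eq_measure)
    moreover have "ennreal (1 / real n * p) = ennreal (1 / real n) * ennreal p" if "p \<ge> 0" for p
      using that by (intro ennreal_mult) auto
    ultimately show "emeasure M (EI i) = ennreal (1 / real n) * emeasure ?Q (T i)"
      by (metis emeasure_eq_measure measure_nonneg)
  qed simp
  also have "\<dots> = ennreal (1 / real n) * (\<integral>\<^sup>+a. (\<Sum>i\<in>{1..n}. indicator (T i) a) \<partial>?Q)"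
    using T by (subst nn_integral_sum) (simp_all add: sum_distrib_left)
  also have "(\<integral>\<^sup>+a. (\<Sum>i\<in>{1..n}. indicator (T i) a) \<partial>?Q) =
      (\<integral>\<^sup>+a. (\<Sum>i\<in>{1..n}. indicator {z. Q z a} (\<zeta> a i)) \<partial>?Q)"
    by (intro nn_integral_cong sum.cong) (auto simp: T_def indicator_def)
  finally show "emeasure M E = ennreal (1 / real n) *
      (\<integral>\<^sup>+a. (\<Sum>i\<in>{1..n}. indicator {z. Q z a} (\<zeta> a i)) \<partial>?Q)" .
qed

lemma su2_poly_restrict: "su2_poly n (\<lambda>k\<in>{..n}. a k) = su2_poly n a"
  unfolding su2_poly_def by (intro sum.cong) auto

text \<open>Finiteness is what gives \<open>Min\<close> its meaning in the distance D_n.\<close>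

lemma finite_critical_points_su2_poly:
  assumes "n \<ge> 1" "a n \<noteq> 0"
  shows "finite (critical_points (su2_poly n a))"
proof -
  have "pderiv (su2_poly n a) \<noteq> 0"
    using degree_su2_poly[of a n, OF assms(2)] assms(1) by (simp add: pderiv_eq_0_iff)
  thus ?thesis unfolding critical_points_def by (rule poly_roots_finite)
qed

lemma zero_labelling_root:
  assumes lab: "zero_labelling n \<zeta>" and a: "a \<in> PiE {..n} (\<lambda>_. UNIV)" "a n \<noteq> 0" and i: "i \<in> {1..n}"
  shows "poly (su2_poly n a) (\<zeta> a i) = 0"
proof -
  have "su2_poly n a \<noteq> 0" using degree_su2_poly[of a n, OF a(2)] i by auto
  moreover have "\<zeta> a i \<in># proots (su2_poly n a)"
    using lab a i unfolding zero_labelling_def by auto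
  ultimately show ?thesis by simp
qed

text \<open>The condition on \<beta> is an implication because critical points can be absent: for n
  = 1 the derivative is almost surely a nonzero constant. At a good zero with n large their
  existence is proved, so the nearest point is genuine there.\<close>

theorem lemma1p2:
  fixes R :: real
    and M :: "nat \<Rightarrow> 'w measure"
    and a :: "nat \<Rightarrow> nat \<Rightarrow> 'w \<Rightarrow> complex"
    and p :: "nat \<Rightarrow> 'w \<Rightarrow> complex poly"
    and \<zeta> :: "nat \<Rightarrow> (nat \<Rightarrow> complex) \<Rightarrow> nat \<Rightarrow> complex"
    and I :: "nat \<Rightarrow> 'w \<Rightarrow> nat"
    and zI :: "nat \<Rightarrow> 'w \<Rightarrow> complex"
  assumes R: "R > 1"
    and prob: "\<And>n. n \<ge> 1 \<Longrightarrow> prob_space (M n)"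
    and gaussian: "\<And>n k. n \<ge> 1 \<Longrightarrow> k \<le> n \<Longrightarrow> std_complex_gaussian (M n) (a n k)"
    and indep: "\<And>n. n \<ge> 1 \<Longrightarrow> prob_space.indep_vars (M n) (\<lambda>_. borel) (a n) {..n}"
    and p: "\<And>n \<omega>. p n \<omega> = su2_poly n (\<lambda>k. a n k \<omega>)"
    and labelling: "\<And>n. n \<ge> 1 \<Longrightarrow> zero_labelling n (\<zeta> n)"
    and I_meas: "\<And>n. n \<ge> 1 \<Longrightarrow> I n \<in> measurable (M n) (count_space {1..n})"
    and I_uniform: "\<And>n. n \<ge> 1 \<Longrightarrow>
          distr (M n) (count_space {1..n}) (I n) = uniform_count_measure {1..n}"
    and I_indep: "\<And>n. n \<ge> 1 \<Longrightarrow>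
          indep_var2 (M n) (count_space {1..n}) (I n)
            (PiM {..n} (\<lambda>_. borel)) (\<lambda>\<omega>. \<lambda>k\<in>{..n}. a n k \<omega>)"
    and zI: "\<And>n \<omega>. zI n \<omega> = \<zeta> n (\<lambda>k\<in>{..n}. a n k \<omega>) (I n \<omega>)"
  shows "(\<forall>\<beta> :: nat \<Rightarrow> 'w \<Rightarrow> complex.
            (\<forall>n\<ge>1. \<beta> n \<in> borel_measurable (M n) \<and>
               (AE \<omega> in M n. critical_points (p n \<omega>) \<noteq> {} \<longrightarrow>
                  is_arg_min (fs_dist (zI n \<omega>)) (\<lambda>b. b \<in> critical_points (p n \<omega>)) (\<beta> n \<omega>)))
            \<longrightarrow> (\<forall>\<eta>>0. (\<lambda>n. \<P>(\<omega> in M n.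
                   cmod (of_nat n * (\<beta> n \<omega> - zI n \<omega>) + 1 / V_FS (zI n \<omega>)) > \<eta>
                   \<bar> zI n \<omega> \<in> annulus R)) \<longlonglongrightarrow> 0))
       \<and> (\<forall>\<eta>>0. (\<lambda>n. \<P>(\<omega> in M n.
             \<bar>real n * Min (fs_dist (zI n \<omega>) ` critical_points (p n \<omega>)) - 2 / cmod (zI n \<omega>)\<bar> > \<eta>
             \<bar> zI n \<omega> \<in> annulus R)) \<longlonglongrightarrow> 0)"
proof -
  define A where "A = (\<lambda>n \<omega>. \<lambda>k\<in>{..n}. a n k \<omega>)"
  have p_A: "p n \<omega> = su2_poly n (A n \<omega>)" for n \<omega>
    unfolding p A_def su2_poly_restrict ..
  have zI_A: "zI n \<omega> = \<zeta> n (A n \<omega>) (I n \<omega>)" for n \<omega> by (simp add: zI A_def)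
  have law: "distr (M n) (PiM {..n} (\<lambda>_. borel)) (A n) = PiM {..n} (\<lambda>_. cgauss)" if "n \<ge> 1" for n
    unfolding A_def using that by (intro distr_gaussian_coefficients prob gaussian indep)
  \<comment> \<open>Lower bound, uniform in \<open>n\<close>, for the probability of the
    conditioning event; \<open>C \<kappa>\<close> below bounds the expected number of bad zeros in
    the annulus.\<close>
  define c where "c = measure lborel (annulus R) / (pi * (1 + R\<^sup>2)\<^sup>2)"
  have "0 < (1 + R\<^sup>2)\<^sup>2" by (intro zero_less_power add_pos_nonneg) auto
  hence c0: "c > 0" unfolding c_def using measure_annulus_pos[OF R] by simp
  define C where "C = (\<lambda>\<kappa>. measure lborel (annulus R) * exp 1 / (pi * \<kappa>\<^sup>2))"
  have event: "{\<omega> \<in> space (M n). Q (zI n \<omega>) (A n \<omega>)} \<in> sets (M n)"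
      "emeasure (M n) {\<omega> \<in> space (M n). Q (zI n \<omega>) (A n \<omega>)} = ennreal (1 / real n) *
        (\<integral>\<^sup>+a. (\<Sum>i\<in>{1..n}. indicator {z. Q z a} (\<zeta> n a i)) \<partial>PiM {..n} (\<lambda>_. cgauss))"
    if n: "n \<ge> 1" and Q: "Measurable.pred (borel \<Otimes>\<^sub>M PiM {..n} (\<lambda>_. cgauss)) (\<lambda>(z, a). Q z a)" for n Q
    unfolding zI_A A_def
    by (rule emeasure_uniform_zero[OF prob[OF n] n law[OF n, unfolded A_def] labelling[OF n] I_meas[OF n]
          I_uniform[OF n] I_indep[OF n] Q])+
  have prob_annulus: "measure (M n) {\<omega> \<in> space (M n). zI n \<omega> \<in> annulus R} \<ge> c" if n: "n \<ge> 1" for n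
  proof -
    interpret prob_space "M n" by (rule prob[OF n])
    have Q: "Measurable.pred (borel \<Otimes>\<^sub>M PiM {..n} (\<lambda>_. cgauss)) (\<lambda>(z, a). z \<in> annulus R)"
      by measurable
    have "ennreal c = ennreal (1 / real n) * ennreal (real n * c)"
      using n c0 by (simp flip: ennreal_mult)
    also have "\<dots> \<le> ennreal (1 / real n) *
        (\<integral>\<^sup>+a. (\<Sum>i\<in>{1..n}. indicator {z. z \<in> annulus R} (\<zeta> n a i)) \<partial>PiM {..n} (\<lambda>_. cgauss))"
      unfolding c_def Collect_mem_eq by (intro mult_left_mono expected_zeros_annulus_ge n labelling R) auto
    also have "\<dots> = emeasure (M n) {\<omega> \<in> space (M n). zI n \<omega> \<in> annulus R}"
      by (rule event(2)[OF n Q, symmetric])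
    finally show ?thesis using c0 by (simp add: emeasure_eq_measure)
  qed
  define bad where "bad = (\<lambda>\<kappa> n. {\<omega> \<in> space (M n). zI n \<omega> \<in> annulus R \<and> bad_zero \<kappa> n (A n \<omega>) (zI n \<omega>)})"
  have bad: "bad \<kappa> n \<in> sets (M n)" "measure (M n) (bad \<kappa> n) \<le> C \<kappa> / real n" if n: "n \<ge> 1" and \<kappa>: "\<kappa> > 0" for n \<kappa>
  proof -
    interpret prob_space "M n" by (rule prob[OF n])
    have Q: "Measurable.pred (borel \<Otimes>\<^sub>M PiM {..n} (\<lambda>_. cgauss)) (\<lambda>(z, a). z \<in> annulus R \<and> bad_zero \<kappa> n a z)"
      by measurable
    show "bad \<kappa> n \<in> sets (M n)" unfolding bad_def by (rule event(1)[OF n Q])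
    have C0: "C \<kappa> \<ge> 0" unfolding C_def by simp
    have "emeasure (M n) (bad \<kappa> n) = ennreal (1 / real n) *
        (\<integral>\<^sup>+a. (\<Sum>i\<in>{1..n}. indicator {z. z \<in> annulus R \<and> bad_zero \<kappa> n a z} (\<zeta> n a i)) \<partial>PiM {..n} (\<lambda>_. cgauss))"
      unfolding bad_def by (rule event(2)[OF n Q])
    also have "\<dots> = ennreal (1 / real n) * (\<integral>\<^sup>+a. (\<Sum>i\<in>{1..n}. indicator (annulus R) (\<zeta> n a i) *
        indicator {z. bad_zero \<kappa> n a z} (\<zeta> n a i)) \<partial>PiM {..n} (\<lambda>_. cgauss))"
      by (intro arg_cong2[where f = "(*)"] nn_integral_cong sum.cong refl) (auto simp: indicator_def)
    also have "\<dots> \<le> ennreal (1 / real n) * ennreal (C \<kappa>)"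
      unfolding C_def by (intro mult_left_mono expected_bad_zeros_le n labelling \<kappa>) auto
    also have "\<dots> = ennreal (1 / real n * C \<kappa>)"
      by (rule ennreal_mult[symmetric]) (use C0 in auto)
    finally show "measure (M n) (bad \<kappa> n) \<le> C \<kappa> / real n"
      using C0 by (simp add: emeasure_eq_measure)
  qed
  have AE_root: "AE \<omega> in M n. A n \<omega> n \<noteq> 0 \<and> poly (p n \<omega>) (zI n \<omega>) = 0" if n: "n \<ge> 1" for n
  proof -
    have A_meas: "A n \<in> measurable (M n) (PiM {..n} (\<lambda>_. borel))"
      using I_indep[OF n] by (simp add: indep_var2_def A_def)
    have "AE a in distr (M n) (PiM {..n} (\<lambda>_. borel)) (A n). a n \<noteq> 0"
      unfolding law[OF n] by (rule AE_PiM_cgauss_nonzero) simp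
    from AE_distrD[OF A_meas this] AE_space show ?thesis
    proof eventually_elim
      case (elim \<omega>)
      have "A n \<omega> \<in> PiE {..n} (\<lambda>_. UNIV)" by (simp add: A_def)
      moreover have "I n \<omega> \<in> {1..n}" using measurable_space[OF I_meas[OF n] elim(2)] by simp
      ultimately show ?case
        using zero_labelling_root[OF labelling[OF n]] elim(1) by (simp add: p_A zI_A)
    qed
  qed
  \<comment> \<open>Both claims go through this reduction: an event that for large \<open>n\<close>
    almost surely forces a zero in the annulus to be bad has conditional probability at most (C
    \<kappa> / n) / c.\<close>
  have conv: "(\<lambda>n. \<P>(\<omega> in M n. X n \<omega> \<bar> zI n \<omega> \<in> annulus R)) \<longlonglongrightarrow> 0"
    if \<kappa>: "\<kappa> > 0" and X: "\<And>n. n \<ge> N \<Longrightarrow> n \<ge> 1 \<Longrightarrow>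
      AE \<omega> in M n. X n \<omega> \<longrightarrow> zI n \<omega> \<in> annulus R \<longrightarrow> bad_zero \<kappa> n (A n \<omega>) (zI n \<omega>)" for X \<kappa> N
  proof (rule tendsto_sandwich)
    show "\<forall>\<^sub>F n in sequentially. 0 \<le> \<P>(\<omega> in M n. X n \<omega> \<bar> zI n \<omega> \<in> annulus R)"
      by (simp add: cond_prob_def)
    show "\<forall>\<^sub>F n in sequentially. \<P>(\<omega> in M n. X n \<omega> \<bar> zI n \<omega> \<in> annulus R) \<le> C \<kappa> / c / real n"
      using eventually_ge_at_top[of "max N 1"]
    proof eventually_elim
      case (elim n)
      hence n: "n \<ge> N" "n \<ge> 1" by auto
      interpret prob_space "M n" by (rule prob[OF n(2)])
      have "prob {\<omega> \<in> space (M n). X n \<omega> \<and> zI n \<omega> \<in> annulus R} \<le> prob (bad \<kappa> n)"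
        using X[OF n] by (intro finite_measure_mono_AE bad n \<kappa>) (auto simp: bad_def)
      also have "\<dots> \<le> C \<kappa> / real n" by (rule bad[OF n(2) \<kappa>])
      finally have "prob {\<omega> \<in> space (M n). X n \<omega> \<and> zI n \<omega> \<in> annulus R} /
          prob {\<omega> \<in> space (M n). zI n \<omega> \<in> annulus R} \<le> (C \<kappa> / real n) / c"
        using prob_annulus[OF n(2)] c0 by (intro frac_le) (auto simp: C_def)
      thus ?case by (simp add: cond_prob_def mult.commute)
    qed
    show "(\<lambda>n. C \<kappa> / c / real n) \<longlonglongrightarrow> 0" by (rule lim_const_over_n)
  qed simp
  show ?thesis
  proof (intro conjI allI impI)
    fix \<beta> :: "nat \<Rightarrow> 'w \<Rightarrow> complex" and \<eta> :: real
    assume \<beta>: "\<forall>n\<ge>1. \<beta> n \<in> borel_measurable (M n) \<and>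
               (AE \<omega> in M n. critical_points (p n \<omega>) \<noteq> {} \<longrightarrow>
                  is_arg_min (fs_dist (zI n \<omega>)) (\<lambda>b. b \<in> critical_points (p n \<omega>)) (\<beta> n \<omega>))"
      and \<eta>: "\<eta> > 0"
    \<comment> \<open>The localisation of the nearest critical point is available for tolerances up
      to 1, hence the cap.\<close>
    have "0 < min 1 \<eta>" "min 1 \<eta> \<le> 1" using \<eta> by auto
    from nearest_critical_point_of_good_zero[OF R this] obtain \<kappa> N where \<kappa>: "\<kappa> > 0" and
      N: "\<And>n a z \<beta>. n \<ge> N \<Longrightarrow> z \<in> annulus R \<Longrightarrow> poly (su2_poly n a) z = 0 \<Longrightarrow> \<not> bad_zero \<kappa> n a z \<Longrightarrow>
        critical_points (su2_poly n a) \<noteq> {} \<and>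
        (\<beta> \<in> critical_points (su2_poly n a) \<longrightarrow> (\<forall>b\<in>critical_points (su2_poly n a). fs_dist z \<beta> \<le> fs_dist z b) \<longrightarrow>
          cmod (of_nat n * (\<beta> - z) + 1 / V_FS z) < min 1 \<eta>)"
      by metis
    show "(\<lambda>n. \<P>(\<omega> in M n. cmod (of_nat n * (\<beta> n \<omega> - zI n \<omega>) + 1 / V_FS (zI n \<omega>)) > \<eta>
                   \<bar> zI n \<omega> \<in> annulus R)) \<longlonglongrightarrow> 0"
    proof (rule conv[OF \<kappa>])
      fix n assume n: "N \<le> n" "1 \<le> n"
      from \<beta> n(2) have "AE \<omega> in M n. critical_points (p n \<omega>) \<noteq> {} \<longrightarrow>
          is_arg_min (fs_dist (zI n \<omega>)) (\<lambda>b. b \<in> critical_points (p n \<omega>)) (\<beta> n \<omega>)" by blast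
      with AE_root[OF n(2)]
      show "AE \<omega> in M n. cmod (of_nat n * (\<beta> n \<omega> - zI n \<omega>) + 1 / V_FS (zI n \<omega>)) > \<eta> \<longrightarrow>
          zI n \<omega> \<in> annulus R \<longrightarrow> bad_zero \<kappa> n (A n \<omega>) (zI n \<omega>)"
      proof eventually_elim
        case (elim \<omega>)
        show ?case
        proof (intro impI, rule ccontr)
          assume far: "cmod (of_nat n * (\<beta> n \<omega> - zI n \<omega>) + 1 / V_FS (zI n \<omega>)) > \<eta>"
            and z: "zI n \<omega> \<in> annulus R" and good: "\<not> bad_zero \<kappa> n (A n \<omega>) (zI n \<omega>)"
          note near = N[OF n(1) z _ good, folded p_A]
          have "is_arg_min (fs_dist (zI n \<omega>)) (\<lambda>b. b \<in> critical_points (p n \<omega>)) (\<beta> n \<omega>)"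
            using near elim by blast
          hence "\<beta> n \<omega> \<in> critical_points (p n \<omega>)"
            "\<forall>b\<in>critical_points (p n \<omega>). fs_dist (zI n \<omega>) (\<beta> n \<omega>) \<le> fs_dist (zI n \<omega>) b"
            by (auto simp: is_arg_min_linorder)
          thus False using near[of "\<beta> n \<omega>"] elim far by auto
        qed
      qed
    qed
  next
    fix \<eta> :: real assume \<eta>: "\<eta> > 0"
    from fs_dist_asymptotics[OF R \<eta>] obtain r N' where r: "0 < r" "r \<le> 1" and
      N': "\<And>n z \<beta>. n \<ge> N' \<Longrightarrow> z \<in> annulus R \<Longrightarrow> cmod (of_nat n * (\<beta> - z) + 1 / V_FS z) < r \<Longrightarrow>
        \<bar>real n * fs_dist z \<beta> - 2 / cmod z\<bar> \<le> \<eta>"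
      by metis
    \<comment> \<open>The order of choice matters: \<eta> fixes the affine tolerance r, and r then
      fixes \<open>\<kappa>\<close>.\<close>
    from nearest_critical_point_of_good_zero[OF R r] obtain \<kappa> N where \<kappa>: "\<kappa> > 0" and
      N: "\<And>n a z \<beta>. n \<ge> N \<Longrightarrow> z \<in> annulus R \<Longrightarrow> poly (su2_poly n a) z = 0 \<Longrightarrow> \<not> bad_zero \<kappa> n a z \<Longrightarrow>
        critical_points (su2_poly n a) \<noteq> {} \<and>
        (\<beta> \<in> critical_points (su2_poly n a) \<longrightarrow> (\<forall>b\<in>critical_points (su2_poly n a). fs_dist z \<beta> \<le> fs_dist z b) \<longrightarrow>
          cmod (of_nat n * (\<beta> - z) + 1 / V_FS z) < r)"
      by metis
    show "(\<lambda>n. \<P>(\<omega> in M n.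
             \<bar>real n * Min (fs_dist (zI n \<omega>) ` critical_points (p n \<omega>)) - 2 / cmod (zI n \<omega>)\<bar> > \<eta>
             \<bar> zI n \<omega> \<in> annulus R)) \<longlonglongrightarrow> 0"
    proof (rule conv[OF \<kappa>, of "max N N'"])
      fix n assume "max N N' \<le> n" and n1: "1 \<le> n"
      hence n: "N \<le> n" "N' \<le> n" by auto
      from AE_root[OF n1]
      show "AE \<omega> in M n. \<bar>real n * Min (fs_dist (zI n \<omega>) ` critical_points (p n \<omega>)) - 2 / cmod (zI n \<omega>)\<bar> > \<eta> \<longrightarrow>
          zI n \<omega> \<in> annulus R \<longrightarrow> bad_zero \<kappa> n (A n \<omega>) (zI n \<omega>)"
      proof eventually_elim
        case (elim \<omega>)
        show ?case
        proof (intro impI, rule ccontr)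
          assume far: "\<bar>real n * Min (fs_dist (zI n \<omega>) ` critical_points (p n \<omega>)) - 2 / cmod (zI n \<omega>)\<bar> > \<eta>"
            and z: "zI n \<omega> \<in> annulus R" and good: "\<not> bad_zero \<kappa> n (A n \<omega>) (zI n \<omega>)"
          note near = N[OF n(1) z _ good, folded p_A]
          have fin: "finite (critical_points (p n \<omega>))"
            unfolding p_A using elim n1 by (intro finite_critical_points_su2_poly) auto
          moreover have "critical_points (p n \<omega>) \<noteq> {}" using near elim by blast
          ultimately have "Min (fs_dist (zI n \<omega>) ` critical_points (p n \<omega>)) \<in> fs_dist (zI n \<omega>) ` critical_points (p n \<omega>)"
            by (intro Min_in) auto
          \<comment> \<open>No nearest point is given in this claim, so one that attains the minimum
            takes its place; the affine estimate holds for every nearest critical point.\<close>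
          then obtain b where b: "b \<in> critical_points (p n \<omega>)"
            "Min (fs_dist (zI n \<omega>) ` critical_points (p n \<omega>)) = fs_dist (zI n \<omega>) b" by auto
          have "\<forall>b'\<in>critical_points (p n \<omega>). fs_dist (zI n \<omega>) b \<le> fs_dist (zI n \<omega>) b'"
            using fin unfolding b(2)[symmetric] by auto
          hence "cmod (of_nat n * (b - zI n \<omega>) + 1 / V_FS (zI n \<omega>)) < r"
            using near[of b] elim b(1) by blast
          from N'[OF n(2) z this] show False using far unfolding b(2) by simp
        qed
      qed
    qed
  qed
qed

end
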